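(* Let $M$ be an almost complex surface in the nearly Kähler manifold $(SL(2,\mathbb{R})\times SL(2,\mathbb{R}),g,J)$ with parallel second fundamental form. Then one of the following holds. (1) $P$ maps the tangent space of $M$ into the normal space of $M$; in this case $M$ is totally geodesic with constant Gaussian curvature $-\tfrac{4}{3}$, and $M$ is congruent to the surface $$\Sigma_3=\left\{\left(\tfrac12 I+\tfrac{\sqrt3}{2}Y,\ \tfrac12 I-\tfrac{\sqrt3}{2}Y\right)\ :\ Y=\begin{pmatrix} y_1 & y_2+y_3\\ y_2-y_3 & -y_1\end{pmatrix},\ y_1,y_2,y_3\in\mathbb{R},\ y_1^2+y_2^2-y_3^2=-1\right\}.$$ (2) $P$ preserves the tangent space of $M$; in this case the Gaussian curvature of $M$ is $0$, $M$ is totally geodesic, and $M$ is congruent either to the surface $\Sigma_1$ given by the immersion $(s,t)\mapsto(A(s,t),B(s,t))$, $(s,t)\in\mathbb{R}^2$, with $$A(s,t)=\begin{pmatrix} e^{\frac{1}{\sqrt2}(\sqrt3 s-t)}&0\\0&e^{-\frac{1}{\sqrt2}(\sqrt3 s-t)}\end{pmatrix},\qquad B(s,t)=\begin{pmatrix} e^{\frac{1}{\sqrt2}(\sqrt3 s+t)}&0\\0&e^{-\frac{1}{\sqrt2}(\sqrt3 s+t)}\end{pmatrix},$$ or to the surface $\Sigma_2$ given by the immersion $(s,t)\mapsto(A(s,t),B(s,t))$, $(s,t)\in\mathbb{R}^2$, with $$A(s,t)=R\!\left(\tfrac{1}{\sqrt2}(\sqrt3 s-t)\right),\qquad B(s,t)=R\!\left(\tfrac{1}{\sqrt2}(\sqrt3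 s+t)\right),\qquad R(x)=\begin{pmatrix}\cos x&\sin x\\-\sin x&\cos x\end{pmatrix}.$$
   Context: For trace-zero real $2\times2$ matrices put $\langle\alpha,\beta\rangle=\tfrac12\operatorname{Trace}(\alpha\beta)$. One has $T_ASL(2,\mathbb{R})=\{A\alpha:\operatorname{Trace}\alpha=0\}$, so tangent vectors of $SL(2,\mathbb{R})\times SL(2,\mathbb{R})$ at $(A,B)$ are the pairs $(A\alpha,B\beta)$ with $\alpha,\beta$ real $2\times 2$ matrices of trace $0$. The pseudo-Riemannian metric $g$, the almost complex structure $J$ and the almost product structure $P$ are $$g((A\alpha,B\beta),(A\gamma,B\delta))=\tfrac23\big(\langle\alpha,\gamma\rangle+\langle\beta,\delta\rangle\big)-\tfrac13\big(\langle\beta,\gamma\rangle+\langle\alpha,\delta\rangle\big),$$ $$J(A\alpha,B\beta)=\tfrac{1}{\sqrt3}\big(A(\alpha-2\beta),B(2\alpha-\beta)\big),\qquad P(A\alpha,B\beta)=(A\beta,B\alpha).$$ With these, $(SL(2,\mathbb{R})\times SL(2,\mathbb{R}),g,J)$ is a nearly Kähler manifold. An almost complex surface is an immersed 2-dimensional connected submanifold $M$ (with immersion $F$) whose tangent spaces are $J$-invariant; it is always assumed regular, i.e. the metric induced by $g$ is non-degenerate (hence positive or negative definite). Normal spaces, second fundamental form $h$, and Gaussian curvature (of the induced metric) are taken with respect to $g$. Parallel second fundamental form means $(\nabla h)(X,Y,Z)=\nabla^\perp_X h(Y,Z)-h(\nabla_XY,Z)-h(Y,\nabla_XZ)=0$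 for all tangent $X,Y,Z$; totally geodesic means $h=0$. $M$ is said to be congruent to a surface $\Sigma\subset SL(2,\mathbb{R})\times SL(2,\mathbb{R})$ if there is an isometry $\Phi$ of $(SL(2,\mathbb{R})\times SL(2,\mathbb{R}),g)$ such that $\Phi(F(M))$ is an open part of $\Sigma$. *)

theory Defs
  imports "HOL-Analysis.Analysis"
begin

section \<open>Smooth maps on open subsets of Euclidean spaces\<close>

text \<open>On open sets these are the usual classes \<open>C\<^sup>n\<close> and \<open>C\<^sup>\<infinity>\<close>: in finite dimension,
  continuity of all iterated directional derivatives is continuity of the iterated derivatives.\<close>

primrec Cn_on :: "nat \<Rightarrow> 'a::euclidean_space set \<Rightarrow> ('a \<Rightarrow> 'b::real_normed_vector) \<Rightarrow> bool" where
  "Cn_on 0 S f = continuous_on S f"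
| "Cn_on (Suc n) S f =
    ((\<forall>x\<in>S. f differentiable at x) \<and> (\<forall>v. Cn_on n S (\<lambda>x. frechet_derivative f (at x) v)))"

definition smooth_on :: "'a::euclidean_space set \<Rightarrow> ('a \<Rightarrow> 'b::real_normed_vector) \<Rightarrow> bool" where
  "smooth_on S f \<longleftrightarrow> (\<forall>n. Cn_on n S f)"


section \<open>The nearly Kaehler manifold \<open>SL(2,\<real>) \<times> SL(2,\<real>)\<close>\<close>

type_synonym mat2 = "real^2^2"
type_synonym mat2_pair = "mat2 \<times> mat2"

text \<open>The product is regarded as a submanifold of the 8-dimensional Euclidean space of pairs of
  matrices; tangent vectors are elements of that space.\<close>

definition SL2xSL2 :: "mat2_pair set" where
  "SL2xSL2 = {(A, B). det A = 1 \<and> det B = 1}"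

definition tangent_SL2xSL2 :: "mat2_pair \<Rightarrow> mat2_pair set" where
  "tangent_SL2xSL2 p = {(fst p ** \<alpha>, snd p ** \<beta>) | \<alpha> \<beta>. trace \<alpha> = 0 \<and> trace \<beta> = 0}"

definition ip :: "mat2 \<Rightarrow> mat2 \<Rightarrow> real" where
  "ip \<alpha> \<beta> = 1/2 * trace (\<alpha> ** \<beta>)"

definition gNK :: "mat2_pair \<Rightarrow> mat2_pair \<Rightarrow> mat2_pair \<Rightarrow> real" where
  "gNK p v w =
    (let \<alpha> = matrix_inv (fst p) ** fst v; \<beta> = matrix_inv (snd p) ** snd v;
         \<gamma> = matrix_inv (fst p) ** fst w; \<delta> = matrix_inv (snd p) ** snd w
     in 2/3 * (ip \<alpha> \<gamma> + ip \<beta> \<delta>) - 1/3 * (ip \<beta> \<gamma> + ip \<alpha> \<delta>))"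

definition J_NK :: "mat2_pair \<Rightarrow> mat2_pair \<Rightarrow> mat2_pair" where
  "J_NK p v =
    (let \<alpha> = matrix_inv (fst p) ** fst v; \<beta> = matrix_inv (snd p) ** snd v
     in (1 / sqrt 3) *\<^sub>R (fst p ** (\<alpha> - 2 *\<^sub>R \<beta>), snd p ** (2 *\<^sub>R \<alpha> - \<beta>)))"

definition P_NK :: "mat2_pair \<Rightarrow> mat2_pair \<Rightarrow> mat2_pair" where
  "P_NK p v =
    (let \<alpha> = matrix_inv (fst p) ** fst v; \<beta> = matrix_inv (snd p) ** snd v
     in (fst p ** \<beta>, snd p ** \<alpha>))"


section \<open>The Levi-Civita connection of \<open>gNK\<close>\<close>

text \<open>Local vector fields are given by smooth maps on open sets of the ambient space that are
  tangent along the submanifold.\<close>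

definition tangent_field :: "mat2_pair set \<Rightarrow> (mat2_pair \<Rightarrow> mat2_pair) \<Rightarrow> bool" where
  "tangent_field U Y \<longleftrightarrow>
    open U \<and> smooth_on U Y \<and> (\<forall>q \<in> U \<inter> SL2xSL2. Y q \<in> tangent_SL2xSL2 q)"

text \<open>Two covariant derivatives of a field differ by a tensor. Hence every affine connection on the
  submanifold has the form \<open>\<nabla>\<^sub>v Y = DY(p) v + C p v (Y p)\<close>, with \<open>DY\<close> the derivative in the ambient
  space and \<open>C p\<close> bilinear on the tangent space at \<open>p\<close> (with values in the ambient space, so that the
  sum is tangent).\<close>

definition covd ::
  "(mat2_pair \<Rightarrow> mat2_pair \<Rightarrow> mat2_pair \<Rightarrow> mat2_pair) \<Rightarrow>
    (mat2_pair \<Rightarrow> mat2_pair) \<Rightarrow> mat2_pair \<Rightarrow> mat2_pair \<Rightarrow> mat2_pair" where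
  "covd C Y p v = frechet_derivative Y (at p) v + C p v (Y p)"

definition affine_connection ::
  "(mat2_pair \<Rightarrow> mat2_pair \<Rightarrow> mat2_pair \<Rightarrow> mat2_pair) \<Rightarrow> bool" where
  "affine_connection C \<longleftrightarrow>
    (\<forall>p\<in>SL2xSL2. \<forall>u\<in>tangent_SL2xSL2 p. \<forall>v\<in>tangent_SL2xSL2 p. \<forall>w\<in>tangent_SL2xSL2 p. \<forall>a b.
        C p (a *\<^sub>R u + b *\<^sub>R v) w = a *\<^sub>R C p u w + b *\<^sub>R C p v w \<and>
        C p w (a *\<^sub>R u + b *\<^sub>R v) = a *\<^sub>R C p w u + b *\<^sub>R C p w v) \<and>
    (\<forall>U Y. tangent_field U Y \<longrightarrow>
      (\<forall>p \<in> U \<inter> SL2xSL2. \<forall>v \<in> tangent_SL2xSL2 p. covd C Y p v \<in> tangent_SL2xSL2 p))"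

definition torsion_free ::
  "(mat2_pair \<Rightarrow> mat2_pair \<Rightarrow> mat2_pair \<Rightarrow> mat2_pair) \<Rightarrow> bool" where
  "torsion_free C \<longleftrightarrow>
    (\<forall>U X Y. tangent_field U X \<and> tangent_field U Y \<longrightarrow>
      (\<forall>p \<in> U \<inter> SL2xSL2.
        covd C Y p (X p) - covd C X p (Y p) =
        frechet_derivative Y (at p) (X p) - frechet_derivative X (at p) (Y p)))"

definition metric_connection ::
  "(mat2_pair \<Rightarrow> mat2_pair \<Rightarrow> mat2_pair \<Rightarrow> mat2_pair) \<Rightarrow> bool" where
  "metric_connection C \<longleftrightarrow>
    (\<forall>U Y Z. tangent_field U Y \<and> tangent_field U Z \<longrightarrow>
      (\<forall>p \<in> U \<inter> SL2xSL2. \<forall>v \<in> tangent_SL2xSL2 p.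
        frechet_derivative (\<lambda>q. gNK q (Y q) (Z q)) (at p) v =
        gNK p (covd C Y p v) (Z p) + gNK p (Y p) (covd C Z p v)))"

definition levi_civita ::
  "(mat2_pair \<Rightarrow> mat2_pair \<Rightarrow> mat2_pair \<Rightarrow> mat2_pair) \<Rightarrow> bool" where
  "levi_civita C \<longleftrightarrow> affine_connection C \<and> torsion_free C \<and> metric_connection C"

text \<open>Existence, and uniqueness on tangent vectors, are proved in \<open>levi_civita_LC\<close> and
  \<open>levi_civita_unique\<close> at the end of this theory.\<close>

definition LC :: "mat2_pair \<Rightarrow> mat2_pair \<Rightarrow> mat2_pair \<Rightarrow> mat2_pair" where
  "LC = (SOME C. levi_civita C)"


section \<open>Metrics on open subsets of the plane\<close>

text \<open>A metric in local coordinates assigns to each point a bilinear form. The next function is the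
  Koszul formula for the Levi-Civita connection on constant (hence commuting) fields \<open>x, y, w\<close>.\<close>

definition christoffel ::
  "(real^2 \<Rightarrow> real^2 \<Rightarrow> real^2 \<Rightarrow> real) \<Rightarrow> real^2 \<Rightarrow> real^2 \<Rightarrow> real^2 \<Rightarrow> real^2" where
  "christoffel G u x y =
    (THE z. \<forall>w. 2 * G u z w =
        frechet_derivative (\<lambda>s. G s y w) (at u) x
      + frechet_derivative (\<lambda>s. G s x w) (at u) y
      - frechet_derivative (\<lambda>s. G s x y) (at u) w)"

definition coord_nabla ::
  "(real^2 \<Rightarrow> real^2 \<Rightarrow> real^2 \<Rightarrow> real) \<Rightarrow>
    (real^2 \<Rightarrow> real^2) \<Rightarrow> (real^2 \<Rightarrow> real^2) \<Rightarrow> real^2 \<Rightarrow> real^2" where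
  "coord_nabla G X Y u = frechet_derivative Y (at u) (X u) + christoffel G u (X u) (Y u)"

text \<open>\<open>R(x,y)z\<close>, computed with constant fields, so that the bracket term vanishes.\<close>

definition riemann ::
  "(real^2 \<Rightarrow> real^2 \<Rightarrow> real^2 \<Rightarrow> real) \<Rightarrow> real^2 \<Rightarrow> real^2 \<Rightarrow> real^2 \<Rightarrow> real^2 \<Rightarrow> real^2" where
  "riemann G u x y z =
    coord_nabla G (\<lambda>_. x) (coord_nabla G (\<lambda>_. y) (\<lambda>_. z)) u
    - coord_nabla G (\<lambda>_. y) (coord_nabla G (\<lambda>_. x) (\<lambda>_. z)) u"

definition gauss_curvature :: "(real^2 \<Rightarrow> real^2 \<Rightarrow> real^2 \<Rightarrow> real) \<Rightarrow> real^2 \<Rightarrow> real" where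
  "gauss_curvature G u =
    (let x = axis 1 1; y = axis 2 1
     in G u (riemann G u x y y) x / (G u x x * G u y y - (G u x y)\<^sup>2))"


section \<open>Immersed surfaces\<close>

text \<open>An abstract smooth surface is a topology \<open>M\<close> together with an atlas; a chart is a pair of its
  domain and the coordinate map.\<close>

type_synonym 'a chart = "'a set \<times> ('a \<Rightarrow> real^2)"

definition smooth_surface :: "'a topology \<Rightarrow> 'a chart set \<Rightarrow> bool" where
  "smooth_surface M \<A> \<longleftrightarrow>
    Hausdorff_space M \<and> second_countable M \<and>
    (\<Union>(U, \<phi>)\<in>\<A>. U) = topspace M \<and>
    (\<forall>(U, \<phi>)\<in>\<A>. openin M U \<and> open (\<phi> ` U) \<and>
       homeomorphic_map (subtopology M U) (top_of_set (\<phi> ` U)) \<phi>) \<and>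
    (\<forall>(U, \<phi>)\<in>\<A>. \<forall>(V, \<psi>)\<in>\<A>. smooth_on (\<phi> ` (U \<inter> V)) (\<psi> \<circ> inv_into U \<phi>))"

text \<open>The local parametrizations \<open>f = F \<circ> \<phi>\<^sup>-\<^sup>1\<close> of \<open>F\<close>, each with its domain \<open>D = \<phi>(U)\<close>.\<close>

definition local_params ::
  "'a chart set \<Rightarrow> ('a \<Rightarrow> mat2_pair) \<Rightarrow> ((real^2) set \<times> (real^2 \<Rightarrow> mat2_pair)) set" where
  "local_params \<A> F = (\<lambda>(U, \<phi>). (\<phi> ` U, F \<circ> inv_into U \<phi>)) ` \<A>"

definition immersion :: "'a topology \<Rightarrow> 'a chart set \<Rightarrow> ('a \<Rightarrow> mat2_pair) \<Rightarrow> bool" where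
  "immersion M \<A> F \<longleftrightarrow>
    F ` topspace M \<subseteq> SL2xSL2 \<and>
    (\<forall>(D, f)\<in>local_params \<A> F.
       smooth_on D f \<and> (\<forall>u\<in>D. inj (frechet_derivative f (at u))))"

definition tangent_plane :: "(real^2 \<Rightarrow> mat2_pair) \<Rightarrow> real^2 \<Rightarrow> mat2_pair set" where
  "tangent_plane f u = range (frechet_derivative f (at u))"

definition normal_space :: "(real^2 \<Rightarrow> mat2_pair) \<Rightarrow> real^2 \<Rightarrow> mat2_pair set" where
  "normal_space f u =
    {w \<in> tangent_SL2xSL2 (f u). \<forall>t \<in> tangent_plane f u. gNK (f u) w t = 0}"

definition induced_metric ::
  "(real^2 \<Rightarrow> mat2_pair) \<Rightarrow> real^2 \<Rightarrow> real^2 \<Rightarrow> real^2 \<Rightarrow> real" where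
  "induced_metric f u x y =
    gNK (f u) (frechet_derivative f (at u) x) (frechet_derivative f (at u) y)"

definition almost_complex_surface ::
  "'a topology \<Rightarrow> 'a chart set \<Rightarrow> ('a \<Rightarrow> mat2_pair) \<Rightarrow> bool" where
  "almost_complex_surface M \<A> F \<longleftrightarrow>
    smooth_surface M \<A> \<and> connected_space M \<and> immersion M \<A> F \<and>
    (\<forall>(D, f)\<in>local_params \<A> F. \<forall>u\<in>D.
       J_NK (f u) ` tangent_plane f u \<subseteq> tangent_plane f u \<and>
       (\<forall>x. (\<forall>y. induced_metric f u x y = 0) \<longrightarrow> x = 0))"


section \<open>Second fundamental form\<close>

text \<open>The decomposition into tangential and normal part exists and is unique because the induced
  metric is non-degenerate.\<close>

definition tangential_part :: "(real^2 \<Rightarrow> mat2_pair) \<Rightarrow> real^2 \<Rightarrow> mat2_pair \<Rightarrow> mat2_pair" where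
  "tangential_part f u w = (THE t. t \<in> tangent_plane f u \<and> w - t \<in> normal_space f u)"

definition normal_part :: "(real^2 \<Rightarrow> mat2_pair) \<Rightarrow> real^2 \<Rightarrow> mat2_pair \<Rightarrow> mat2_pair" where
  "normal_part f u w = w - tangential_part f u w"

text \<open>The Levi-Civita connection of \<open>gNK\<close> pulled back along \<open>f\<close>: the covariant derivative in direction
  \<open>X\<close> of a vector field \<open>V\<close> along \<open>f\<close>.\<close>

definition nabla_along ::
  "(real^2 \<Rightarrow> mat2_pair) \<Rightarrow> (real^2 \<Rightarrow> real^2) \<Rightarrow> (real^2 \<Rightarrow> mat2_pair) \<Rightarrow> real^2 \<Rightarrow> mat2_pair" where
  "nabla_along f X V u =
    frechet_derivative V (at u) (X u) + LC (f u) (frechet_derivative f (at u) (X u)) (V u)"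

definition second_ff ::
  "(real^2 \<Rightarrow> mat2_pair) \<Rightarrow> (real^2 \<Rightarrow> real^2) \<Rightarrow> (real^2 \<Rightarrow> real^2) \<Rightarrow> real^2 \<Rightarrow> mat2_pair" where
  "second_ff f X Y u =
    normal_part f u (nabla_along f X (\<lambda>s. frechet_derivative f (at s) (Y s)) u)"

definition normal_nabla ::
  "(real^2 \<Rightarrow> mat2_pair) \<Rightarrow> (real^2 \<Rightarrow> real^2) \<Rightarrow> (real^2 \<Rightarrow> mat2_pair) \<Rightarrow> real^2 \<Rightarrow> mat2_pair" where
  "normal_nabla f X \<xi> u = normal_part f u (nabla_along f X \<xi> u)"

definition nabla_second_ff ::
  "(real^2 \<Rightarrow> mat2_pair) \<Rightarrow> (real^2 \<Rightarrow> real^2) \<Rightarrow> (real^2 \<Rightarrow> real^2) \<Rightarrow> (real^2 \<Rightarrow> real^2) \<Rightarrow>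
    real^2 \<Rightarrow> mat2_pair" where
  "nabla_second_ff f X Y Z u =
    normal_nabla f X (second_ff f Y Z) u
    - second_ff f (coord_nabla (induced_metric f) X Y) Z u
    - second_ff f Y (coord_nabla (induced_metric f) X Z) u"

definition parallel_second_ff :: "'a chart set \<Rightarrow> ('a \<Rightarrow> mat2_pair) \<Rightarrow> bool" where
  "parallel_second_ff \<A> F \<longleftrightarrow>
    (\<forall>(D, f)\<in>local_params \<A> F. \<forall>X Y Z.
       smooth_on D X \<and> smooth_on D Y \<and> smooth_on D Z \<longrightarrow>
       (\<forall>u\<in>D. nabla_second_ff f X Y Z u = 0))"

definition totally_geodesic :: "'a chart set \<Rightarrow> ('a \<Rightarrow> mat2_pair) \<Rightarrow> bool" where
  "totally_geodesic \<A> F \<longleftrightarrow>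
    (\<forall>(D, f)\<in>local_params \<A> F. \<forall>X Y. smooth_on D X \<and> smooth_on D Y \<longrightarrow>
       (\<forall>u\<in>D. second_ff f X Y u = 0))"

definition constant_gauss_curvature :: "'a chart set \<Rightarrow> ('a \<Rightarrow> mat2_pair) \<Rightarrow> real \<Rightarrow> bool" where
  "constant_gauss_curvature \<A> F c \<longleftrightarrow>
    (\<forall>(D, f)\<in>local_params \<A> F. \<forall>u\<in>D. gauss_curvature (induced_metric f) u = c)"

definition P_tangent_to_normal :: "'a chart set \<Rightarrow> ('a \<Rightarrow> mat2_pair) \<Rightarrow> bool" where
  "P_tangent_to_normal \<A> F \<longleftrightarrow>
    (\<forall>(D, f)\<in>local_params \<A> F. \<forall>u\<in>D. P_NK (f u) ` tangent_plane f u \<subseteq> normal_space f u)"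

definition P_preserves_tangent :: "'a chart set \<Rightarrow> ('a \<Rightarrow> mat2_pair) \<Rightarrow> bool" where
  "P_preserves_tangent \<A> F \<longleftrightarrow>
    (\<forall>(D, f)\<in>local_params \<A> F. \<forall>u\<in>D. P_NK (f u) ` tangent_plane f u = tangent_plane f u)"


section \<open>Congruence\<close>

text \<open>A map defined on \<open>SL2xSL2\<close> is smooth if it extends locally to smooth maps of the ambient space.
  On tangent vectors, the derivative of an extension does not depend on the extension.\<close>

definition local_extension ::
  "(mat2_pair \<Rightarrow> mat2_pair) \<Rightarrow> mat2_pair \<Rightarrow> mat2_pair set \<Rightarrow> (mat2_pair \<Rightarrow> mat2_pair) \<Rightarrow> bool" where
  "local_extension \<Phi> p U \<Psi> \<longleftrightarrow>
    open U \<and> p \<in> U \<and> smooth_on U \<Psi> \<and> (\<forall>q \<in> U \<inter> SL2xSL2. \<Psi> q = \<Phi> q)"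

definition smooth_map :: "(mat2_pair \<Rightarrow> mat2_pair) \<Rightarrow> bool" where
  "smooth_map \<Phi> \<longleftrightarrow> (\<forall>p\<in>SL2xSL2. \<exists>U \<Psi>. local_extension \<Phi> p U \<Psi>)"

definition isometry :: "(mat2_pair \<Rightarrow> mat2_pair) \<Rightarrow> bool" where
  "isometry \<Phi> \<longleftrightarrow>
    bij_betw \<Phi> SL2xSL2 SL2xSL2 \<and> smooth_map \<Phi> \<and> smooth_map (inv_into SL2xSL2 \<Phi>) \<and>
    (\<forall>p\<in>SL2xSL2. \<forall>U \<Psi>. local_extension \<Phi> p U \<Psi> \<longrightarrow>
       (\<forall>v\<in>tangent_SL2xSL2 p. \<forall>w\<in>tangent_SL2xSL2 p.
          gNK (\<Phi> p) (frechet_derivative \<Psi> (at p) v) (frechet_derivative \<Psi> (at p) w) = gNK p v w))"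

text \<open>``Open part'' refers to the subspace topology.\<close>

definition congruent_to ::
  "'a topology \<Rightarrow> ('a \<Rightarrow> mat2_pair) \<Rightarrow> mat2_pair set \<Rightarrow> bool" where
  "congruent_to M F \<Sigma> \<longleftrightarrow>
    (\<exists>\<Phi>. isometry \<Phi> \<and> openin (top_of_set \<Sigma>) (\<Phi> ` F ` topspace M))"


section \<open>The model surfaces\<close>

definition exp_diag :: "real \<Rightarrow> mat2" where
  "exp_diag x = vector [vector [exp x, 0], vector [0, exp (- x)]]"

definition rot :: "real \<Rightarrow> mat2" where
  "rot x = vector [vector [cos x, sin x], vector [- sin x, cos x]]"

definition Sigma1 :: "mat2_pair set" where
  "Sigma1 = {(exp_diag (1 / sqrt 2 * (sqrt 3 * s - t)), exp_diag (1 / sqrt 2 * (sqrt 3 * s + t)))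
              | s t. True}"

definition Sigma2 :: "mat2_pair set" where
  "Sigma2 = {(rot (1 / sqrt 2 * (sqrt 3 * s - t)), rot (1 / sqrt 2 * (sqrt 3 * s + t)))
              | s t. True}"

definition Sigma3 :: "mat2_pair set" where
  "Sigma3 =
    {((1/2) *\<^sub>R mat 1 + (sqrt 3 / 2) *\<^sub>R Y, (1/2) *\<^sub>R mat 1 - (sqrt 3 / 2) *\<^sub>R Y) | Y y1 y2 y3.
       Y = vector [vector [y1, y2 + y3], vector [y2 - y3, - y1]] \<and>
       y1\<^sup>2 + y2\<^sup>2 - y3\<^sup>2 = (-1::real)}"


section \<open>Existence and uniqueness of the Levi-Civita connection\<close>

text \<open>With \<open>u = (A\<alpha>, B\<beta>)\<close> and \<open>v = (A\<gamma>, B\<delta>)\<close>:\<close>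

definition LC_formula :: "mat2_pair \<Rightarrow> mat2_pair \<Rightarrow> mat2_pair \<Rightarrow> mat2_pair" where
  "LC_formula p u v =
    (let \<alpha> = matrix_inv (fst p) ** fst u; \<beta> = matrix_inv (snd p) ** snd u;
         \<gamma> = matrix_inv (fst p) ** fst v; \<delta> = matrix_inv (snd p) ** snd v;
         \<kappa> = (1/6) *\<^sub>R ((\<alpha> ** \<delta> - \<delta> ** \<alpha>) - (\<beta> ** \<gamma> - \<gamma> ** \<beta>))
     in (- (fst p ** ((1/2) *\<^sub>R (\<alpha> ** \<gamma> + \<gamma> ** \<alpha>) + \<kappa>)),
         - (snd p ** ((1/2) *\<^sub>R (\<beta> ** \<delta> + \<delta> ** \<beta>) - \<kappa>))))"

lemma bounded_bilinear_mat2_mult: "bounded_bilinear ((**) :: mat2 \<Rightarrow> mat2 \<Rightarrow> mat2)"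
  unfolding bilinear_conv_bounded_bilinear[symmetric] bilinear_def linear_iff
  by (auto simp: vec_eq_iff matrix_matrix_mult_def forall_2 sum_2 algebra_simps)

interpretation mat2_mult: bounded_bilinear "(**) :: mat2 \<Rightarrow> mat2 \<Rightarrow> mat2"
  by (rule bounded_bilinear_mat2_mult)

lemma linear_trace_mat2: "linear (trace :: mat2 \<Rightarrow> real)"
  unfolding linear_iff by (auto simp: trace_def sum_2 algebra_simps)

lemmas trace_mat2_linear =
  linear_add[OF linear_trace_mat2] linear_diff[OF linear_trace_mat2]
  linear_cmul[OF linear_trace_mat2] linear_neg[OF linear_trace_mat2]

lemma trace_mat2_has_derivative:
  "(f has_derivative f') F \<Longrightarrow> ((\<lambda>x. trace (f x :: mat2)) has_derivative (\<lambda>x. trace (f' x))) F"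
  by (rule bounded_linear.has_derivative)
     (simp add: linear_conv_bounded_linear[symmetric] linear_trace_mat2)

definition adj2 :: "mat2 \<Rightarrow> mat2" where
  "adj2 A = vector [vector [A$2$2, - A$1$2], vector [- A$2$1, A$1$1]]"

lemma linear_adj2: "linear adj2"
  unfolding linear_iff by (auto simp: adj2_def vec_eq_iff forall_2)

lemma matrix_inv_unique_mat2:
  fixes A :: mat2
  assumes "A ** B = mat 1" "B ** A = mat 1"
  shows "matrix_inv A = B"
proof -
  have "A ** matrix_inv A = mat 1 \<and> matrix_inv A ** A = mat 1"
    unfolding matrix_inv_def by (rule someI[of _ B]) (use assms in auto)
  then show ?thesis
    using assms by (metis matrix_mul_assoc matrix_mul_lid matrix_mul_rid)
qed

lemma matrix_inv_mat2:
  fixes A :: mat2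
  assumes "det A \<noteq> 0"
  shows "matrix_inv A = (1 / det A) *\<^sub>R adj2 A"
    and "A ** matrix_inv A = mat 1" and "matrix_inv A ** A = mat 1"
proof -
  have "A ** adj2 A = det A *\<^sub>R mat 1" "adj2 A ** A = det A *\<^sub>R mat 1"
    by (simp_all add: vec_eq_iff forall_2 matrix_matrix_mult_def sum_2 adj2_def mat_def det_2
        algebra_simps)
  then have "A ** ((1 / det A) *\<^sub>R adj2 A) = mat 1" "((1 / det A) *\<^sub>R adj2 A) ** A = mat 1"
    using assms by (simp_all add: mat2_mult.scaleR_left mat2_mult.scaleR_right)
  then show "matrix_inv A = (1 / det A) *\<^sub>R adj2 A" "A ** matrix_inv A = mat 1"
    "matrix_inv A ** A = mat 1"
    using matrix_inv_unique_mat2 by metis+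
qed

lemma mat2_nth_has_derivative: "((\<lambda>A::mat2. A$i$j) has_derivative (\<lambda>V. V$i$j)) F"
  by (intro bounded_linear_imp_has_derivative bounded_linear_compose[OF bounded_linear_vec_nth]
      bounded_linear_vec_nth)

lemma det_mat2_has_derivative:
  "((\<lambda>A::mat2. det A) has_derivative (\<lambda>V. trace (adj2 A ** V))) (at A)"
  unfolding det_2 trace_def sum_2 matrix_matrix_mult_def adj2_def
  by (auto intro!: derivative_eq_intros mat2_nth_has_derivative simp: algebra_simps)

lemma open_det_nonzero: "open {A::mat2. det A \<noteq> 0}"
proof -
  have "continuous_on UNIV (\<lambda>A::mat2. det A)"
    by (rule has_derivative_continuous_on) (rule det_mat2_has_derivative[THEN has_derivative_at_withinI])
  then show ?thesis by (auto intro!: open_Collect_neq continuous_intros)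
qed

lemma matrix_inv_has_derivative:
  fixes A :: mat2
  assumes "det A \<noteq> 0"
  shows "(matrix_inv has_derivative (\<lambda>V. - (matrix_inv A ** V ** matrix_inv A))) (at A)"
proof -
  have bl: "bounded_linear adj2"
    by (simp add: linear_conv_bounded_linear[symmetric] linear_adj2)
  have d: "A$1$1 * A$2$2 - A$1$2 * A$2$1 \<noteq> 0" using assms by (simp add: det_2)
  have 1: "((\<lambda>A. (1 / det A) *\<^sub>R adj2 A) has_derivative
      (\<lambda>V. (1 / det A) *\<^sub>R adj2 V + (- trace (adj2 A ** V) / (det A)\<^sup>2) *\<^sub>R adj2 A)) (at A)"
    by (rule derivative_eq_intros det_mat2_has_derivative
          bounded_linear.has_derivative[OF bl] refl assms)+
       (use assms in \<open>auto simp: power2_eq_square field_simps\<close>)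
  have 2: "(1 / det A) *\<^sub>R adj2 V + (- trace (adj2 A ** V) / (det A)\<^sup>2) *\<^sub>R adj2 A
      = - (matrix_inv A ** V ** matrix_inv A)" for V
    unfolding matrix_inv_mat2(1)[OF assms]
    using d
    by (simp add: vec_eq_iff forall_2 matrix_matrix_mult_def sum_2 adj2_def det_2 trace_def
         divide_simps power2_eq_square) (simp add: algebra_simps)
  show ?thesis
    using 1 unfolding 2
    by (rule has_derivative_transform_within_open[OF _ open_det_nonzero])
       (use assms in \<open>auto simp: matrix_inv_mat2(1)\<close>)
qed

lemma SL2xSL2_det: "p \<in> SL2xSL2 \<Longrightarrow> det (fst p) \<noteq> 0 \<and> det (snd p) \<noteq> 0"
  by (auto simp: SL2xSL2_def)

lemma matrix_inv_cancel:
  assumes "p \<in> SL2xSL2"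
  shows "matrix_inv (fst p) ** (fst p ** X) = X" "matrix_inv (snd p) ** (snd p ** X) = X"
    "fst p ** (matrix_inv (fst p) ** X) = X" "snd p ** (matrix_inv (snd p) ** X) = X"
  using SL2xSL2_det[OF assms] by (simp_all add: matrix_mul_assoc matrix_inv_mat2(2,3))

lemma tangent_iff:
  assumes "p \<in> SL2xSL2"
  shows "v \<in> tangent_SL2xSL2 p \<longleftrightarrow>
    trace (matrix_inv (fst p) ** fst v) = 0 \<and> trace (matrix_inv (snd p) ** snd v) = 0"
proof
  assume "trace (matrix_inv (fst p) ** fst v) = 0 \<and> trace (matrix_inv (snd p) ** snd v) = 0"
  moreover have "v = (fst p ** (matrix_inv (fst p) ** fst v), snd p ** (matrix_inv (snd p) ** snd v))"
    by (simp add: matrix_inv_cancel[OF assms])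
  ultimately show "v \<in> tangent_SL2xSL2 p"
    unfolding tangent_SL2xSL2_def by blast
qed (auto simp: tangent_SL2xSL2_def matrix_inv_cancel[OF assms])

lemma smooth_on_differentiable:
  assumes "smooth_on S f" "x \<in> S" shows "f differentiable at x"
  using assms(1)[unfolded smooth_on_def, rule_format, of 1] assms(2) by simp

lemma smooth_on_has_derivative:
  "smooth_on S f \<Longrightarrow> x \<in> S \<Longrightarrow> (f has_derivative frechet_derivative f (at x)) (at x)"
  by (rule frechet_derivative_works[THEN iffD1, OF smooth_on_differentiable])

lemma smooth_on_linear:
  assumes "linear f" shows "smooth_on S f"
proof -
  have c: "Cn_on n S (\<lambda>x. c)" for n and c :: 'b
    by (induction n arbitrary: c) (auto simp: frechet_derivative_const)
  have bl: "bounded_linear f"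
    using assms by (simp add: linear_conv_bounded_linear)
  have f': "frechet_derivative f (at x) = f" for x
    using bounded_linear_imp_has_derivative[OF bl] by (rule frechet_derivative_at[symmetric])
  have "Cn_on n S f" for n
    by (cases n) (auto simp: f' c bounded_linear_imp_differentiable[OF bl]
        intro!: linear_continuous_on bl)
  then show ?thesis by (simp add: smooth_on_def)
qed

lemma left_translate_has_derivative:
  fixes Y :: "mat2_pair \<Rightarrow> mat2_pair"
  assumes p: "p \<in> SL2xSL2" and Y: "(Y has_derivative Y') (at p)"
  shows "((\<lambda>q. matrix_inv (fst q) ** fst (Y q)) has_derivative
      (\<lambda>v. matrix_inv (fst p) ** fst (Y' v)
         - matrix_inv (fst p) ** fst v ** (matrix_inv (fst p) ** fst (Y p)))) (at p)"
    and "((\<lambda>q. matrix_inv (snd q) ** snd (Y q)) has_derivative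
      (\<lambda>v. matrix_inv (snd p) ** snd (Y' v)
         - matrix_inv (snd p) ** snd v ** (matrix_inv (snd p) ** snd (Y p)))) (at p)"
proof -
  have 1: "((\<lambda>q::mat2_pair. matrix_inv (fst q)) has_derivative
      (\<lambda>v. - (matrix_inv (fst p) ** fst v ** matrix_inv (fst p)))) (at p)"
    using matrix_inv_has_derivative[of "fst p"] SL2xSL2_det[OF p]
    by (auto intro!: has_derivative_compose[of fst fst, simplified] derivative_eq_intros)
  have 2: "((\<lambda>q::mat2_pair. matrix_inv (snd q)) has_derivative
      (\<lambda>v. - (matrix_inv (snd p) ** snd v ** matrix_inv (snd p)))) (at p)"
    using matrix_inv_has_derivative[of "snd p"] SL2xSL2_det[OF p]
    by (auto intro!: has_derivative_compose[of snd snd, simplified] derivative_eq_intros)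
  show "((\<lambda>q. matrix_inv (fst q) ** fst (Y q)) has_derivative
      (\<lambda>v. matrix_inv (fst p) ** fst (Y' v)
         - matrix_inv (fst p) ** fst v ** (matrix_inv (fst p) ** fst (Y p)))) (at p)"
    using mat2_mult.FDERIV[OF 1 has_derivative_fst[OF Y]]
    by (simp add: mat2_mult.minus_left matrix_mul_assoc)
  show "((\<lambda>q. matrix_inv (snd q) ** snd (Y q)) has_derivative
      (\<lambda>v. matrix_inv (snd p) ** snd (Y' v)
         - matrix_inv (snd p) ** snd v ** (matrix_inv (snd p) ** snd (Y p)))) (at p)"
    using mat2_mult.FDERIV[OF 2 has_derivative_snd[OF Y]]
    by (simp add: mat2_mult.minus_left matrix_mul_assoc)
qed

text \<open>Every tangent vector is the velocity of a curve, obtained by normalizing \<open>A(I + t\<alpha>)\<close>.\<close>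

lemma SL2_curve:
  fixes A \<alpha> :: mat2
  assumes "det A = 1" "trace \<alpha> = 0"
  obtains c where "c 0 = A" "(c has_derivative (\<lambda>t. t *\<^sub>R (A ** \<alpha>))) (at 0)"
    "\<forall>\<^sub>F t in at 0. det (c t) = 1"
proof
  define c where "c t = (1 / sqrt (1 + t\<^sup>2 * det \<alpha>)) *\<^sub>R (A + t *\<^sub>R (A ** \<alpha>))" for t :: real
  show "c 0 = A" by (simp add: c_def)
  show "(c has_derivative (\<lambda>t. t *\<^sub>R (A ** \<alpha>))) (at 0)"
    unfolding c_def by (auto intro!: derivative_eq_intros)
  have lim: "((\<lambda>t::real. 1 + t\<^sup>2 * det \<alpha>) \<longlongrightarrow> 1 + 0\<^sup>2 * det \<alpha>) (at 0)"
    by (intro tendsto_intros)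
  have "\<forall>\<^sub>F t::real in at 0. 0 < 1 + t\<^sup>2 * det \<alpha>"
    by (rule order_tendstoD(1)[OF lim]) simp
  then show "\<forall>\<^sub>F t in at 0. det (c t) = 1"
  proof eventually_elim
    case (elim t)
    have tr: "\<alpha>$2$2 = - \<alpha>$1$1" using assms(2) by (simp add: trace_def sum_2)
    have dA: "A$1$1 * A$2$2 - A$1$2 * A$2$1 = 1" using assms(1) by (simp add: det_2)
    have "det (A + t *\<^sub>R (A ** \<alpha>)) =
        (A$1$1 * A$2$2 - A$1$2 * A$2$1) * (1 + t\<^sup>2 * det \<alpha>)"
      by (simp add: det_2 matrix_matrix_mult_def sum_2 tr power2_eq_square) (simp add: algebra_simps)
    then have "det (A + t *\<^sub>R (A ** \<alpha>)) = 1 + t\<^sup>2 * det \<alpha>" by (simp add: dA)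
    moreover have "det (k *\<^sub>R B) = k\<^sup>2 * det B" for k and B :: mat2
      by (simp add: det_2 power2_eq_square algebra_simps)
    ultimately show ?case
      using elim by (simp add: c_def power_divide)
  qed
qed

lemma SL2xSL2_curve:
  assumes p: "p \<in> SL2xSL2" and v: "v \<in> tangent_SL2xSL2 p"
  obtains c where "c 0 = p" "(c has_derivative (\<lambda>t. t *\<^sub>R v)) (at 0)"
    "\<forall>\<^sub>F t in at (0::real). c t \<in> SL2xSL2"
proof -
  obtain \<alpha> \<beta> where v: "v = (fst p ** \<alpha>, snd p ** \<beta>)" "trace \<alpha> = 0" "trace \<beta> = 0"
    using v by (auto simp: tangent_SL2xSL2_def)
  have d: "det (fst p) = 1" "det (snd p) = 1" using p by (auto simp: SL2xSL2_def)
  obtain c1 where c1: "c1 0 = fst p" "(c1 has_derivative (\<lambda>t. t *\<^sub>R (fst p ** \<alpha>))) (at 0)"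
    "\<forall>\<^sub>F t in at 0. det (c1 t) = 1"
    by (rule SL2_curve[OF d(1) v(2)])
  obtain c2 where c2: "c2 0 = snd p" "(c2 has_derivative (\<lambda>t. t *\<^sub>R (snd p ** \<beta>))) (at 0)"
    "\<forall>\<^sub>F t in at 0. det (c2 t) = 1"
    by (rule SL2_curve[OF d(2) v(3)])
  have "((\<lambda>t. (c1 t, c2 t)) has_derivative (\<lambda>t. t *\<^sub>R v)) (at 0)"
    using has_derivative_Pair[OF c1(2) c2(2)] by (simp add: v(1))
  moreover have "\<forall>\<^sub>F t in at 0. (c1 t, c2 t) \<in> SL2xSL2"
    using c1(3) c2(3) by eventually_elim (simp add: SL2xSL2_def)
  ultimately show ?thesis using that[of "\<lambda>t. (c1 t, c2 t)"] c1(1) c2(1) by simp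
qed

lemma derivative_zero_along:
  fixes \<phi> :: "mat2_pair \<Rightarrow> real"
  assumes p: "p \<in> SL2xSL2" and v: "v \<in> tangent_SL2xSL2 p"
    and U: "open U" "p \<in> U" "\<And>q. q \<in> U \<inter> SL2xSL2 \<Longrightarrow> \<phi> q = 0"
    and \<phi>: "(\<phi> has_derivative \<phi>') (at p)"
  shows "\<phi>' v = 0"
proof -
  obtain c where c: "c 0 = p" "(c has_derivative (\<lambda>t. t *\<^sub>R v)) (at (0::real))"
    "\<forall>\<^sub>F t in at (0::real). c t \<in> SL2xSL2"
    using SL2xSL2_curve[OF p v] .
  have 1: "((\<lambda>t. \<phi> (c t)) has_derivative (\<lambda>t. \<phi>' (t *\<^sub>R v))) (at 0)"
    by (rule has_derivative_compose[OF c(2)]) (simp add: c(1) \<phi>)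
  have "(c \<longlongrightarrow> p) (at 0)"
    using has_derivative_continuous[OF c(2)] by (simp add: continuous_at c(1) isCont_def)
  then have "\<forall>\<^sub>F t in at 0. c t \<in> U" using U(1,2) by (rule topological_tendstoD)
  then have "\<forall>\<^sub>F t in at 0. \<phi> (c t) = 0"
    using c(3) by eventually_elim (use U(3) in auto)
  then have "((\<lambda>t::real. 0::real) has_derivative (\<lambda>t. \<phi>' (t *\<^sub>R v))) (at 0)"
    using has_derivative_transform_eventually[OF 1] U(2,3) p c(1) by simp
  then have "(\<lambda>t. \<phi>' (t *\<^sub>R v)) = (\<lambda>t::real. 0)"
    using has_derivative_unique has_derivative_const by blast
  from fun_cong[OF this, of 1] show ?thesis by simp
qed

lemma tangent_field_derivative:
  assumes Y: "tangent_field U Y" and p: "p \<in> U \<inter> SL2xSL2" and v: "v \<in> tangent_SL2xSL2 p"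
  shows "trace (matrix_inv (fst p) ** fst (frechet_derivative Y (at p) v)) =
      trace (matrix_inv (fst p) ** fst v ** (matrix_inv (fst p) ** fst (Y p)))"
    and "trace (matrix_inv (snd p) ** snd (frechet_derivative Y (at p) v)) =
      trace (matrix_inv (snd p) ** snd v ** (matrix_inv (snd p) ** snd (Y p)))"
proof -
  have p': "p \<in> SL2xSL2" "p \<in> U" and U: "open U" "smooth_on U Y"
    using p Y by (auto simp: tangent_field_def)
  have 0: "trace (matrix_inv (fst q) ** fst (Y q)) = 0" "trace (matrix_inv (snd q) ** snd (Y q)) = 0"
    if "q \<in> U \<inter> SL2xSL2" for q
    using Y that tangent_iff[of q "Y q"] by (auto simp: tangent_field_def)
  note D = left_translate_has_derivative[OF p'(1) smooth_on_has_derivative[OF U(2) p'(2)],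
      THEN trace_mat2_has_derivative]
  show "trace (matrix_inv (fst p) ** fst (frechet_derivative Y (at p) v)) =
      trace (matrix_inv (fst p) ** fst v ** (matrix_inv (fst p) ** fst (Y p)))"
    using derivative_zero_along[OF p'(1) v U(1) p'(2) 0(1) D(1)] by (simp add: trace_mat2_linear)
  show "trace (matrix_inv (snd p) ** snd (frechet_derivative Y (at p) v)) =
      trace (matrix_inv (snd p) ** snd v ** (matrix_inv (snd p) ** snd (Y p)))"
    using derivative_zero_along[OF p'(1) v U(1) p'(2) 0(2) D(2)] by (simp add: trace_mat2_linear)
qed

lemma LC_formula_left:
  assumes "p \<in> SL2xSL2"
  defines "A \<equiv> matrix_inv (fst p)" and "B \<equiv> matrix_inv (snd p)"
  shows "A ** fst (LC_formula p u v) =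
      - ((1/2) *\<^sub>R (A ** fst u ** (A ** fst v) + A ** fst v ** (A ** fst u))
         + (1/6) *\<^sub>R ((A ** fst u ** (B ** snd v) - B ** snd v ** (A ** fst u))
                   - (B ** snd u ** (A ** fst v) - A ** fst v ** (B ** snd u))))"
    and "B ** snd (LC_formula p u v) =
      - ((1/2) *\<^sub>R (B ** snd u ** (B ** snd v) + B ** snd v ** (B ** snd u))
         - (1/6) *\<^sub>R ((A ** fst u ** (B ** snd v) - B ** snd v ** (A ** fst u))
                   - (B ** snd u ** (A ** fst v) - A ** fst v ** (B ** snd u))))"
  unfolding LC_formula_def Let_def A_def B_def
  by (simp_all add: mat2_mult.minus_right matrix_inv_cancel[OF assms(1)])

lemma pair_eqI_left:
  assumes "p \<in> SL2xSL2"
    and "matrix_inv (fst p) ** fst x = matrix_inv (fst p) ** fst y"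
    and "matrix_inv (snd p) ** snd x = matrix_inv (snd p) ** snd y"
  shows "x = y"
  using matrix_inv_cancel(3,4)[OF assms(1)] assms(2,3) by (metis prod.collapse)

lemma affine_connection_LC_formula: "affine_connection LC_formula"
  unfolding affine_connection_def
proof (intro conjI ballI allI impI)
  fix p u v w :: mat2_pair and a b :: real
  show "LC_formula p (a *\<^sub>R u + b *\<^sub>R v) w = a *\<^sub>R LC_formula p u w + b *\<^sub>R LC_formula p v w"
    "LC_formula p w (a *\<^sub>R u + b *\<^sub>R v) = a *\<^sub>R LC_formula p w u + b *\<^sub>R LC_formula p w v"
    by (simp_all add: LC_formula_def Let_def prod_eq_iff mat2_mult.add_left mat2_mult.add_right
        mat2_mult.scaleR_left mat2_mult.scaleR_right mat2_mult.diff_right algebra_simps)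
next
  fix U Y p v assume a: "tangent_field U Y" "p \<in> U \<inter> SL2xSL2" "v \<in> tangent_SL2xSL2 p"
  then have p: "p \<in> SL2xSL2" by simp
  have c: "trace (X ** Z) = trace (Z ** X)" for X Z :: mat2 by (rule trace_mul_sym)
  show "covd LC_formula Y p v \<in> tangent_SL2xSL2 p"
    unfolding tangent_iff[OF p] covd_def fst_add snd_add mat2_mult.add_right
      LC_formula_left[OF p] trace_mat2_linear tangent_field_derivative[OF a]
    by (simp add: c[of "matrix_inv (fst p) ** fst v"] c[of "matrix_inv (snd p) ** snd v"])
qed

lemma torsion_free_LC_formula: "torsion_free LC_formula"
  unfolding torsion_free_def covd_def
proof (intro allI impI ballI)
  fix U X Y p assume "tangent_field U X \<and> tangent_field U Y" "p \<in> U \<inter> SL2xSL2"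
  then have p: "p \<in> SL2xSL2" by simp
  have "LC_formula p (X p) (Y p) = LC_formula p (Y p) (X p)"
    by (rule pair_eqI_left[OF p]; unfold LC_formula_left[OF p]) (simp_all add: algebra_simps)
  then show "frechet_derivative Y (at p) (X p) + LC_formula p (X p) (Y p) -
      (frechet_derivative X (at p) (Y p) + LC_formula p (Y p) (X p)) =
      frechet_derivative Y (at p) (X p) - frechet_derivative X (at p) (Y p)" by simp
qed

lemma linear_ip: "ip (X + Y) Z = ip X Z + ip Y Z" "ip (X - Y) Z = ip X Z - ip Y Z"
  "ip (- X) Z = - ip X Z" "ip (r *\<^sub>R X) Z = r * ip X Z"
  "ip Z (X + Y) = ip Z X + ip Z Y" "ip Z (X - Y) = ip Z X - ip Z Y"
  "ip Z (- X) = - ip Z X" "ip Z (r *\<^sub>R X) = r * ip Z X"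
  by (simp_all add: ip_def mat2_mult.add_left mat2_mult.add_right mat2_mult.diff_left
      mat2_mult.diff_right mat2_mult.minus_left mat2_mult.minus_right mat2_mult.scaleR_left
      mat2_mult.scaleR_right trace_mat2_linear algebra_simps)

lemma ip_has_derivative:
  assumes "(f has_derivative f') (at p)" "(h has_derivative h') (at p)"
  shows "((\<lambda>q. ip (f q) (h q)) has_derivative (\<lambda>v. ip (f p) (h' v) + ip (f' v) (h p))) (at p)"
  unfolding ip_def
  by (rule derivative_eq_intros trace_mat2_has_derivative mat2_mult.FDERIV assms refl)+
     (simp add: trace_mat2_linear algebra_simps)

lemma ip_trilinear:
  fixes x y z :: mat2
  assumes "trace x = 0" "trace y = 0" "trace z = 0"
  shows "ip y (x ** z) = - ip x (y ** z)" "ip y (z ** x) = ip x (y ** z)"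
    "ip (x ** y) z = ip x (y ** z)" "ip (y ** x) z = - ip x (y ** z)"
proof -
  have [simp]: "x$2$2 = - x$1$1" "y$2$2 = - y$1$1" "z$2$2 = - z$1$1"
    using assms by (simp_all add: trace_def sum_2)
  show "ip y (x ** z) = - ip x (y ** z)" "ip y (z ** x) = ip x (y ** z)"
    "ip (x ** y) z = ip x (y ** z)" "ip (y ** x) z = - ip x (y ** z)"
    by (simp_all add: ip_def trace_def matrix_matrix_mult_def sum_2 algebra_simps)
qed

lemma metric_connection_LC_formula: "metric_connection LC_formula"
  unfolding metric_connection_def
proof (intro allI impI ballI)
  fix U Y Z p v
  assume a: "tangent_field U Y \<and> tangent_field U Z" "p \<in> U \<inter> SL2xSL2" "v \<in> tangent_SL2xSL2 p"
  then have p: "p \<in> SL2xSL2" and Y: "(Y has_derivative frechet_derivative Y (at p)) (at p)"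
    and Z: "(Z has_derivative frechet_derivative Z (at p)) (at p)"
    by (auto simp: tangent_field_def intro!: smooth_on_has_derivative)
  note D = left_translate_has_derivative[OF p Y] left_translate_has_derivative[OF p Z]
  have t: "v \<in> tangent_SL2xSL2 p" "Y p \<in> tangent_SL2xSL2 p" "Z p \<in> tangent_SL2xSL2 p"
    using a by (auto simp: tangent_field_def)
  define A B where AB: "A = matrix_inv (fst p)" "B = matrix_inv (snd p)"
  define a b \<gamma> \<delta> \<epsilon> \<zeta> where defs: "a = A ** fst v" "b = B ** snd v" "\<gamma> = A ** fst (Y p)" "\<delta> = B ** snd (Y p)"
    "\<epsilon> = A ** fst (Z p)" "\<zeta> = B ** snd (Z p)"
  have t0: "trace a = 0" "trace b = 0" "trace \<gamma> = 0" "trace \<delta> = 0" "trace \<epsilon> = 0" "trace \<zeta> = 0"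
    using t unfolding tangent_iff[OF p] defs AB by auto
  note tri =
    ip_trilinear[OF t0(1) t0(3) t0(5)] ip_trilinear[OF t0(1) t0(3) t0(6)]
    ip_trilinear[OF t0(1) t0(4) t0(5)] ip_trilinear[OF t0(1) t0(4) t0(6)]
    ip_trilinear[OF t0(2) t0(3) t0(5)] ip_trilinear[OF t0(2) t0(3) t0(6)]
    ip_trilinear[OF t0(2) t0(4) t0(5)] ip_trilinear[OF t0(2) t0(4) t0(6)]
  have "((\<lambda>q. gNK q (Y q) (Z q)) has_derivative
     (\<lambda>v. 2/3 * ((ip (A ** fst (Y p)) (A ** fst (frechet_derivative Z (at p) v)
                - A ** fst v ** (A ** fst (Z p)))
              + ip (A ** fst (frechet_derivative Y (at p) v) - A ** fst v ** (A ** fst (Y p)))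
                  (A ** fst (Z p)))
           + (ip (B ** snd (Y p)) (B ** snd (frechet_derivative Z (at p) v)
                - B ** snd v ** (B ** snd (Z p)))
              + ip (B ** snd (frechet_derivative Y (at p) v) - B ** snd v ** (B ** snd (Y p)))
                  (B ** snd (Z p))))
        - 1/3 * ((ip (B ** snd (Y p)) (A ** fst (frechet_derivative Z (at p) v)
                - A ** fst v ** (A ** fst (Z p)))
              + ip (B ** snd (frechet_derivative Y (at p) v) - B ** snd v ** (B ** snd (Y p)))
                  (A ** fst (Z p)))
           + (ip (A ** fst (Y p)) (B ** snd (frechet_derivative Z (at p) v)
                - B ** snd v ** (B ** snd (Z p)))
              + ip (A ** fst (frechet_derivative Y (at p) v) - A ** fst v ** (A ** fst (Y p)))
                  (B ** snd (Z p)))))) (at p)"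
    unfolding gNK_def Let_def AB
    by (intro has_derivative_diff has_derivative_add has_derivative_mult_right ip_has_derivative D)
  note fd = fun_cong[OF frechet_derivative_at[OF this, symmetric], of v, folded defs]
  show "frechet_derivative (\<lambda>q. gNK q (Y q) (Z q)) (at p) v =
      gNK p (covd LC_formula Y p v) (Z p) + gNK p (Y p) (covd LC_formula Z p v)"
    unfolding fd
    unfolding gNK_def Let_def covd_def fst_add snd_add mat2_mult.add_right AB[symmetric]
      LC_formula_left[OF p, folded AB] defs[symmetric] linear_ip
    by (simp add: tri field_simps)
qed

theorem levi_civita_LC_formula: "levi_civita LC_formula"
  unfolding levi_civita_def
  using affine_connection_LC_formula torsion_free_LC_formula metric_connection_LC_formula by blast

theorem levi_civita_LC: "levi_civita LC"
  unfolding LC_def by (rule someI[of levi_civita, OF levi_civita_LC_formula])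

text \<open>Left-invariant fields are restrictions of linear maps.\<close>

lemma left_invariant_field:
  assumes p: "p \<in> SL2xSL2" and v: "v \<in> tangent_SL2xSL2 p"
  obtains Y where "tangent_field UNIV Y" "Y p = v"
proof -
  obtain \<alpha> \<beta> where v: "v = (fst p ** \<alpha>, snd p ** \<beta>)" "trace \<alpha> = 0" "trace \<beta> = 0"
    using v by (auto simp: tangent_SL2xSL2_def)
  have "linear (\<lambda>q::mat2_pair. (fst q ** \<alpha>, snd q ** \<beta>))"
    unfolding linear_iff by (auto simp: mat2_mult.add_left mat2_mult.scaleR_left)
  then have "tangent_field UNIV (\<lambda>q. (fst q ** \<alpha>, snd q ** \<beta>))"
    using v(2,3) by (auto simp: tangent_field_def tangent_SL2xSL2_def intro!: smooth_on_linear)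
  then show ?thesis using that v(1) by auto
qed

lemma gNK_add: "gNK p (u + v) w = gNK p u w + gNK p v w" "gNK p w (u + v) = gNK p w u + gNK p w v"
  "gNK p (u - v) w = gNK p u w - gNK p v w" "gNK p w (u - v) = gNK p w u - gNK p w v"
  by (simp_all add: gNK_def Let_def mat2_mult.add_right mat2_mult.diff_right linear_ip field_simps)

lemma ip_commute: "ip X Y = ip Y X"
  unfolding ip_def by (simp add: trace_mul_sym[of X Y])

lemma gNK_commute: "gNK p v w = gNK p w v"
  by (simp add: gNK_def Let_def ip_commute)

lemma ip_nondegenerate:
  assumes "trace X = 0" "\<And>Y. trace Y = 0 \<Longrightarrow> ip X Y = 0"
  shows "X = 0"
proof -
  have X: "X$2$2 = - X$1$1" using assms(1) by (simp add: trace_def sum_2)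
  have "trace (vector [vector [a, b], vector [c, -a]] :: mat2) = 0" for a b c
    by (simp add: trace_def sum_2)
  from assms(2)[OF this] have "X$1$1 * a + X$1$2 * c + (X$2$1 * b + X$1$1 * a) = 0" for a b c
    by (simp add: ip_def trace_def sum_2 matrix_matrix_mult_def X)
  from this[of 1 0 0] this[of 0 1 0] this[of 0 0 1] show ?thesis
    by (simp add: vec_eq_iff forall_2 X)
qed

lemma gNK_nondegenerate:
  assumes p: "p \<in> SL2xSL2" and v: "v \<in> tangent_SL2xSL2 p"
    and 0: "\<And>w. w \<in> tangent_SL2xSL2 p \<Longrightarrow> gNK p v w = 0"
  shows "v = 0"
proof -
  define \<alpha> \<beta> where ab: "\<alpha> = matrix_inv (fst p) ** fst v" "\<beta> = matrix_inv (snd p) ** snd v"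
  have t: "trace \<alpha> = 0" "trace \<beta> = 0" using v tangent_iff[OF p] by (auto simp: ab)
  have *: "2/3 * (ip \<alpha> \<gamma> + ip \<beta> \<delta>) - 1/3 * (ip \<beta> \<gamma> + ip \<alpha> \<delta>) = 0"
    if "trace \<gamma> = 0" "trace \<delta> = 0" for \<gamma> \<delta>
  proof -
    have "(fst p ** \<gamma>, snd p ** \<delta>) \<in> tangent_SL2xSL2 p"
      using that by (auto simp: tangent_SL2xSL2_def)
    from 0[OF this] show ?thesis by (simp add: gNK_def Let_def ab matrix_inv_cancel[OF p])
  qed
  have z: "ip \<alpha> Y = 0" "ip \<beta> Y = 0" if "trace Y = 0" for Y
    using *[OF that, of 0] *[OF _ that, of 0] linear_0[OF linear_trace_mat2]
    by (simp_all add: ip_def)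
  have "\<alpha> = 0" "\<beta> = 0" using ip_nondegenerate t z by blast+
  then show ?thesis
    by (intro pair_eqI_left[OF p]) (simp_all add: ab[symmetric])
qed

theorem levi_civita_unique:
  assumes C: "levi_civita C" and C': "levi_civita C'"
    and p: "p \<in> SL2xSL2" and u: "u \<in> tangent_SL2xSL2 p" and v: "v \<in> tangent_SL2xSL2 p"
  shows "C p u v = C' p u v"
proof -
  define S where "S x y = C p x y - C' p x y" for x y
  let ?T = "tangent_SL2xSL2 p"
  have diff_T: "x - y \<in> ?T" if "x \<in> ?T" "y \<in> ?T" for x y
    using that unfolding tangent_iff[OF p] by (simp add: mat2_mult.diff_right trace_mat2_linear)
  have S: "S x y \<in> ?T" and sym: "S x y = S y x"
    and skew: "\<And>z. z \<in> ?T \<Longrightarrow> gNK p (S x y) z + gNK p y (S x z) = 0"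
    if x: "x \<in> ?T" and y: "y \<in> ?T" for x y
  proof -
    obtain X where X: "tangent_field UNIV X" "X p = x" using left_invariant_field[OF p x] .
    obtain Y where Y: "tangent_field UNIV Y" "Y p = y" using left_invariant_field[OF p y] .
    have d: "S x y = covd C Y p x - covd C' Y p x" by (simp add: S_def covd_def Y(2))
    have "covd C Y p x \<in> ?T" "covd C' Y p x \<in> ?T"
      using C C' Y(1) p x by (force simp: levi_civita_def affine_connection_def)+
    then show "S x y \<in> ?T" unfolding d by (rule diff_T)
    have "covd K Y p x - covd K X p y =
        frechet_derivative Y (at p) x - frechet_derivative X (at p) y" if "levi_civita K" for K
      using that X Y p unfolding levi_civita_def torsion_free_def by force
    from this[OF C] this[OF C'] show "S x y = S y x"
      by (simp add: S_def covd_def X(2) Y(2) algebra_simps)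
    fix z assume z: "z \<in> ?T"
    obtain Z where Z: "tangent_field UNIV Z" "Z p = z" using left_invariant_field[OF p z] .
    have "frechet_derivative (\<lambda>q. gNK q (Y q) (Z q)) (at p) x =
        gNK p (covd K Y p x) z + gNK p y (covd K Z p x)" if "levi_civita K" for K
      using that Y Z p x unfolding levi_civita_def metric_connection_def by force
    from this[OF C] this[OF C'] show "gNK p (S x y) z + gNK p y (S x z) = 0"
      by (simp add: S_def covd_def Y(2) Z(2) gNK_add)
  qed
  have "gNK p (S u v) w = 0" if w: "w \<in> ?T" for w
    using skew[OF u v w] skew[OF v w u] skew[OF w u v] sym[OF u v] sym[OF v w] sym[OF u w]
    by (simp add: gNK_commute[of p v] gNK_commute[of p w] gNK_commute[of p u])
  then have "S u v = 0" using gNK_nondegenerate[OF p S[OF u v]] by blast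
  then show ?thesis by (simp add: S_def)
qed

end

theory Submission
  imports Defs
begin

text \<open>
  Left translation identifies every tangent space of \<open>SL(2,\<real>) \<times> SL(2,\<real>)\<close> with the space of
  pairs \<open>(\<alpha>, \<beta>)\<close> of traceless matrices. Let \<open>\<omega> = (-1 + i\<surd>3)/2\<close>. Then
  \<open>(\<alpha>, \<beta>) \<mapsto> Z = \<omega>\<alpha> + \<omega>\<^sup>2\<beta>\<close> identifies this space with \<open>sl(2,\<complex>)\<close> in such a way that \<open>J\<close> is
  multiplication by \<open>i\<close>, \<open>P\<close> is complex conjugation and \<open>g(Z, W)\<close> is two thirds of the real part
  of the product of \<open>Z\<close> with the conjugate of \<open>W\<close>. The tangent planes of an almost complex surface
  are complex lines on which \<open>g\<close> is definite. The proof works with pairs of real matrices, but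
  this picture is behind all of its computations.

  The two cases come from the Codazzi equation: if the second fundamental form is parallel, then
  \<open>R(X, JX)X\<close> is tangent. For \<open>X = (\<alpha>, \<beta>)\<close> and \<open>\<gamma> = [\<alpha>, \<beta>]\<close> this curvature is a multiple of
  \<open>([\<alpha>, \<gamma>], [\<beta>, \<gamma>])\<close>. It lies in the plane spanned by \<open>X\<close> and \<open>JX\<close> only if \<open>\<gamma> = 0\<close>, which
  means that \<open>Z\<close> is proportional to its conjugate and \<open>P\<close> preserves the plane, or if
  \<open>\<langle>\<alpha>, \<alpha>\<rangle> = \<langle>\<beta>, \<beta>\<rangle> = 2\<langle>\<alpha>, \<beta>\<rangle>\<close>, which means that \<open>\<langle>Z, Z\<rangle> = 0\<close> and \<open>P\<close> maps the plane into
  its normal space (\<open>pointwise_dichotomy\<close>). Both conditions are closed and they exclude each other,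
  so on a connected surface one of them holds everywhere (\<open>commuting_or_null\<close>).

  If \<open>\<gamma> = 0\<close>, each tangent plane consists of the pairs of multiples of one traceless matrix \<open>X\<close>. All
  brackets vanish, and the Maurer-Cartan equation forces the line through \<open>X\<close> to be constant
  (\<open>axis_locally_constant\<close>), so the surface is flat and totally geodesic. Moreover \<open>A X A\<^sup>-\<^sup>1\<close> and
  \<open>B X B\<^sup>-\<^sup>1\<close> are constant (\<open>conj_axis_constant\<close>). After a left translation \<open>A\<close> and \<open>B\<close> therefore commute
  with \<open>X\<close>, and conjugating \<open>X\<close> into a diagonal matrix or into a generator of the rotations gives
  the models \<open>Sigma1\<close> and \<open>Sigma2\<close>.

  In the null case the plane determines a timelike unit matrix \<open>N\<close>, a multiple of \<open>\<gamma>\<close>. Left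
  multiplication by \<open>N\<close> is a complex structure on the orthogonal complement of \<open>N\<close>, and the plane is
  the graph of the rotation by \<open>\<pi>/3\<close> there. By the Maurer-Cartan equation the derivative of \<open>N\<close> is
  a known complex linear map plus an antilinear map, and the antilinear map amounts to the second
  fundamental form, whose values are pairs of multiples of \<open>N\<close>. If it is parallel, comparing linear and
  antilinear parts of its derivative orthogonally to \<open>N\<close> shows that it vanishes
  (\<open>sff_and_umb_zero\<close>). Then \<open>A (1/2 + \<surd>3/2 N)\<close> and \<open>B (1/2 - \<surd>3/2 N)\<close> are constant (\<open>frame_constant\<close>),
  and left translation by the inverses of these constants moves the surface into \<open>Sigma3\<close>.

  The image is open in the model because a linear projection to the plane restricts to a local
  coordinate of the model and has injective derivative along the surface (\<open>open_immersed_image\<close>).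
\<close>

section \<open>Mixed second derivatives and smooth maps\<close>

text \<open>The mean value theorem in direction \<open>v\<close> turns the second difference into a difference of
  values of the derivative in direction \<open>v\<close>, to which the differentiability at \<open>x\<close> alone applies. The
  second difference is symmetric in \<open>v\<close> and \<open>w\<close>, which is why mixed derivatives commute.\<close>

lemma second_difference_limit:
  fixes g :: "'a::real_normed_vector \<Rightarrow> real"
  assumes D: "open D" "x \<in> D" and g: "\<And>y. y \<in> D \<Longrightarrow> (g has_derivative g' y) (at y)"
    and L: "((\<lambda>y. g' y v) has_derivative L) (at x)"
  shows "((\<lambda>t. (g (x + t *\<^sub>R v + t *\<^sub>R w) - g (x + t *\<^sub>R v) - g (x + t *\<^sub>R w) + g x) / t\<^sup>2) \<longlongrightarrow> L w)
    (at_right 0)"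
proof (rule tendstoI)
  fix e :: real assume e: "0 < e"
  define C where "C = norm v + norm w + 1"
  have C: "C > 0" "norm v \<le> C" "norm w \<le> C" "norm v + norm w \<le> C" by (auto simp: C_def add_nonneg_pos)
  interpret L: bounded_linear L using L by (rule has_derivative_bounded_linear)
  obtain r where r: "r > 0" "ball x r \<subseteq> D" using D by (meson openE)
  have "e / (4 * C) > 0" using e C by simp
  from has_derivative_at_alt[THEN iffD1, OF L, THEN conjunct2, rule_format, OF this]
  obtain d where d: "d > 0"
    "\<And>y. norm (y - x) < d \<Longrightarrow> norm (g' y v - g' x v - L (y - x)) \<le> e / (4 * C) * norm (y - x)"
    by blast
  have "\<forall>\<^sub>F t in at_right 0. t < min r d / C" "\<forall>\<^sub>F t::real in at_right 0. 0 < t"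
    using r d C by (auto simp: eventually_at_right_less intro!: eventually_at_rightI[of 0 "min r d / C"])
  then show "\<forall>\<^sub>F t in at_right 0. dist ((g (x + t *\<^sub>R v + t *\<^sub>R w) - g (x + t *\<^sub>R v) - g (x + t *\<^sub>R w) + g x) / t\<^sup>2) (L w) < e"
  proof eventually_elim
    case (elim t)
    then have t: "t > 0" "t * C < r" "t * C < d" using C by (auto simp: field_simps)
    have nb: "norm (s *\<^sub>R v + k *\<^sub>R w) \<le> t * C" if "0 \<le> s" "s \<le> t" "0 \<le> k" "k \<le> t" for s k
    proof -
      have "norm (s *\<^sub>R v + k *\<^sub>R w) \<le> s * norm v + k * norm w"
        using norm_triangle_ineq[of "s *\<^sub>R v" "k *\<^sub>R w"] that by simp
      also have "\<dots> \<le> t * norm v + t * norm w" using that by (intro add_mono mult_right_mono) auto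
      also have "\<dots> \<le> t * C" using t C(4) by (simp add: distrib_left[symmetric])
      finally show ?thesis .
    qed
    have inD: "x + s *\<^sub>R v + k *\<^sub>R w \<in> D" if "0 \<le> s" "s \<le> t" "0 \<le> k" "k \<le> t" for s k
    proof -
      have "x - (x + s *\<^sub>R v + k *\<^sub>R w) = - (s *\<^sub>R v + k *\<^sub>R w)" by simp
      then have "dist x (x + s *\<^sub>R v + k *\<^sub>R w) = norm (s *\<^sub>R v + k *\<^sub>R w)"
        unfolding dist_norm by (simp only: norm_minus_cancel)
      then show ?thesis using nb[OF that] t r by auto
    qed
    define \<phi> where "\<phi> s = g (x + s *\<^sub>R v + t *\<^sub>R w) - g (x + s *\<^sub>R v)" for s
    have d\<phi>: "(\<phi> has_real_derivative (g' (x + s *\<^sub>R v + t *\<^sub>R w) v - g' (x + s *\<^sub>R v) v)) (at s)"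
      if "0 \<le> s" "s \<le> t" for s
    proof -
      have *: "((\<lambda>s. g (x + s *\<^sub>R v + k)) has_derivative (\<lambda>h. g' (x + s *\<^sub>R v + k) (h *\<^sub>R v))) (at s)"
        if "x + s *\<^sub>R v + k \<in> D" for k
        by (rule has_derivative_compose[of "\<lambda>s. x + s *\<^sub>R v + k" _ s UNIV g, OF _ g[OF that]])
          (auto intro!: derivative_eq_intros)
      have lin: "g' y (h *\<^sub>R v) = h * g' y v" if "y \<in> D" for y h
        using linear_cmul[OF has_derivative_linear[OF g[OF that]]] by simp
      have D1: "x + s *\<^sub>R v + t *\<^sub>R w \<in> D" "x + s *\<^sub>R v + 0 \<in> D"
        using inD[of s t] inD[of s 0] that t by auto
      have "(\<phi> has_derivative (\<lambda>h. g' (x + s *\<^sub>R v + t *\<^sub>R w) (h *\<^sub>R v) - g' (x + s *\<^sub>R v + 0) (h *\<^sub>R v))) (at s)"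
        using has_derivative_diff[OF *[OF D1(1)] *[OF D1(2)]] by (simp add: \<phi>_def[abs_def])
      then show ?thesis
        using lin[OF D1(1)] lin[OF D1(2)] unfolding has_field_derivative_def
        by (elim has_derivative_eq_rhs) (simp add: fun_eq_iff algebra_simps)
    qed
    obtain s where s: "0 < s" "s < t"
      "\<phi> t - \<phi> 0 = (t - 0) * (g' (x + s *\<^sub>R v + t *\<^sub>R w) v - g' (x + s *\<^sub>R v) v)"
      using MVT2[OF t(1) d\<phi>] by auto
    define a where "a = g' (x + s *\<^sub>R v + t *\<^sub>R w) v - g' x v - L (s *\<^sub>R v + t *\<^sub>R w)"
    define b where "b = g' (x + s *\<^sub>R v) v - g' x v - L (s *\<^sub>R v)"
    have "norm a \<le> e / (4*C) * norm (s *\<^sub>R v + t *\<^sub>R w)"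
      unfolding a_def using d(2)[of "x + s *\<^sub>R v + t *\<^sub>R w"] nb[of s t] s t by (simp add: add.assoc)
    also have "\<dots> \<le> e / (4*C) * (t * C)" using nb[of s t] s t e C by (intro mult_left_mono) auto
    finally have a: "\<bar>a\<bar> \<le> e * t / 4" using C by simp
    have "norm b \<le> e / (4*C) * norm (s *\<^sub>R v)"
      unfolding b_def using d(2)[of "x + s *\<^sub>R v"] nb[of s 0] s t by simp
    also have "\<dots> \<le> e / (4*C) * (t * C)" using nb[of s 0] s t e C by (intro mult_left_mono) auto
    finally have b: "\<bar>b\<bar> \<le> e * t / 4" using C by simp
    have "\<phi> t - \<phi> 0 = t * (a - b) + t\<^sup>2 * L w"
      unfolding s(3) a_def b_def L.add L.scaleR by (simp add: power2_eq_square algebra_simps)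
    moreover have "g (x + t *\<^sub>R v + t *\<^sub>R w) - g (x + t *\<^sub>R v) - g (x + t *\<^sub>R w) + g x = \<phi> t - \<phi> 0"
      by (simp add: \<phi>_def)
    ultimately have quot: "(g (x + t *\<^sub>R v + t *\<^sub>R w) - g (x + t *\<^sub>R v) - g (x + t *\<^sub>R w) + g x) / t\<^sup>2 - L w
        = (t * (a - b) + t\<^sup>2 * L w) / t\<^sup>2 - L w"
      by (simp only:)
    have "(t * (a - b) + t\<^sup>2 * L w) / t\<^sup>2 - L w = (a - b) / t"
      using t by (simp add: power2_eq_square field_simps)
    moreover note quot
    moreover have "\<bar>(a - b) / t\<bar> < e"
    proof -
      have "\<bar>a - b\<bar> \<le> e * t / 2" using a b by linarith
      also have "\<dots> < e * t" using e t by simp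
      finally show ?thesis using t by (simp add: abs_divide pos_divide_less_eq)
    qed
    ultimately show ?case by (simp add: dist_real_def)
  qed
qed

lemma symmetric_second_derivative_real:
  fixes g :: "'a::real_normed_vector \<Rightarrow> real"
  assumes D: "open D" "x \<in> D" and g: "\<And>y. y \<in> D \<Longrightarrow> (g has_derivative g' y) (at y)"
    and v: "((\<lambda>y. g' y v) has_derivative Lv) (at x)"
    and w: "((\<lambda>y. g' y w) has_derivative Lw) (at x)"
  shows "Lv w = Lw v"
proof -
  have "((\<lambda>t. (g (x + t *\<^sub>R v + t *\<^sub>R w) - g (x + t *\<^sub>R v) - g (x + t *\<^sub>R w) + g x) / t\<^sup>2) \<longlongrightarrow> Lw v)
    (at_right 0)"
    using second_difference_limit[OF D g w, of v] by (simp add: algebra_simps)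
  from tendsto_unique[OF _ second_difference_limit[OF D g v] this] show ?thesis by simp
qed

lemma symmetric_second_derivative:
  fixes g :: "'a::real_normed_vector \<Rightarrow> 'b::euclidean_space"
  assumes D: "open D" "x \<in> D" and g: "\<And>y. y \<in> D \<Longrightarrow> (g has_derivative g' y) (at y)"
    and v: "((\<lambda>y. g' y v) has_derivative Lv) (at x)"
    and w: "((\<lambda>y. g' y w) has_derivative Lw) (at x)"
  shows "Lv w = Lw v"
proof (rule euclidean_eqI)
  fix b :: 'b
  show "Lv w \<bullet> b = Lw v \<bullet> b"
    by (rule symmetric_second_derivative_real[OF D, of "\<lambda>y. g y \<bullet> b" "\<lambda>y h. g' y h \<bullet> b"])
      (auto intro!: derivative_eq_intros g v w)
qed

lemma Cn_on_cong:
  assumes "open S" "\<And>x. x \<in> S \<Longrightarrow> f x = g x"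
  shows "Cn_on n S f = Cn_on n S g"
  using assms(2)
proof (induction n arbitrary: f g)
  case 0 then show ?case by (simp cong: continuous_on_cong)
next
  case (Suc n)
  have hd: "(f has_derivative h) (at x) \<longleftrightarrow> (g has_derivative h) (at x)" if "x \<in> S" for x h
  proof
    assume "(f has_derivative h) (at x)"
    then show "(g has_derivative h) (at x)"
      by (rule has_derivative_transform_within_open[OF _ assms(1) that]) (rule Suc.prems)
  next
    assume "(g has_derivative h) (at x)"
    then show "(f has_derivative h) (at x)"
      by (rule has_derivative_transform_within_open[OF _ assms(1) that]) (rule Suc.prems[symmetric])
  qed
  then have "frechet_derivative f (at x) = frechet_derivative g (at x)" if "x \<in> S" for x
    using that by (simp add: frechet_derivative_def)
  moreover have "f differentiable at x \<longleftrightarrow> g differentiable at x" if "x \<in> S" for x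
    using hd[OF that] by (simp add: differentiable_def)
  moreover have "Cn_on n S (\<lambda>x. frechet_derivative f (at x) v) = Cn_on n S (\<lambda>x. frechet_derivative g (at x) v)" for v
    by (rule Suc.IH) (simp add: calculation(1))
  ultimately show ?case by simp
qed

text \<open>Lets a derivative found by the usual rules stand in for \<open>frechet_derivative\<close>.\<close>

lemma Cn_on_Suc_I:
  assumes "open S" "\<And>x. x \<in> S \<Longrightarrow> (f has_derivative f' x) (at x)" "\<And>v. Cn_on n S (\<lambda>x. f' x v)"
  shows "Cn_on (Suc n) S f"
proof -
  have "Cn_on n S (\<lambda>x. frechet_derivative f (at x) v)" for v
  proof -
    have "Cn_on n S (\<lambda>x. f' x v) = Cn_on n S (\<lambda>x. frechet_derivative f (at x) v)"
      by (rule Cn_on_cong[OF assms(1)]) (simp add: frechet_derivative_at[OF assms(2), symmetric])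
    then show ?thesis using assms(3) by simp
  qed
  moreover have "\<forall>x\<in>S. f differentiable at x"
    using assms(2) unfolding differentiable_def by blast
  ultimately show ?thesis by simp
qed

lemma Cn_on_Suc_D: "Cn_on (Suc n) S f \<Longrightarrow> Cn_on n S f"
proof (induction n arbitrary: f)
  case 0 then show ?case
    by (auto intro!: continuous_at_imp_continuous_on differentiable_imp_continuous_within)
next
  case (Suc n)
  have "Cn_on (Suc n) S (\<lambda>x. frechet_derivative f (at x) v)" for v
    using Suc.prems unfolding Cn_on.simps(2)[of "Suc n"] by blast
  from Suc.IH[OF this] show ?case
    using Suc.prems unfolding Cn_on.simps(2)[of "Suc n"] Cn_on.simps(2)[of n] by blast
qed

lemma Cn_on_add:
  assumes "open S" "Cn_on n S f" "Cn_on n S g"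
  shows "Cn_on n S (\<lambda>x. f x + g x)"
  using assms(2,3)
proof (induction n arbitrary: f g)
  case 0 then show ?case by (auto intro!: continuous_intros)
next
  case (Suc n)
  show ?case
    by (rule Cn_on_Suc_I[OF assms(1), of _ "\<lambda>x v. frechet_derivative f (at x) v + frechet_derivative g (at x) v"])
      (use Suc in \<open>auto intro!: has_derivative_add frechet_derivative_works[THEN iffD1]\<close>)
qed

lemma Cn_on_bilinear:
  assumes B: "bounded_bilinear B" and "open S" "Cn_on n S f" "Cn_on n S g"
  shows "Cn_on n S (\<lambda>x. B (f x) (g x))"
  using assms(3,4)
proof (induction n arbitrary: f g)
  case 0 then show ?case by (auto intro!: bounded_bilinear.continuous_on[OF B])
next
  case (Suc n)
  show ?case
  proof (rule Cn_on_Suc_I[OF assms(2)])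
    show "((\<lambda>x. B (f x) (g x)) has_derivative
       (\<lambda>v. B (f x) (frechet_derivative g (at x) v) + B (frechet_derivative f (at x) v) (g x))) (at x)"
      if "x \<in> S" for x
      using Suc.prems that by (intro bounded_bilinear.FDERIV[OF B] frechet_derivative_works[THEN iffD1]) auto
    show "Cn_on n S (\<lambda>x. B (f x) (frechet_derivative g (at x) v) + B (frechet_derivative f (at x) v) (g x))" for v
      using Suc.prems[THEN Cn_on_Suc_D] Suc.prems
      by (intro Cn_on_add[OF assms(2)] Suc.IH) auto
  qed
qed

lemma smooth_on_bounded_bilinear:
  "bounded_bilinear B \<Longrightarrow> open S \<Longrightarrow> smooth_on S f \<Longrightarrow> smooth_on S g \<Longrightarrow> smooth_on S (\<lambda>x. B (f x) (g x))"
  by (simp add: smooth_on_def Cn_on_bilinear)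

lemma smooth_on_frechet_derivative:
  "smooth_on S f \<Longrightarrow> smooth_on S (\<lambda>x. frechet_derivative f (at x) v)"
  unfolding smooth_on_def
proof
  fix n assume "\<forall>n. Cn_on n S f"
  then have "Cn_on (Suc n) S f" by blast
  then show "Cn_on n S (\<lambda>x. frechet_derivative f (at x) v)" by simp
qed

lemma smooth_on_cong:
  "open S \<Longrightarrow> (\<And>x. x \<in> S \<Longrightarrow> f x = g x) \<Longrightarrow> smooth_on S f = smooth_on S g"
  by (simp add: smooth_on_def Cn_on_cong[of S f g])

section \<open>Traceless matrices\<close>

definition br :: "mat2 \<Rightarrow> mat2 \<Rightarrow> mat2" where "br x y = x ** y - y ** x"

lemma bounded_bilinear_br: "bounded_bilinear br"
  unfolding bilinear_conv_bounded_bilinear[symmetric] bilinear_def linear_iff br_def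
  by (auto simp: mat2_mult.add_left mat2_mult.add_right mat2_mult.scaleR_left mat2_mult.scaleR_right
      algebra_simps)

interpretation br: bounded_bilinear br by (rule bounded_bilinear_br)

lemma bounded_bilinear_ip: "bounded_bilinear ip"
  unfolding bilinear_conv_bounded_bilinear[symmetric] bilinear_def linear_iff
  by (auto simp: linear_ip)

interpretation ip: bounded_bilinear ip by (rule bounded_bilinear_ip)

lemmas br_linear = br.add_left br.add_right br.diff_left br.diff_right br.minus_left br.minus_right
  br.scaleR_left br.scaleR_right br.zero_left br.zero_right
lemmas mul_linear = mat2_mult.add_left mat2_mult.add_right mat2_mult.diff_left mat2_mult.diff_right
  mat2_mult.minus_left mat2_mult.minus_right mat2_mult.scaleR_left mat2_mult.scaleR_right
  mat2_mult.zero_left mat2_mult.zero_right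
lemmas ip_linear = linear_ip ip.zero_left ip.zero_right

lemma br_self [simp]: "br x x = 0" by (simp add: br_def)
lemma br_anti: "br y x = - br x y" by (simp add: br_def)
lemma trace_br [simp]: "trace (br x y) = 0"
  using trace_mul_sym[of x y] by (simp add: br_def trace_mat2_linear)

lemma trace0_22: "trace x = 0 \<Longrightarrow> x$2$2 = - x$1$1" for x :: mat2
  by (simp add: trace_def sum_2)

lemmas mat2_coords = vec_eq_iff forall_2 matrix_matrix_mult_def sum_2 trace_def mat_def ip_def br_def

text \<open>Symmetric and antisymmetric part of the product. All later identities rest on this splitting
  and on the next rules for orthogonal matrices, which anticommute.\<close>

lemma mult_traceless:
  assumes "trace x = 0" "trace y = 0"
  shows "x ** y = ip x y *\<^sub>R mat 1 + (1/2) *\<^sub>R br x y"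
  using assms[THEN trace0_22] by (simp add: mat2_coords field_simps)

lemma square_traceless: "trace x = 0 \<Longrightarrow> x ** x = ip x x *\<^sub>R mat 1"
  using mult_traceless[of x x] by simp

lemma anticommute_traceless:
  assumes "trace x = 0" "trace y = 0" "ip x y = 0"
  shows "y ** x = - (x ** y)"
  using mult_traceless[of x y] mult_traceless[of y x] assms br_anti[of x y]
  by (simp add: ip_commute)

lemma br_orthogonal:
  assumes "trace x = 0" "trace y = 0" "ip x y = 0"
  shows "br x y = 2 *\<^sub>R (x ** y)"
  using mult_traceless[of x y] assms by simp

text \<open>The double bracket is the vector triple product of the three-dimensional Lorentzian space of
  traceless matrices.\<close>

lemma triple_br:
  assumes "trace x = 0" "trace y = 0" "trace z = 0"
  shows "br x (br y z) = (4 * ip x y) *\<^sub>R z - (4 * ip x z) *\<^sub>R y"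
  using assms[THEN trace0_22] by (simp add: mat2_coords field_simps)

lemma ip_br_cyclic: "ip x (br y z) = ip (br x y) z"
  by (simp add: mat2_coords field_simps)

lemma ip_br_skew: "ip y (br x z) = - ip (br x y) z"
  by (simp add: mat2_coords field_simps)

lemma ip_br_left: "ip (br x y) x = 0" "ip (br x y) y = 0" "ip x (br x y) = 0" "ip y (br x y) = 0"
  by (simp_all add: mat2_coords field_simps)

section \<open>The nearly Kaehler structure at the identity\<close>

definition sl :: "mat2_pair \<Rightarrow> bool" where
  "sl z \<longleftrightarrow> trace (fst z) = 0 \<and> trace (snd z) = 0"

definition gL :: "mat2_pair \<Rightarrow> mat2_pair \<Rightarrow> real" where
  "gL z w = 2/3 * (ip (fst z) (fst w) + ip (snd z) (snd w)) - 1/3 * (ip (snd z) (fst w) + ip (fst z) (snd w))"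

definition JL :: "mat2_pair \<Rightarrow> mat2_pair" where
  "JL z = (1 / sqrt 3) *\<^sub>R (fst z - 2 *\<^sub>R snd z, 2 *\<^sub>R fst z - snd z)"

definition br2 :: "mat2_pair \<Rightarrow> mat2_pair \<Rightarrow> mat2_pair" where
  "br2 z w = (br (fst z) (fst w), br (snd z) (snd w))"

text \<open>The Levi-Civita connection acts on left-trivialized fields as the derivative plus this term.
  In the complex notation of the introduction, on \<open>Z\<close> and \<open>W\<close> it is
  \<open>-1/3 [Z + Z\<^sup>*, W] + 1/6 [Z\<^sup>*, W\<^sup>*]\<close>, where the star denotes conjugation.\<close>

definition lam :: "mat2_pair \<Rightarrow> mat2_pair \<Rightarrow> mat2_pair" where
  "lam z w = ((1/2) *\<^sub>R br (fst z) (fst w) - (1/6) *\<^sub>R (br (fst z) (snd w) - br (snd z) (fst w)),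
              (1/2) *\<^sub>R br (snd z) (snd w) + (1/6) *\<^sub>R (br (fst z) (snd w) - br (snd z) (fst w)))"

text \<open>The curvature of the left-invariant connection given by \<open>lam\<close>.\<close>

definition RL :: "mat2_pair \<Rightarrow> mat2_pair \<Rightarrow> mat2_pair \<Rightarrow> mat2_pair" where
  "RL a b c = lam a (lam b c) - lam b (lam a c) - lam (br2 a b) c"

lemma bounded_bilinear_lam: "bounded_bilinear lam"
  unfolding bilinear_conv_bounded_bilinear[symmetric] bilinear_def linear_iff lam_def
  by (auto simp: br_linear algebra_simps)

interpretation lam: bounded_bilinear lam by (rule bounded_bilinear_lam)

lemma bounded_bilinear_gL: "bounded_bilinear gL"
  unfolding bilinear_conv_bounded_bilinear[symmetric] bilinear_def linear_iff gL_def
  by (auto simp: linear_ip algebra_simps)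

interpretation gL: bounded_bilinear gL by (rule bounded_bilinear_gL)

lemma bounded_bilinear_br2: "bounded_bilinear br2"
  unfolding bilinear_conv_bounded_bilinear[symmetric] bilinear_def linear_iff br2_def
  by (auto simp: br_linear algebra_simps)

interpretation br2: bounded_bilinear br2 by (rule bounded_bilinear_br2)

lemma bounded_linear_JL: "bounded_linear JL"
  unfolding linear_conv_bounded_linear[symmetric] linear_iff JL_def
  by (auto simp: algebra_simps)

lemmas JL_add = linear_add[OF bounded_linear.linear[OF bounded_linear_JL]]
  and JL_scaleR = linear_cmul[OF bounded_linear.linear[OF bounded_linear_JL]]

lemma gL_commute: "gL z w = gL w z" by (simp add: gL_def ip_commute)

lemma sl_add: "sl z \<Longrightarrow> sl w \<Longrightarrow> sl (z + w)"
  and sl_diff: "sl z \<Longrightarrow> sl w \<Longrightarrow> sl (z - w)" and sl_lam: "sl (lam z w)"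
  by (simp_all add: sl_def trace_mat2_linear lam_def)

lemma lam_torsion: "lam z w - lam w z = br2 z w"
proof -
  have "br (fst w) (fst z) = - br (fst z) (fst w)" "br (snd w) (snd z) = - br (snd z) (snd w)"
    "br (fst w) (snd z) = - br (snd z) (fst w)" "br (snd w) (fst z) = - br (fst z) (snd w)"
    by (rule br_anti)+
  then show ?thesis by (simp add: lam_def br2_def vec_eq_iff field_simps)
qed

lemma lam_skew: "gL (lam z w) y + gL w (lam z y) = 0"
  by (simp add: gL_def lam_def ip_linear ip_br_skew algebra_simps)

lemma JL_JL: "JL (JL z) = - z"
  by (simp add: JL_def vec_eq_iff field_simps prod_eq_iff)

lemma gL_JL: "gL (JL z) (JL w) = gL z w"
  by (simp add: gL_def JL_def linear_ip field_simps)

lemma gL_JL_self: "gL z (JL z) = 0"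
  unfolding JL_def gL.scaleR_right
  by (simp add: gL_def linear_ip ip_commute[of "snd z" "fst z"] algebra_simps)

text \<open>After expansion every term is a multiple of \<open>[\<alpha>, \<gamma>]\<close> or \<open>[\<beta>, \<gamma>]\<close>, where \<open>\<alpha>\<close>, \<open>\<beta>\<close> are the entries of
  \<open>z\<close>.\<close>

lemma RL_complex_line_scaled:
  fixes z w :: mat2_pair
  defines "\<gamma> \<equiv> br (fst z) (snd z)" and "z' \<equiv> (fst z - 2 *\<^sub>R snd z, 2 *\<^sub>R fst z - snd z)"
  assumes "w = z \<or> w = z'"
  shows "RL z z' w = (-2/3) *\<^sub>R (br (fst w) \<gamma>, br (snd w) \<gamma>)"
proof -
  obtain x y where z: "z = (x, y)" by fastforce
  obtain \<gamma>' p q where d: "br x y = \<gamma>'" "br x \<gamma>' = p" "br y \<gamma>' = q" by blast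
  have d': "br y x = - \<gamma>'" "br \<gamma>' x = - p" "br \<gamma>' y = - q"
    using d br_anti by metis+
  have two: "br u (v * 2) = 2 *\<^sub>R br u v" for u v :: mat2
  proof -
    have "v * 2 = 2 *\<^sub>R v" by (simp add: vec_eq_iff)
    then show ?thesis by (simp only: br.scaleR_right)
  qed
  show ?thesis
    using assms(3) unfolding z'_def \<gamma>_def
    by (elim disjE; simp add: z RL_def lam_def br2_def br_linear d d')
      (simp_all add: two d vec_eq_iff field_simps)
qed

lemma RL_complex_line:
  assumes "w = r *\<^sub>R z + s *\<^sub>R JL z"
  shows "RL z (JL z) w = (- 2 / (3 * sqrt 3)) *\<^sub>R (br (fst w) (br (fst z) (snd z)), br (snd w) (br (fst z) (snd z)))"
proof -
  define z' where "z' = (fst z - 2 *\<^sub>R snd z, 2 *\<^sub>R fst z - snd z)"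
  have J: "JL z = (1 / sqrt 3) *\<^sub>R z'" by (simp add: JL_def z'_def)
  have lin: "RL z (c *\<^sub>R z') (a *\<^sub>R u + b *\<^sub>R v) = (c * a) *\<^sub>R RL z z' u + (c * b) *\<^sub>R RL z z' v" for c a b u v
    by (simp add: RL_def br2.scaleR_right lam.add_right lam.scaleR_left lam.scaleR_right lam.add_left algebra_simps)
  show ?thesis
    unfolding assms J scaleR_scaleR lin
    using RL_complex_line_scaled[of z z] RL_complex_line_scaled[of z' z]
    by (simp add: z'_def[symmetric] br_linear prod_eq_iff algebra_simps)
qed

text \<open>If \<open>\<alpha>\<close> and \<open>\<beta>\<close> do not commute, they are linearly independent, and the triple product formula
  turns the hypothesis into four linear equations between the products of \<open>\<alpha>\<close> and \<open>\<beta>\<close>.\<close>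

lemma complex_line_dichotomy:
  assumes "sl z" and e: "(br (fst z) (br (fst z) (snd z)), br (snd z) (br (fst z) (snd z))) = x *\<^sub>R z + y *\<^sub>R JL z"
  shows "br (fst z) (snd z) = 0 \<or> ip (fst z) (fst z) = 2 * ip (fst z) (snd z) \<and> ip (snd z) (snd z) = 2 * ip (fst z) (snd z)"
proof (rule disjCI)
  assume n: "\<not> (ip (fst z) (fst z) = 2 * ip (fst z) (snd z) \<and> ip (snd z) (snd z) = 2 * ip (fst z) (snd z))"
  define \<alpha> \<beta> \<gamma> where d: "\<alpha> = fst z" "\<beta> = snd z" "\<gamma> = br \<alpha> \<beta>"
  define a b c where abc: "a = ip \<alpha> \<alpha>" "b = ip \<beta> \<beta>" "c = ip \<alpha> \<beta>"
  define y' where "y' = y / sqrt 3"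
  have t: "trace \<alpha> = 0" "trace \<beta> = 0" using assms(1) by (auto simp: sl_def d)
  have 1: "(4 * a) *\<^sub>R \<beta> - (4 * c) *\<^sub>R \<alpha> = x *\<^sub>R \<alpha> + y' *\<^sub>R (\<alpha> - 2 *\<^sub>R \<beta>)"
   and 2: "(4 * c) *\<^sub>R \<beta> - (4 * b) *\<^sub>R \<alpha> = x *\<^sub>R \<beta> + y' *\<^sub>R (2 *\<^sub>R \<alpha> - \<beta>)"
    using e triple_br[of \<alpha> \<alpha> \<beta>] triple_br[of \<beta> \<alpha> \<beta>] t
    by (simp_all add: d abc y'_def JL_def prod_eq_iff ip_commute)
  \<comment> \<open>bracketing the two equations with \<open>\<alpha>\<close> and with \<open>\<beta>\<close> isolates their coefficients\<close>
  have "br \<beta> \<alpha> = - \<gamma>" unfolding d(3) by (rule br_anti)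
  then have "(4 * a + 2 * y') *\<^sub>R \<gamma> = 0" "(x + y' + 4 * c) *\<^sub>R \<gamma> = 0" "(4 * c - x + y') *\<^sub>R \<gamma> = 0" "(4 * b + 2 * y') *\<^sub>R \<gamma> = 0"
    using arg_cong[OF 1, of "br \<alpha>"] arg_cong[OF 1, of "br \<beta>"] arg_cong[OF 2, of "br \<alpha>"] arg_cong[OF 2, of "br \<beta>"]
    by (simp_all add: br_linear d(3)[symmetric] scaleR_add_left scaleR_diff_left algebra_simps) 
  then show "br (fst z) (snd z) = 0"
    using n unfolding scaleR_eq_0_iff by (auto simp: d abc)
qed

text \<open>For a complex line with \<open>\<langle>Z, Z\<rangle> = 0\<close> this is the timelike unit matrix orthogonal to both
  entries of \<open>z\<close>. The factor normalizes its square to minus the identity.\<close>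

definition nu :: "mat2_pair \<Rightarrow> mat2" where
  "nu z = (- 1 / (sqrt 3 * ip (fst z) (fst z))) *\<^sub>R br (fst z) (snd z)"

text \<open>The graph over the orthogonal complement of \<open>N\<close> of left multiplication by \<open>1/2 + \<surd>3/2 N\<close>, the
  rotation by \<open>\<pi>/3\<close> for the complex structure \<open>N\<close>.\<close>

definition TN :: "mat2 \<Rightarrow> mat2_pair set" where
  "TN N = {(x, (1/2) *\<^sub>R x + (sqrt 3 / 2) *\<^sub>R (N ** x)) | x. trace x = 0 \<and> ip N x = 0}"

lemma nu_props:
  assumes "sl z" and e: "ip (fst z) (fst z) = 2 * ip (fst z) (snd z)" "ip (snd z) (snd z) = 2 * ip (fst z) (snd z)"
    and a: "ip (fst z) (fst z) \<noteq> 0"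
  shows "trace (nu z) = 0" "ip (nu z) (nu z) = - 1" "z \<in> TN (nu z)" "JL z \<in> TN (nu z)"
proof -
  define \<alpha> \<beta> \<gamma> where d: "\<alpha> = fst z" "\<beta> = snd z" "\<gamma> = br \<alpha> \<beta>"
  define c where c: "c = ip \<alpha> \<beta>"
  have t: "trace \<alpha> = 0" "trace \<beta> = 0" using assms(1) by (auto simp: sl_def d)
  have ips: "ip \<alpha> \<alpha> = 2 * c" "ip \<beta> \<beta> = 2 * c" "c \<noteq> 0" using e a by (auto simp: d c)
  have nu: "nu z = (- 1 / (sqrt 3 * (2 * c))) *\<^sub>R \<gamma>" by (simp add: nu_def d(1,2)[symmetric] d(3) ips)
  show tn: "trace (nu z) = 0" by (simp add: nu d trace_mat2_linear)
  have "ip \<gamma> \<gamma> = ip \<alpha> (br \<beta> \<gamma>)" by (simp add: ip_br_cyclic d(3))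
  also have "\<dots> = - 12 * c\<^sup>2" using triple_br[of \<beta> \<alpha> \<beta>] t
    by (simp add: d(3) linear_ip ips ip_commute[of \<beta> \<alpha>] c[symmetric] power2_eq_square)
  finally show "ip (nu z) (nu z) = - 1" using ips by (simp add: nu linear_ip power2_eq_square)
  have orth: "ip (nu z) \<alpha> = 0" "ip (nu z) \<beta> = 0" by (simp_all add: nu linear_ip d(3) ip_br_left)
  have "br \<gamma> \<alpha> = - br \<alpha> \<gamma>" "br \<gamma> \<beta> = - br \<beta> \<gamma>" by (rule br_anti)+
  then have g: "br \<gamma> \<alpha> = (4 * c) *\<^sub>R \<alpha> - (8 * c) *\<^sub>R \<beta>" "br \<gamma> \<beta> = (8 * c) *\<^sub>R \<alpha> - (4 * c) *\<^sub>R \<beta>"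
    using triple_br[of \<alpha> \<alpha> \<beta>] triple_br[of \<beta> \<alpha> \<beta>] t
    by (simp_all add: d(3) ips ip_commute[of \<beta> \<alpha>] c[symmetric])
  have N\<alpha>: "(sqrt 3 / 2) *\<^sub>R (nu z ** \<alpha>) = \<beta> - (1/2) *\<^sub>R \<alpha>" "(sqrt 3 / 2) *\<^sub>R (nu z ** \<beta>) = (1/2) *\<^sub>R \<beta> - \<alpha>"
  proof -
    have "nu z ** \<alpha> = (1/2) *\<^sub>R br (nu z) \<alpha>" "nu z ** \<beta> = (1/2) *\<^sub>R br (nu z) \<beta>"
      using mult_traceless[OF tn t(1)] mult_traceless[OF tn t(2)] by (simp_all only: orth) simp_all
    then show "(sqrt 3 / 2) *\<^sub>R (nu z ** \<alpha>) = \<beta> - (1/2) *\<^sub>R \<alpha>" "(sqrt 3 / 2) *\<^sub>R (nu z ** \<beta>) = (1/2) *\<^sub>R \<beta> - \<alpha>"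
      using ips(3) by (simp_all add: nu br_linear g vec_eq_iff field_simps)
  qed
  show "z \<in> TN (nu z)"
    unfolding TN_def using N\<alpha>(1) t orth by (auto intro!: exI[of _ \<alpha>] simp: d prod_eq_iff)
  show "JL z \<in> TN (nu z)"
    unfolding TN_def
  proof (intro CollectI exI conjI)
    show "trace ((1/sqrt 3) *\<^sub>R (\<alpha> - 2 *\<^sub>R \<beta>)) = 0" "ip (nu z) ((1/sqrt 3) *\<^sub>R (\<alpha> - 2 *\<^sub>R \<beta>)) = 0"
      using t orth by (simp_all add: trace_mat2_linear linear_ip)
    have "(sqrt 3 / 2) *\<^sub>R (nu z ** ((1/sqrt 3) *\<^sub>R (\<alpha> - 2 *\<^sub>R \<beta>))) =
      (1/sqrt 3) *\<^sub>R ((sqrt 3 / 2) *\<^sub>R (nu z ** \<alpha>) - 2 *\<^sub>R ((sqrt 3 / 2) *\<^sub>R (nu z ** \<beta>)))"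
      by (simp add: mul_linear scaleR_diff_right)
    also have "\<dots> = (1/sqrt 3) *\<^sub>R ((3/2) *\<^sub>R \<alpha>)"
      unfolding N\<alpha> by (simp add: vec_eq_iff field_simps)
    finally show "JL z = ((1/sqrt 3) *\<^sub>R (\<alpha> - 2 *\<^sub>R \<beta>), (1/2) *\<^sub>R ((1/sqrt 3) *\<^sub>R (\<alpha> - 2 *\<^sub>R \<beta>)) +
       (sqrt 3 / 2) *\<^sub>R (nu z ** ((1/sqrt 3) *\<^sub>R (\<alpha> - 2 *\<^sub>R \<beta>))))"
      by (simp only:) (simp add: JL_def d vec_eq_iff field_simps)
  qed
qed

lemma TN_add: "z \<in> TN N \<Longrightarrow> w \<in> TN N \<Longrightarrow> z + w \<in> TN N"
  by (force simp: TN_def mul_linear linear_ip trace_mat2_linear algebra_simps)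
lemma TN_scaleR: "z \<in> TN N \<Longrightarrow> c *\<^sub>R z \<in> TN N"
  by (force simp: TN_def mul_linear linear_ip trace_mat2_linear algebra_simps)

text \<open>Every nonzero element of the plane recovers the same axis, so the axis depends on the plane
  alone.\<close>

lemma nu_TN:
  assumes "trace N = 0" "ip N N = - 1" "z \<in> TN N" "ip (fst z) (fst z) \<noteq> 0"
  shows "nu z = N"
proof -
  obtain x where x: "z = (x, (1/2) *\<^sub>R x + (sqrt 3 / 2) *\<^sub>R (N ** x))" "trace x = 0" "ip N x = 0"
    using assms(3) by (auto simp: TN_def)
  have "br x (N ** x) = - (2 * ip x x) *\<^sub>R N"
  proof -
    have 1: "N ** x ** x = ip x x *\<^sub>R N"
      by (simp add: matrix_mul_assoc[symmetric] square_traceless[OF x(2)] mul_linear)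
    have "x ** (N ** x) = x ** N ** x" by (simp add: matrix_mul_assoc)
    also have "\<dots> = - (ip x x *\<^sub>R N)"
      unfolding anticommute_traceless[OF assms(1) x(2,3)] by (simp add: mul_linear 1)
    finally show ?thesis by (simp add: br_def 1 vec_eq_iff)
  qed
  then show ?thesis using assms(4) by (simp add: nu_def x(1) br_linear)
qed

section \<open>The left-trivialized derivative of a surface\<close>

text \<open>Left translation to the identity, and back.\<close>

definition ltr :: "mat2_pair \<Rightarrow> mat2_pair \<Rightarrow> mat2_pair" where
  "ltr p w = (matrix_inv (fst p) ** fst w, matrix_inv (snd p) ** snd w)"

definition unl :: "mat2_pair \<Rightarrow> mat2_pair \<Rightarrow> mat2_pair" where
  "unl p z = (fst p ** fst z, snd p ** snd z)"

lemma bounded_bilinear_unl: "bounded_bilinear unl"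
  unfolding bilinear_conv_bounded_bilinear[symmetric] bilinear_def linear_iff unl_def
  by (auto simp: mul_linear)

interpretation unl: bounded_bilinear unl by (rule bounded_bilinear_unl)

lemma unl_assoc: "unl (unl p z) w = unl p (unl z w)"
  by (simp add: unl_def matrix_mul_assoc)

lemma unl_ltr: "p \<in> SL2xSL2 \<Longrightarrow> unl p (ltr p w) = w"
  and ltr_unl: "p \<in> SL2xSL2 \<Longrightarrow> ltr p (unl p w) = w"
  by (simp_all add: unl_def ltr_def matrix_inv_cancel)

lemma gNK_ltr: "gNK p v w = gL (ltr p v) (ltr p w)"
  by (simp add: gNK_def gL_def ltr_def Let_def)

lemma J_NK_ltr: "J_NK p v = unl p (JL (ltr p v))"
  by (simp add: J_NK_def JL_def unl_def ltr_def Let_def mul_linear)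

lemma P_NK_ltr: "P_NK p v = unl p (prod.swap (ltr p v))"
  by (simp add: P_NK_def unl_def ltr_def Let_def)

lemma tangent_ltr: "p \<in> SL2xSL2 \<Longrightarrow> v \<in> tangent_SL2xSL2 p \<longleftrightarrow> sl (ltr p v)"
  by (simp add: tangent_iff sl_def ltr_def)

text \<open>On a left-trivialized field the derivative contributes the product \<open>unl z w\<close>, which the
  connection form has to remove.\<close>

lemma LC_left:
  assumes p: "p \<in> SL2xSL2" and z: "sl z" and w: "sl w"
  shows "LC p (unl p z) (unl p w) = unl p (lam z w - unl z w)"
proof -
  have "LC p (unl p z) (unl p w) = LC_formula p (unl p z) (unl p w)"
    by (rule levi_civita_unique[OF levi_civita_LC levi_civita_LC_formula p])
      (simp_all add: tangent_ltr p ltr_unl z w)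
  also have "\<dots> = unl p (lam z w - unl z w)"
    by (rule pair_eqI_left[OF p]; unfold LC_formula_left[OF p])
      (simp_all add: unl_def lam_def br_def matrix_inv_cancel[OF p] vec_eq_iff field_simps)
  finally show ?thesis .
qed

lemma matrix_inv_SL2: "det A = 1 \<Longrightarrow> matrix_inv A = adj2 A" for A :: mat2
  by (simp add: matrix_inv_mat2(1))

lemma bounded_bilinear_adj_mult:
  "bounded_bilinear (\<lambda>p w :: mat2_pair. (adj2 (fst p) ** fst w, adj2 (snd p) ** snd w))"
  unfolding bilinear_conv_bounded_bilinear[symmetric] bilinear_def linear_iff
  by (auto simp: mul_linear linear_add[OF linear_adj2] linear_cmul[OF linear_adj2])

lemma vec2_expand: "v = v$1 *\<^sub>R axis 1 1 + v$2 *\<^sub>R axis 2 1" for v :: "real^2"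
  by (simp add: vec_eq_iff forall_2 axis_def)

locale surface_patch =
  fixes D :: "(real^2) set" and f :: "real^2 \<Rightarrow> mat2_pair"
  assumes open_D: "open D" and smooth_f: "smooth_on D f"
    and f_SL: "u \<in> D \<Longrightarrow> f u \<in> SL2xSL2"
    and inj_df: "u \<in> D \<Longrightarrow> inj (frechet_derivative f (at u))"
    and J_inv: "u \<in> D \<Longrightarrow> J_NK (f u) ` tangent_plane f u \<subseteq> tangent_plane f u"
    and nondeg: "u \<in> D \<Longrightarrow> (\<And>y. induced_metric f u x y = 0) \<Longrightarrow> x = 0"
begin

text \<open>The pullback of the Maurer-Cartan form of the product group.\<close>

definition mc :: "real^2 \<Rightarrow> real^2 \<Rightarrow> mat2_pair" where
  "mc u v = ltr (f u) (frechet_derivative f (at u) v)"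

definition dmc :: "real^2 \<Rightarrow> real^2 \<Rightarrow> real^2 \<Rightarrow> mat2_pair" where
  "dmc u x y = frechet_derivative (\<lambda>s. mc s y) (at u) x"

lemma f_deriv: "u \<in> D \<Longrightarrow> (f has_derivative frechet_derivative f (at u)) (at u)"
  by (rule smooth_on_has_derivative[OF smooth_f])

lemma linear_df: "u \<in> D \<Longrightarrow> linear (frechet_derivative f (at u))"
  by (rule has_derivative_linear[OF f_deriv])

lemma df_mc: "u \<in> D \<Longrightarrow> frechet_derivative f (at u) v = unl (f u) (mc u v)"
  by (simp add: mc_def unl_ltr f_SL)

lemma linear_mc: assumes "u \<in> D" shows "linear (mc u)"
  unfolding mc_def[abs_def] ltr_def linear_iff
  by (auto simp: mul_linear linear_add[OF linear_df[OF assms]] linear_cmul[OF linear_df[OF assms]])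

lemmas mc_add = linear_add[OF linear_mc] and mc_scaleR = linear_cmul[OF linear_mc]
  and mc_diff = linear_diff[OF linear_mc] and mc_zero = linear_0[OF linear_mc]

lemma mc_expand: "u \<in> D \<Longrightarrow> mc u v = v$1 *\<^sub>R mc u (axis 1 1) + v$2 *\<^sub>R mc u (axis 2 1)"
  using vec2_expand[of v] by (metis mc_add mc_scaleR)

lemma mc_eq_0: assumes "u \<in> D" "mc u v = 0" shows "v = 0"
proof -
  have "frechet_derivative f (at u) v = frechet_derivative f (at u) 0"
    using assms by (simp add: df_mc unl.zero_right mc_zero)
  then show ?thesis using inj_df[OF assms(1)] by (simp add: inj_eq)
qed

text \<open>On matrices of determinant one the inverse is the adjugate, which is linear, so that \<open>mc\<close> is
  bilinear in the surface and its derivative.\<close>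

lemma smooth_mc: "smooth_on D (\<lambda>s. mc s v)"
proof -
  have "smooth_on D (\<lambda>s. (adj2 (fst (f s)) ** fst (frechet_derivative f (at s) v),
      adj2 (snd (f s)) ** snd (frechet_derivative f (at s) v)))"
    by (rule smooth_on_bounded_bilinear[OF bounded_bilinear_adj_mult open_D smooth_f
          smooth_on_frechet_derivative[OF smooth_f]])
  moreover have "mc s v = (adj2 (fst (f s)) ** fst (frechet_derivative f (at s) v),
      adj2 (snd (f s)) ** snd (frechet_derivative f (at s) v))" if "s \<in> D" for s
  proof -
    have "det (fst (f s)) = 1" "det (snd (f s)) = 1" using f_SL[OF that] by (auto simp: SL2xSL2_def)
    then show ?thesis by (simp add: mc_def ltr_def matrix_inv_SL2)
  qed
  ultimately show ?thesis using smooth_on_cong[OF open_D] by (metis (no_types, lifting))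
qed

lemma mc_deriv: "u \<in> D \<Longrightarrow> ((\<lambda>s. mc s y) has_derivative (\<lambda>x. dmc u x y)) (at u)"
  unfolding dmc_def by (rule smooth_on_has_derivative[OF smooth_mc])

lemma smooth_dmc: "smooth_on D (\<lambda>s. dmc s x y)"
  unfolding dmc_def by (rule smooth_on_frechet_derivative[OF smooth_mc])

lemma linear_dmc_left: "u \<in> D \<Longrightarrow> linear (\<lambda>x. dmc u x y)"
  by (rule has_derivative_linear[OF mc_deriv])

lemma has_derivative_on_D_cong:
  "(g has_derivative g') (at u) \<Longrightarrow> u \<in> D \<Longrightarrow> (\<And>s. s \<in> D \<Longrightarrow> g s = h s) \<Longrightarrow> (h has_derivative g') (at u)"
  by (rule has_derivative_transform_within_open[OF _ open_D])

lemma linear_dmc_right: assumes "u \<in> D" shows "linear (dmc u x)"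
  unfolding linear_iff
proof (intro conjI allI)
  fix y z c
  have "((\<lambda>s. mc s (y + z)) has_derivative (\<lambda>x. dmc u x y + dmc u x z)) (at u)"
    by (rule has_derivative_on_D_cong[OF has_derivative_add[OF mc_deriv mc_deriv]])
      (simp_all add: assms mc_add)
  from has_derivative_unique[OF mc_deriv[OF assms] this] show "dmc u x (y + z) = dmc u x y + dmc u x z"
    by (rule fun_cong)
  have "((\<lambda>s. mc s (c *\<^sub>R y)) has_derivative (\<lambda>x. c *\<^sub>R dmc u x y)) (at u)"
    by (rule has_derivative_on_D_cong[OF has_derivative_scaleR_right[OF mc_deriv]])
      (simp_all add: assms mc_scaleR)
  from has_derivative_unique[OF mc_deriv[OF assms] this] show "dmc u x (c *\<^sub>R y) = c *\<^sub>R dmc u x y"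
    by (rule fun_cong)
qed

lemmas dmc_add = linear_add[OF linear_dmc_left] linear_add[OF linear_dmc_right]
  and dmc_scaleR = linear_cmul[OF linear_dmc_left] linear_cmul[OF linear_dmc_right]

lemma dmc_expand: "u \<in> D \<Longrightarrow> dmc u x v = v$1 *\<^sub>R dmc u x (axis 1 1) + v$2 *\<^sub>R dmc u x (axis 2 1)"
  using vec2_expand[of v] by (metis dmc_add(2) dmc_scaleR(2))

lemma mc_field_deriv:
  assumes u: "u \<in> D" and Y: "(Y has_derivative Y') (at u)"
  shows "((\<lambda>s. mc s (Y s)) has_derivative (\<lambda>x. dmc u x (Y u) + mc u (Y' x))) (at u)"
proof (rule has_derivative_on_D_cong[OF _ u])
  show "((\<lambda>s. Y s $ 1 *\<^sub>R mc s (axis 1 1) + Y s $ 2 *\<^sub>R mc s (axis 2 1)) has_derivative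
     (\<lambda>x. dmc u x (Y u) + mc u (Y' x))) (at u)"
    by (rule derivative_eq_intros mc_deriv[OF u] bounded_linear.has_derivative[OF bounded_linear_vec_nth Y] refl)+
      (simp add: mc_expand[OF u, of "Y' _"] dmc_expand[OF u, of _ "Y u"] fun_eq_iff add_ac)
qed (simp add: mc_expand[symmetric])

lemma sl_mc: assumes u: "u \<in> D" shows "sl (mc u v)"
proof -
  have d: "det (fst (f s)) = 1" "det (snd (f s)) = 1" if "s \<in> D" for s
    using f_SL[OF that] by (auto simp: SL2xSL2_def)
  have h: "((\<lambda>s. det (fst (f s))) has_derivative
      (\<lambda>x. trace (adj2 (fst (f u)) ** fst (frechet_derivative f (at u) x)))) (at u)"
    "((\<lambda>s. det (snd (f s))) has_derivative
      (\<lambda>x. trace (adj2 (snd (f u)) ** snd (frechet_derivative f (at u) x)))) (at u)"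
    by (rule has_derivative_compose[OF has_derivative_fst[OF f_deriv[OF u]] det_mat2_has_derivative]
         has_derivative_compose[OF has_derivative_snd[OF f_deriv[OF u]] det_mat2_has_derivative])+
  from has_derivative_on_D_cong[OF h(1) u d(1)] has_derivative_on_D_cong[OF h(2) u d(2)]
  have "((\<lambda>s. 1::real) has_derivative
      (\<lambda>x. trace (adj2 (fst (f u)) ** fst (frechet_derivative f (at u) x)))) (at u)"
    "((\<lambda>s. 1::real) has_derivative
      (\<lambda>x. trace (adj2 (snd (f u)) ** snd (frechet_derivative f (at u) x)))) (at u)" by blast+
  from this[THEN has_derivative_unique[OF has_derivative_const]] show ?thesis
    using d[OF u] by (simp add: fun_eq_iff sl_def mc_def ltr_def matrix_inv_SL2)
qed

lemma sl_deriv: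
  assumes u: "u \<in> D" and W: "(W has_derivative W') (at u)" and sl: "\<And>s. s \<in> D \<Longrightarrow> sl (W s)"
  shows "sl (W' x)"
proof -
  have "((\<lambda>s. trace (fst (W s))) has_derivative (\<lambda>x. trace (fst (W' x)))) (at u)"
    "((\<lambda>s. trace (snd (W s))) has_derivative (\<lambda>x. trace (snd (W' x)))) (at u)"
    by (intro trace_mat2_has_derivative has_derivative_fst has_derivative_snd W)+
  then have "((\<lambda>s. 0::real) has_derivative (\<lambda>x. trace (fst (W' x)))) (at u)"
    "((\<lambda>s. 0::real) has_derivative (\<lambda>x. trace (snd (W' x)))) (at u)"
    using sl by (auto simp: sl_def elim!: has_derivative_on_D_cong[OF _ u])
  from this[THEN has_derivative_unique[OF has_derivative_const]] show ?thesis
    by (simp add: sl_def fun_eq_iff)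
qed

lemma sl_dmc: "u \<in> D \<Longrightarrow> sl (dmc u x y)"
  by (rule sl_deriv[OF _ mc_deriv]) (auto intro: sl_mc)

lemma unl_field_deriv:
  assumes u: "u \<in> D" and V: "\<And>s. s \<in> D \<Longrightarrow> V s = unl (f s) (W s)" and W: "(W has_derivative W') (at u)"
  shows "(V has_derivative (\<lambda>x. unl (f u) (unl (mc u x) (W u) + W' x))) (at u)"
proof (rule has_derivative_on_D_cong[OF _ u])
  show "((\<lambda>s. unl (f s) (W s)) has_derivative (\<lambda>x. unl (f u) (unl (mc u x) (W u) + W' x))) (at u)"
    using unl.FDERIV[OF f_deriv[OF u] W] by (simp add: df_mc[OF u] unl_assoc unl.add_right add.commute)
qed (simp add: V)

text \<open>From here on, covariant derivatives along the surface are computed in the fixed vector space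
  of pairs of traceless matrices.\<close>

lemma nabla_along_unl:
  assumes u: "u \<in> D" and V: "\<And>s. s \<in> D \<Longrightarrow> V s = unl (f s) (W s)" and W: "(W has_derivative W') (at u)"
    and sl: "sl (W u)"
  shows "nabla_along f X V u = unl (f u) (W' (X u) + lam (mc u (X u)) (W u))"
proof -
  have "frechet_derivative V (at u) = (\<lambda>x. unl (f u) (unl (mc u x) (W u) + W' x))"
    using frechet_derivative_at[OF unl_field_deriv[OF u V W]] by simp
  then show ?thesis
    unfolding nabla_along_def
    by (simp add: df_mc[OF u] V[OF u] LC_left[OF f_SL[OF u] sl_mc[OF u] sl] unl.add_right[symmetric] algebra_simps)
qed

text \<open>Symmetry of the second derivative, expressed in the left trivialization.\<close>

lemma maurer_cartan: assumes u: "u \<in> D" shows "dmc u x y - dmc u y x = - br2 (mc u x) (mc u y)"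
proof -
  have 1: "((\<lambda>s. frechet_derivative f (at s) y) has_derivative
      (\<lambda>x. unl (f u) (unl (mc u x) (mc u y) + dmc u x y))) (at u)" for y
    by (rule unl_field_deriv[OF u _ mc_deriv[OF u]]) (simp add: df_mc)
  have "unl (f u) (unl (mc u x) (mc u y) + dmc u x y) = unl (f u) (unl (mc u y) (mc u x) + dmc u y x)"
    by (rule symmetric_second_derivative[OF open_D u f_deriv 1 1])
  then have "unl (mc u x) (mc u y) + dmc u x y = unl (mc u y) (mc u x) + dmc u y x"
    using ltr_unl[OF f_SL[OF u]] by metis
  then show ?thesis by (simp add: br2_def br_def unl_def prod_eq_iff algebra_simps)
qed

lemma induced_metric_mc: "induced_metric f u x y = gL (mc u x) (mc u y)"
  by (simp add: induced_metric_def gNK_ltr mc_def)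

text \<open>Coordinates of the tangential part by the rule of Cramer. An explicit formula makes it
  evident that they depend differentiably on the point.\<close>

definition tang :: "real^2 \<Rightarrow> mat2_pair \<Rightarrow> real^2" where
  "tang u w = (let a = mc u (axis 1 1); b = mc u (axis 2 1); d = gL a a * gL b b - (gL a b)\<^sup>2 in
     ((gL w a * gL b b - gL w b * gL a b) / d) *\<^sub>R axis 1 1 + ((gL w b * gL a a - gL w a * gL a b) / d) *\<^sub>R axis 2 1)"

lemma gram_det_nonzero:
  assumes u: "u \<in> D"
  shows "gL (mc u (axis 1 1)) (mc u (axis 1 1)) * gL (mc u (axis 2 1)) (mc u (axis 2 1)) - (gL (mc u (axis 1 1)) (mc u (axis 2 1)))\<^sup>2 \<noteq> 0"
    (is "?a * ?b - ?c\<^sup>2 \<noteq> 0")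
proof
  assume 0: "?a * ?b - ?c\<^sup>2 = 0"
  have z: "v = 0" if "v$1 * ?a + v$2 * ?c = 0" "v$1 * ?c + v$2 * ?b = 0" for v :: "real^2"
  proof (rule nondeg[OF u])
    fix y
    have "gL (mc u v) (mc u y) = y$1 * (v$1 * ?a + v$2 * ?c) + y$2 * (v$1 * ?c + v$2 * ?b)"
      unfolding mc_expand[OF u, of v] mc_expand[OF u, of y]
      by (simp add: gL.add_left gL.add_right gL.scaleR_left gL.scaleR_right gL_commute[of "mc u (axis 2 1)" "mc u (axis 1 1)"] algebra_simps)
    then show "induced_metric f u v y = 0" by (simp add: induced_metric_mc that)
  qed
  have "?b *\<^sub>R axis 1 1 + (- ?c) *\<^sub>R axis 2 1 = (0::real^2)"
    by (rule z) (use 0 in \<open>auto simp: axis_def power2_eq_square algebra_simps\<close>)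
  then have bc: "?b = 0" "?c = 0" by (auto simp: vec_eq_iff forall_2 axis_def)
  have "axis 2 1 = (0::real^2)" by (rule z) (use bc in \<open>auto simp: axis_def\<close>)
  then show False by (simp add: axis_eq_0_iff)
qed

lemma tang_works: assumes u: "u \<in> D" shows "gL (mc u (tang u w)) (mc u y) = gL w (mc u y)"
proof -
  note d = gram_det_nonzero[OF u]
  define a b where ab: "a = mc u (axis 1 1)" "b = mc u (axis 2 1)"
  have t: "mc u (tang u w) = ((gL w a * gL b b - gL w b * gL a b) / (gL a a * gL b b - (gL a b)\<^sup>2)) *\<^sub>R a
    + ((gL w b * gL a a - gL w a * gL a b) / (gL a a * gL b b - (gL a b)\<^sup>2)) *\<^sub>R b"
    unfolding tang_def Let_def by (simp add: mc_add[OF u] mc_scaleR[OF u] ab)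
  have "gL (mc u (tang u w)) a = gL w a" "gL (mc u (tang u w)) b = gL w b"
    using d unfolding t ab[symmetric]
    by (simp_all add: gL.add_left gL.scaleR_left gL_commute[of b a] divide_simps)
       (simp_all add: power2_eq_square algebra_simps)
  then show ?thesis
    unfolding mc_expand[OF u, of y] by (simp add: gL.add_right gL.scaleR_right ab)
qed

lemma tang_unique: assumes u: "u \<in> D" and c: "\<And>y. gL (mc u c) (mc u y) = gL w (mc u y)" shows "tang u w = c"
proof -
  have "tang u w - c = 0"
    by (rule nondeg[OF u]) (simp add: induced_metric_mc mc_diff[OF u] gL.diff_left tang_works[OF u] c)
  then show ?thesis by simp
qed

lemma tang_mc: "u \<in> D \<Longrightarrow> tang u (mc u c) = c"
  by (rule tang_unique) auto

lemma tang_add: "u \<in> D \<Longrightarrow> tang u (v + w) = tang u v + tang u w"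
  by (rule tang_unique) (auto simp: mc_add gL.add_left tang_works)

lemma tang_scaleR: "u \<in> D \<Longrightarrow> tang u (c *\<^sub>R v) = c *\<^sub>R tang u v"
  by (rule tang_unique) (auto simp: mc_scaleR gL.scaleR_left tang_works)

lemma tang_differentiable:
  assumes u: "u \<in> D" and W: "W differentiable at u"
  shows "(\<lambda>s. tang s (W s)) differentiable at u"
proof -
  have g: "(\<lambda>s. gL (P s) (Q s)) differentiable at u" if "P differentiable at u" "Q differentiable at u" for P Q
    using that gL.FDERIV unfolding differentiable_def by blast
  have m: "(\<lambda>s. mc s y) differentiable at u" for y
    by (rule smooth_on_differentiable[OF smooth_mc u])
  show ?thesis
    unfolding tang_def Let_def
    by (intro derivative_intros g m W) (use gram_det_nonzero[OF u] in auto)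
qed

definition nrm :: "real^2 \<Rightarrow> mat2_pair \<Rightarrow> mat2_pair" where
  "nrm u w = w - mc u (tang u w)"

lemma nrm_add: "u \<in> D \<Longrightarrow> nrm u (v + w) = nrm u v + nrm u w"
  and nrm_scaleR: "u \<in> D \<Longrightarrow> nrm u (c *\<^sub>R v) = c *\<^sub>R nrm u v"
  and nrm_mc: "u \<in> D \<Longrightarrow> nrm u (mc u x) = 0"
  by (simp_all add: nrm_def tang_add tang_scaleR mc_add mc_scaleR tang_mc algebra_simps)

lemma nrm_diff: "u \<in> D \<Longrightarrow> nrm u (v - w) = nrm u v - nrm u w"
  using nrm_add[of u v "- w"] nrm_scaleR[of u "-1" w] by simp

lemma sl_nrm: "u \<in> D \<Longrightarrow> sl w \<Longrightarrow> sl (nrm u w)"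
  by (simp add: nrm_def sl_diff sl_mc)

lemma nrm_orthogonal: "u \<in> D \<Longrightarrow> gL (nrm u w) (mc u y) = 0"
  by (simp add: nrm_def gL.diff_left tang_works)

lemma tangent_plane_mc: "u \<in> D \<Longrightarrow> tangent_plane f u = range (\<lambda>v. unl (f u) (mc u v))"
  by (simp add: tangent_plane_def df_mc)

lemma normal_space_unl: assumes u: "u \<in> D"
  shows "unl (f u) w \<in> normal_space f u \<longleftrightarrow> sl w \<and> (\<forall>y. gL w (mc u y) = 0)"
  by (auto simp: normal_space_def tangent_ltr f_SL[OF u] ltr_unl gNK_ltr tangent_plane_mc[OF u])

lemma normal_part_unl:
  assumes u: "u \<in> D" and w: "sl w"
  shows "normal_part f u (unl (f u) w) = unl (f u) (nrm u w)"
proof -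
  have "tangential_part f u (unl (f u) w) = unl (f u) (mc u (tang u w))"
    unfolding tangential_part_def
  proof (rule the_equality)
    show "unl (f u) (mc u (tang u w)) \<in> tangent_plane f u \<and>
      unl (f u) w - unl (f u) (mc u (tang u w)) \<in> normal_space f u"
      using sl_nrm[OF u w] nrm_orthogonal[OF u, of w]
      by (auto simp: tangent_plane_mc[OF u] normal_space_unl[OF u] nrm_def simp flip: unl.diff_right)
    fix t assume t: "t \<in> tangent_plane f u \<and> unl (f u) w - t \<in> normal_space f u"
    then obtain c where c: "t = unl (f u) (mc u c)" by (auto simp: tangent_plane_mc[OF u])
    have "gL (w - mc u c) (mc u y) = 0" for y
      using t normal_space_unl[OF u, of "w - mc u c"] by (simp add: c unl.diff_right)
    then show "t = unl (f u) (mc u (tang u w))"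
      using tang_unique[OF u, of c w] by (simp add: c gL.diff_left)
  qed
  then show ?thesis by (simp add: normal_part_def nrm_def unl.diff_right)
qed

text \<open>The left-trivialized covariant derivative, in direction \<open>x\<close>, of the image under the surface of
  the constant field \<open>y\<close>.\<close>

definition cov :: "real^2 \<Rightarrow> real^2 \<Rightarrow> real^2 \<Rightarrow> mat2_pair" where
  "cov u x y = dmc u x y + lam (mc u x) (mc u y)"

definition sff :: "real^2 \<Rightarrow> real^2 \<Rightarrow> real^2 \<Rightarrow> mat2_pair" where
  "sff u x y = nrm u (cov u x y)"

definition gam :: "real^2 \<Rightarrow> real^2 \<Rightarrow> real^2 \<Rightarrow> real^2" where
  "gam u x y = tang u (cov u x y)"

lemma cov_split: "cov u x y = mc u (gam u x y) + sff u x y"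
  by (simp add: sff_def nrm_def gam_def)

lemma cov_sym: "u \<in> D \<Longrightarrow> cov u x y = cov u y x"
  using maurer_cartan[of u x y] lam_torsion[of "mc u x" "mc u y"]
  by (simp add: cov_def algebra_simps)

lemma sl_cov: "u \<in> D \<Longrightarrow> sl (cov u x y)"
  by (simp add: cov_def sl_add sl_dmc sl_lam)

lemma sl_sff: "u \<in> D \<Longrightarrow> sl (sff u x y)"
  by (simp add: sff_def sl_nrm sl_cov)

lemma cov_differentiable: "u \<in> D \<Longrightarrow> (\<lambda>s. cov s x y) differentiable at u"
  unfolding cov_def
  by (intro derivative_intros smooth_on_differentiable[OF smooth_dmc]
      smooth_on_differentiable[OF smooth_on_bounded_bilinear[OF bounded_bilinear_lam open_D smooth_mc smooth_mc]])

lemma gam_differentiable: "u \<in> D \<Longrightarrow> (\<lambda>s. gam s x y) differentiable at u"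
  unfolding gam_def by (rule tang_differentiable[OF _ cov_differentiable])

lemma second_ff_eq:
  assumes u: "u \<in> D" and Y: "Y differentiable at u"
  shows "second_ff f X Y u = unl (f u) (sff u (X u) (Y u))"
proof -
  obtain Y' where Y: "(Y has_derivative Y') (at u)" using Y by (auto simp: differentiable_def)
  have "nabla_along f X (\<lambda>s. frechet_derivative f (at s) (Y s)) u =
    unl (f u) (dmc u (X u) (Y u) + mc u (Y' (X u)) + lam (mc u (X u)) (mc u (Y u)))"
    by (rule nabla_along_unl[OF u _ mc_field_deriv[OF u Y] sl_mc[OF u]]) (rule df_mc)
  also have "\<dots> = unl (f u) (cov u (X u) (Y u) + mc u (Y' (X u)))"
    by (simp add: cov_def algebra_simps)
  finally show ?thesis
    unfolding second_ff_def
    by (simp add: normal_part_unl[OF u] sl_add sl_cov[OF u] sl_mc[OF u] nrm_add[OF u] nrm_mc[OF u] sff_def)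
qed

lemma metric_compat:
  assumes u: "u \<in> D"
  shows "((\<lambda>s. gL (mc s y) (mc s z)) has_derivative
     (\<lambda>x. gL (cov u x y) (mc u z) + gL (mc u y) (cov u x z))) (at u)"
proof -
  have "gL (mc u y) (dmc u x z) + gL (dmc u x y) (mc u z) =
    gL (cov u x y) (mc u z) + gL (mc u y) (cov u x z)" for x
    using lam_skew[of "mc u x" "mc u y" "mc u z"] by (simp add: cov_def gL.add_left gL.add_right)
  then show ?thesis using gL.FDERIV[OF mc_deriv[OF u, of y] mc_deriv[OF u, of z]] by simp
qed

text \<open>The tangential part of the ambient connection is metric and torsion-free, so that it
  satisfies the Koszul formula.\<close>

lemma christoffel_gam:
  assumes u: "u \<in> D" shows "christoffel (induced_metric f) u x y = gam u x y"
proof -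
  have fd: "frechet_derivative (\<lambda>s. induced_metric f s y z) (at u) x =
    gL (cov u x y) (mc u z) + gL (mc u y) (cov u x z)" for x y z
    unfolding induced_metric_mc using frechet_derivative_at[OF metric_compat[OF u, of y z], symmetric]
    by (rule fun_cong)
  have K: "frechet_derivative (\<lambda>s. induced_metric f s y w) (at u) x
      + frechet_derivative (\<lambda>s. induced_metric f s x w) (at u) y
      - frechet_derivative (\<lambda>s. induced_metric f s x y) (at u) w = 2 * gL (cov u x y) (mc u w)" for w
    unfolding fd using cov_sym[OF u, of w x] cov_sym[OF u, of w y] cov_sym[OF u, of x y]
    by (simp add: gL_commute)
  show ?thesis
    unfolding christoffel_def K
    by (rule the_equality)
      (auto simp: induced_metric_mc gam_def tang_works[OF u] intro!: tang_unique[OF u, symmetric])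
qed

lemma coord_nabla_const: "u \<in> D \<Longrightarrow> coord_nabla (induced_metric f) (\<lambda>_. x) (\<lambda>_. y) u = gam u x y"
  by (simp add: coord_nabla_def christoffel_gam)

definition dgam :: "real^2 \<Rightarrow> real^2 \<Rightarrow> real^2 \<Rightarrow> real^2 \<Rightarrow> real^2" where
  "dgam u x y z = frechet_derivative (\<lambda>s. gam s y z) (at u) x"

lemma gam_deriv: "u \<in> D \<Longrightarrow> ((\<lambda>s. gam s y z) has_derivative (\<lambda>x. dgam u x y z)) (at u)"
  unfolding dgam_def using gam_differentiable frechet_derivative_works by blast

definition dcov :: "real^2 \<Rightarrow> real^2 \<Rightarrow> real^2 \<Rightarrow> real^2 \<Rightarrow> mat2_pair" where
  "dcov u x y z = frechet_derivative (\<lambda>s. cov s y z) (at u) x"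

lemma cov_deriv: "u \<in> D \<Longrightarrow> ((\<lambda>s. cov s y z) has_derivative (\<lambda>x. dcov u x y z)) (at u)"
  unfolding dcov_def using cov_differentiable frechet_derivative_works by blast

lemma sff_deriv: assumes u: "u \<in> D"
  shows "((\<lambda>s. sff s y z) has_derivative (\<lambda>x. dcov u x y z - dmc u x (gam u y z) - mc u (dgam u x y z))) (at u)"
proof -
  have "((\<lambda>s. cov s y z - mc s (gam s y z)) has_derivative
      (\<lambda>x. dcov u x y z - (dmc u x (gam u y z) + mc u (dgam u x y z)))) (at u)"
    by (rule has_derivative_diff[OF cov_deriv[OF u] mc_field_deriv[OF u gam_deriv[OF u]]])
  then show ?thesis by (simp add: cov_split diff_diff_eq)
qed

text \<open>Curvature as the commutator of covariant derivatives; the second derivatives of \<open>mc\<close> cancel by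
  symmetry, and the Maurer-Cartan equation supplies the bracket term.\<close>

lemma ricci_identity:
  assumes u: "u \<in> D"
  shows "(dcov u x y z + lam (mc u x) (cov u y z)) - (dcov u y x z + lam (mc u y) (cov u x z)) =
    RL (mc u x) (mc u y) (mc u z)"
proof -
  define d2 where "d2 x y z = frechet_derivative (\<lambda>s. dmc s y z) (at u) x" for x y z
  have d2: "((\<lambda>s. dmc s y z) has_derivative (\<lambda>x. d2 x y z)) (at u)" for y z
    unfolding d2_def by (rule smooth_on_has_derivative[OF smooth_dmc u])
  have d2_sym: "d2 x y z = d2 y x z"
    by (rule symmetric_second_derivative[OF open_D u mc_deriv d2 d2])
  have "((\<lambda>s. cov s y z) has_derivative
      (\<lambda>x. d2 x y z + (lam (mc u y) (dmc u x z) + lam (dmc u x y) (mc u z)))) (at u)" for y z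
    unfolding cov_def by (rule has_derivative_add[OF d2 lam.FDERIV[OF mc_deriv[OF u] mc_deriv[OF u]]])
  from has_derivative_unique[OF cov_deriv[OF u] this]
  have dc: "dcov u x y z = d2 x y z + (lam (mc u y) (dmc u x z) + lam (dmc u x y) (mc u z))" for x y z
    by (rule fun_cong)
  have "lam (dmc u x y) (mc u z) - lam (dmc u y x) (mc u z) = - lam (br2 (mc u x) (mc u y)) (mc u z)"
    using maurer_cartan[OF u, of x y] by (simp flip: lam.diff_left lam.minus_left)
  then show ?thesis
    unfolding dc RL_def using d2_sym by (simp add: cov_def lam.add_right algebra_simps)
qed

end

section \<open>The equations of Codazzi and Gauss\<close>

lemma smooth_on_const: "smooth_on S (\<lambda>_. c)"
proof -
  have "Cn_on n S (\<lambda>_. c)" for n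
    by (induction n arbitrary: c) (auto simp: frechet_derivative_const)
  then show ?thesis by (simp add: smooth_on_def)
qed

text \<open>In the three-dimensional space of traceless matrices the bracket is a cross product.\<close>

lemma commuting_parallel:
  assumes "trace x = 0" "trace y = 0" "br x y = 0" "x \<noteq> 0"
  obtains c where "y = c *\<^sub>R x"
proof -
  have t: "x$2$2 = - x$1$1" "y$2$2 = - y$1$1" using assms by (auto simp: trace0_22)
  have e: "x$1$2 * y$2$1 = y$1$2 * x$2$1" "x$1$1 * y$1$2 = y$1$1 * x$1$2" "x$1$1 * y$2$1 = y$1$1 * x$2$1"
    using assms(3) by (auto simp: mat2_coords t)
  consider "x$1$1 \<noteq> 0" | "x$1$2 \<noteq> 0" | "x$2$1 \<noteq> 0"
    using assms(4) t by (auto simp: vec_eq_iff forall_2)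
  then show thesis
  proof cases
    case 1 then show ?thesis using e by (intro that[of "y$1$1 / x$1$1"]) (auto simp: vec_eq_iff forall_2 t field_simps)
  next
    case 2 then show ?thesis using e by (intro that[of "y$1$2 / x$1$2"]) (auto simp: vec_eq_iff forall_2 t field_simps)
  next
    case 3 then show ?thesis using e by (intro that[of "y$2$1 / x$2$1"]) (auto simp: vec_eq_iff forall_2 t field_simps)
  qed
qed

lemma unl_eq_0: "p \<in> SL2xSL2 \<Longrightarrow> unl p w = 0 \<Longrightarrow> w = 0"
  using ltr_unl[of p w] ltr_unl[of p 0] by (simp add: unl.zero_right)

context surface_patch begin

lemma parallel_equation:
  assumes u: "u \<in> D" and par: "nabla_second_ff f (\<lambda>_. x) (\<lambda>_. y) (\<lambda>_. z) u = 0"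
    and S: "((\<lambda>s. sff s y z) has_derivative S') (at u)"
  shows "nrm u (S' x + lam (mc u x) (sff u y z)) = sff u (gam u x y) z + sff u y (gam u x z)"
proof -
  have sl': "sl (S' x)" by (rule sl_deriv[OF u S sl_sff])
  have "second_ff f (\<lambda>_. y) (\<lambda>_. z) s = unl (f s) (sff s y z)" if "s \<in> D" for s
    by (rule second_ff_eq[OF that, of "\<lambda>_. z" "\<lambda>_. y"]) simp
  from nabla_along_unl[OF u this S sl_sff[OF u], of "\<lambda>_. x"]
  have 1: "normal_nabla f (\<lambda>_. x) (second_ff f (\<lambda>_. y) (\<lambda>_. z)) u =
      unl (f u) (nrm u (S' x + lam (mc u x) (sff u y z)))"
    unfolding normal_nabla_def by (simp add: normal_part_unl[OF u] sl_add sl' sl_lam)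
  obtain g where g: "((\<lambda>s. gam s x z) has_derivative g) (at u)"
    using gam_deriv[OF u] by blast
  have "(coord_nabla (induced_metric f) (\<lambda>_. x) (\<lambda>_. z) has_derivative g) (at u)"
    by (rule has_derivative_on_D_cong[OF g u]) (simp add: coord_nabla_const)
  then have d: "coord_nabla (induced_metric f) (\<lambda>_. x) (\<lambda>_. z) differentiable at u"
    by (auto simp: differentiable_def)
  have "unl (f u) (nrm u (S' x + lam (mc u x) (sff u y z)) - sff u (gam u x y) z - sff u y (gam u x z)) = 0"
    using par unfolding nabla_second_ff_def 1
    by (simp add: second_ff_eq[OF u] second_ff_eq[OF u d] coord_nabla_const[OF u] unl.diff_right)
  from unl_eq_0[OF f_SL[OF u] this] show ?thesis by (simp add: algebra_simps)
qed

text \<open>The derivative of \<open>cov\<close> splits into the derivative of the second fundamental form, a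
  tangential term and the second fundamental form of the Christoffel term. Under the hypothesis
  the antisymmetrized normal part cancels completely.\<close>

lemma codazzi:
  assumes u: "u \<in> D" and par: "\<And>x y z. nabla_second_ff f (\<lambda>_. x) (\<lambda>_. y) (\<lambda>_. z) u = 0"
  shows "nrm u (RL (mc u x) (mc u y) (mc u z)) = 0"
proof -
  have e: "nrm u (dcov u x y z + lam (mc u x) (cov u y z)) =
      sff u x (gam u y z) + (sff u (gam u x y) z + sff u y (gam u x z))" for x y z
  proof -
    have split: "dcov u x y z + lam (mc u x) (cov u y z) = cov u x (gam u y z) + mc u (dgam u x y z)
       + (dcov u x y z - dmc u x (gam u y z) - mc u (dgam u x y z) + lam (mc u x) (sff u y z))"
      unfolding cov_split[of u y z] by (simp add: cov_def lam.add_right)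
    show ?thesis
      unfolding split nrm_add[OF u, of "_ + _" "_ - _ - _ + _"] nrm_add[OF u, of "cov u _ _"] nrm_mc[OF u]
        parallel_equation[OF u par sff_deriv[OF u], of x y z]
      by (simp add: sff_def)
  qed
  have "gam u y x = gam u x y" by (simp add: gam_def cov_sym[OF u, of y x])
  then show ?thesis
    unfolding ricci_identity[OF u, symmetric] nrm_diff[OF u] e by simp
qed

text \<open>Without second fundamental form the ambient covariant derivative is the intrinsic one, so
  that the curvatures agree on the tangent plane.\<close>

lemma riemann_totally_geodesic:
  assumes u: "u \<in> D" and tg: "\<And>s x y. s \<in> D \<Longrightarrow> sff s x y = 0"
  shows "mc u (riemann (induced_metric f) u x y z) = RL (mc u x) (mc u y) (mc u z)"
proof -
  have nab: "coord_nabla (induced_metric f) (\<lambda>_. x) (coord_nabla (induced_metric f) (\<lambda>_. y) (\<lambda>_. z)) u =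
    dgam u x y z + gam u x (gam u y z)" for x y
  proof -
    have "(coord_nabla (induced_metric f) (\<lambda>_. y) (\<lambda>_. z) has_derivative (\<lambda>x. dgam u x y z)) (at u)"
      by (rule has_derivative_on_D_cong[OF gam_deriv[OF u] u]) (simp add: coord_nabla_const)
    from frechet_derivative_at[OF this, symmetric] show ?thesis
      unfolding coord_nabla_def[of _ "\<lambda>_. x"]
      by (simp add: coord_nabla_const[OF u] christoffel_gam[OF u])
  qed
  have c: "cov s x y = mc s (gam s x y)" if "s \<in> D" for s x y
    using cov_split[of s x y] tg[OF that] by simp
  have "((\<lambda>s. cov s y z) has_derivative (\<lambda>x. dmc u x (gam u y z) + mc u (dgam u x y z))) (at u)" for y z
    by (rule has_derivative_on_D_cong[OF mc_field_deriv[OF u gam_deriv[OF u]] u]) (simp add: c)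
  from has_derivative_unique[OF cov_deriv[OF u] this]
  have "dcov u x y z = dmc u x (gam u y z) + mc u (dgam u x y z)" for x y z by (rule fun_cong)
  note dc = this
  have "dcov u x y z + lam (mc u x) (cov u y z) = mc u (dgam u x y z + gam u x (gam u y z))" for x y
  proof -
    have "dcov u x y z + lam (mc u x) (cov u y z) = cov u x (gam u y z) + mc u (dgam u x y z)"
      unfolding dc c[OF u, of y z] cov_def[of u x] by simp
    then show ?thesis unfolding c[OF u, of x] by (simp add: mc_add[OF u])
  qed
  then show ?thesis
    unfolding ricci_identity[OF u, symmetric] riemann_def nab by (simp add: mc_diff[OF u])
qed

lemma gauss_curvature_totally_geodesic:
  assumes u: "u \<in> D" and tg: "\<And>s x y. s \<in> D \<Longrightarrow> sff s x y = 0"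
  defines "a \<equiv> mc u (axis 1 1)" and "b \<equiv> mc u (axis 2 1)"
  shows "gauss_curvature (induced_metric f) u = gL (RL a b b) a / (gL a a * gL b b - (gL a b)\<^sup>2)"
  unfolding gauss_curvature_def Let_def a_def b_def
  by (simp only: induced_metric_mc riemann_totally_geodesic[OF u tg])

text \<open>Provides the direction in the parameter domain which represents \<open>J\<close>.\<close>

lemma JL_mc: assumes u: "u \<in> D" obtains v' where "mc u v' = JL (mc u v)"
proof -
  have "J_NK (f u) (frechet_derivative f (at u) v) \<in> tangent_plane f u"
    using J_inv[OF u] by (auto simp: tangent_plane_def)
  then obtain v' where "unl (f u) (JL (mc u v)) = unl (f u) (mc u v')"
    by (auto simp: tangent_plane_mc[OF u] J_NK_ltr mc_def)
  then show thesis using that ltr_unl[OF f_SL[OF u]] by metis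
qed

lemma mc_complex_line:
  assumes u: "u \<in> D" and v: "v \<noteq> 0"
  obtains r s where "mc u w = r *\<^sub>R mc u v + s *\<^sub>R JL (mc u v)"
proof -
  obtain v' where v': "mc u v' = JL (mc u v)" using JL_mc[OF u] .
  have z: "mc u v \<noteq> 0" using mc_eq_0[OF u] v by blast
  have np: "v' \<noteq> c *\<^sub>R v" for c
  proof
    assume "v' = c *\<^sub>R v"
    then have c: "JL (mc u v) = c *\<^sub>R mc u v" using v' mc_scaleR[OF u] by metis
    have "- mc u v = (c * c) *\<^sub>R mc u v"
      using JL_JL[of "mc u v"] by (simp add: c JL_scaleR)
    from arg_cong[OF this, of "\<lambda>w. w + mc u v"]
    have "(c * c + 1) *\<^sub>R mc u v = 0" by (simp add: scaleR_add_left)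
    moreover have "c * c + 1 \<noteq> 0" using zero_le_square[of c] by linarith
    ultimately show False using z by simp
  qed
  \<comment> \<open>\<open>v\<close> and \<open>v'\<close> form a basis because \<open>J\<close> has no real eigenvalue\<close>
  define d where "d = v$1 * v'$2 - v$2 * v'$1"
  have d: "d \<noteq> 0"
  proof
    assume 0: "d = 0"
    show False
    proof (cases "v$1 = 0")
      case False
      then have "v' = (v'$1 / v$1) *\<^sub>R v" using 0 by (simp add: d_def vec_eq_iff forall_2 field_simps)
      then show False using np by blast
    next
      case True
      then have "v$2 \<noteq> 0" using v by (simp add: vec_eq_iff forall_2)
      then have "v' = (v'$2 / v$2) *\<^sub>R v" using 0 True by (simp add: d_def vec_eq_iff forall_2 field_simps)
      then show False using np by blast
    qed
  qed
  have "w = ((w$1 * v'$2 - w$2 * v'$1) / d) *\<^sub>R v + ((v$1 * w$2 - v$2 * w$1) / d) *\<^sub>R v'"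
    using d by (simp add: vec_eq_iff forall_2 field_simps) (simp add: d_def algebra_simps)
  then have "mc u w = ((w$1 * v'$2 - w$2 * v'$1) / d) *\<^sub>R mc u v + ((v$1 * w$2 - v$2 * w$1) / d) *\<^sub>R JL (mc u v)"
    using v' mc_add[OF u] mc_scaleR[OF u] by metis
  then show thesis by (rule that)
qed

lemma mc_regular:
  assumes u: "u \<in> D" and v: "v \<noteq> 0" shows "gL (mc u v) (mc u v) \<noteq> 0"
proof
  assume 0: "gL (mc u v) (mc u v) = 0"
  have "induced_metric f u v y = 0" for y
  proof -
    obtain r s where "mc u y = r *\<^sub>R mc u v + s *\<^sub>R JL (mc u v)" using mc_complex_line[OF u v] .
    then show ?thesis
      by (simp add: induced_metric_mc gL.add_right gL.scaleR_right 0 gL_JL_self)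
  qed
  then show False using nondeg[OF u] v by blast
qed

text \<open>By the Codazzi equation the curvature \<open>R(z, Jz)z\<close> is tangent.\<close>

lemma pointwise_dichotomy:
  assumes u: "u \<in> D" and par: "\<And>x y z. nabla_second_ff f (\<lambda>_. x) (\<lambda>_. y) (\<lambda>_. z) u = 0"
    and v: "v \<noteq> 0"
  shows "br (fst (mc u v)) (snd (mc u v)) = 0 \<or>
    ip (fst (mc u v)) (fst (mc u v)) = 2 * ip (fst (mc u v)) (snd (mc u v)) \<and>
    ip (snd (mc u v)) (snd (mc u v)) = 2 * ip (fst (mc u v)) (snd (mc u v))"
proof -
  let ?z = "mc u v" let ?g = "br (fst ?z) (snd ?z)"
  obtain v' where v': "mc u v' = JL ?z" using JL_mc[OF u] .
  have "RL ?z (JL ?z) ?z = mc u (tang u (RL ?z (JL ?z) ?z))"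
    using codazzi[OF u par, of v v' v] by (simp add: v' nrm_def)
  moreover obtain r s where "mc u (tang u (RL ?z (JL ?z) ?z)) = r *\<^sub>R ?z + s *\<^sub>R JL ?z"
    using mc_complex_line[OF u v] .
  moreover have "RL ?z (JL ?z) ?z = (- 2 / (3 * sqrt 3)) *\<^sub>R (br (fst ?z) ?g, br (snd ?z) ?g)"
    by (rule RL_complex_line[of ?z 1 ?z 0]) simp
  ultimately have "(- 2 / (3 * sqrt 3)) *\<^sub>R (br (fst ?z) ?g, br (snd ?z) ?g) = r *\<^sub>R ?z + s *\<^sub>R JL ?z"
    by (simp only:)
  from arg_cong[OF this, of "\<lambda>w. (- (3 * sqrt 3) / 2) *\<^sub>R w"]
  have "(br (fst ?z) ?g, br (snd ?z) ?g) = (- (3 * sqrt 3) / 2 * r) *\<^sub>R ?z + (- (3 * sqrt 3) / 2 * s) *\<^sub>R JL ?z"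
    by (simp only: scaleR_add_right scaleR_scaleR) (simp add: field_simps)
  then show ?thesis by (rule complex_line_dichotomy[OF sl_mc[OF u]])
qed

end

section \<open>Planes orthogonal to a timelike axis\<close>

text \<open>Left multiplication by \<open>rho N\<close> on the complement of \<open>N\<close> is the rotation by \<open>\<pi>/3\<close>; \<open>rhoc N\<close> is the
  inverse rotation.\<close>

definition rho :: "mat2 \<Rightarrow> mat2" where "rho N = (1/2) *\<^sub>R mat 1 + (sqrt 3 / 2) *\<^sub>R N"
definition rhoc :: "mat2 \<Rightarrow> mat2" where "rhoc N = (1/2) *\<^sub>R mat 1 - (sqrt 3 / 2) *\<^sub>R N"

lemma TN_iff: "z \<in> TN N \<longleftrightarrow> trace (fst z) = 0 \<and> ip N (fst z) = 0 \<and> snd z = rho N ** fst z"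
  by (cases z) (auto simp: TN_def rho_def mul_linear)

lemma right_assoc: "(X ** Y) ** Z = X ** (Y ** Z)" for X Y Z :: mat2
  by (rule matrix_mul_assoc[symmetric])

lemma times_two: "x * 2 = 2 *\<^sub>R x" "2 * x = 2 *\<^sub>R x" for x :: mat2
  by (simp_all add: vec_eq_iff)

lemma sqrt3_mult: "sqrt 3 * (sqrt 3 * t) = 3 * t" for t :: real
  by (simp flip: mult.assoc)

text \<open>Together with the next lemma these rules bring every product into a normal form in which
  factors \<open>N\<close> stand on the left and occur at most once.\<close>

lemma unit_rules:
  fixes Y :: mat2
  assumes "trace N = 0" "ip N N = -1"
  shows "N ** N = - mat 1" "N ** (N ** Y) = - Y"
  using square_traceless[OF assms(1)] assms(2) by (simp_all add: matrix_mul_assoc mul_linear)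

lemma orth_rules:
  fixes Y :: mat2
  assumes "trace N = 0" "trace a = 0" "ip N a = 0"
  shows "a ** N = - (N ** a)" "a ** (N ** Y) = - (N ** (a ** Y))"
  using anticommute_traceless[OF assms] by (simp_all add: matrix_mul_assoc mul_linear)

lemma rotate_orth:
  assumes "trace N = 0" "ip N N = -1" "trace a = 0" "ip N a = 0"
  shows "trace (N ** a) = 0" "ip N (N ** a) = 0"
proof -
  show "trace (N ** a) = 0" using assms(4) by (simp add: ip_def)
  show "ip N (N ** a) = 0"
    using assms(3) by (simp add: ip_def unit_rules[OF assms(1,2)] trace_mat2_linear)
qed

text \<open>\<open>br a x\<close> is orthogonal to \<open>a\<close> and \<open>x\<close> and therefore a multiple of \<open>N\<close>. Multiplying it with \<open>a\<close>
  recovers \<open>x\<close>.\<close>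

lemma orth_span:
  assumes N: "trace N = 0" "ip N N = -1" and a: "trace a = 0" "ip N a = 0" "ip a a \<noteq> 0"
    and x: "trace x = 0" "ip N x = 0"
  obtains r s where "x = r *\<^sub>R a + s *\<^sub>R (N ** a)"
proof -
  have "br N (br a x) = 0" using triple_br[OF N(1) a(1) x(1)] by (simp add: a x)
  moreover have "N \<noteq> 0" using N(2) by (auto simp: ip_linear)
  ultimately obtain k where k: "br a x = k *\<^sub>R N" using commuting_parallel[OF N(1) trace_br] by metis
  have "ip a a *\<^sub>R x = (a ** a) ** x" by (simp add: square_traceless[OF a(1)] mul_linear)
  also have "\<dots> = a ** (ip a x *\<^sub>R mat 1 + (1/2) *\<^sub>R br a x)"
    using mult_traceless[OF a(1) x(1)] by (simp add: right_assoc)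
  also have "\<dots> = ip a x *\<^sub>R a + (- k / 2) *\<^sub>R (N ** a)"
    by (simp add: k mul_linear orth_rules[OF N(1) a(1,2)])
  finally have "ip a a *\<^sub>R x = ip a x *\<^sub>R a + (- k / 2) *\<^sub>R (N ** a)" .
  from arg_cong[OF this, of "\<lambda>w. (1 / ip a a) *\<^sub>R w"]
  have "x = (ip a x / ip a a) *\<^sub>R a + (- k / 2 / ip a a) *\<^sub>R (N ** a)"
    using a(3) by (simp add: scaleR_right_diff_distrib mult.commute)
  then show thesis by (rule that)
qed

lemma rotate_ip:
  assumes N: "trace N = 0" "ip N N = -1" and a: "trace a = 0" "ip N a = 0"
  shows "ip a (N ** a) = 0" "ip (N ** a) a = 0" "ip (N ** a) (N ** a) = ip a a"
proof -
  have aa: "a ** a = ip a a *\<^sub>R mat 1" by (rule square_traceless[OF a(1)])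
  have "a ** (N ** a) = - (ip a a *\<^sub>R N)"
    by (simp only: orth_rules(2)[OF N(1) a] aa mul_linear matrix_mul_rid)
  then show 1: "ip a (N ** a) = 0" using N(1) by (simp add: ip_def trace_mat2_linear)
  then show "ip (N ** a) a = 0" using ip_commute[of a "N ** a"] by simp
  have "(N ** a) ** (N ** a) = a ** a"
    by (simp only: right_assoc orth_rules(2)[OF N(1) a] mul_linear unit_rules(2)[OF N] minus_minus)
  then show "ip (N ** a) (N ** a) = ip a a" by (simp only: ip_def)
qed

lemma orth_definite:
  assumes N: "trace N = 0" "ip N N = -1" and a: "trace a = 0" "ip N a = 0" "ip a a \<noteq> 0"
    and x: "trace x = 0" "ip N x = 0" and o: "ip x a = 0" "ip x (N ** a) = 0"
  shows "x = 0"
proof -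
  obtain r s where x': "x = r *\<^sub>R a + s *\<^sub>R (N ** a)" using orth_span[OF N a x] .
  show ?thesis using o a(3) rotate_ip[OF N a(1,2)] unfolding x' by (simp add: linear_ip)
qed

lemma gL_TN:
  assumes N: "trace N = 0" "ip N N = -1" and z: "z \<in> TN N"
  shows "gL z z = ip (fst z) (fst z)"
proof -
  define a where "a = fst z"
  have a: "trace a = 0" "ip N a = 0" "snd z = rho N ** a" using z by (auto simp: TN_iff a_def)
  note 1 = rotate_ip[OF N a(1,2)]
  show ?thesis
    by (simp add: gL_def a(3) a_def[symmetric] rho_def mul_linear linear_ip 1 power2_eq_square[symmetric])
qed

text \<open>\<open>c \<mapsto> N c N\<close> fixes the complement of \<open>N\<close> and negates everything that commutes with \<open>N\<close>. Adding it
  to the identity gives twice the projection to the complement; it kills multiples of the identity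
  as well, and this makes it convenient for products.\<close>

lemma component_projection:
  assumes N: "trace N = 0" "ip N N = -1" and c: "trace c = 0"
  shows "c + N ** (c ** N) = 2 *\<^sub>R (c + ip N c *\<^sub>R N)"
proof -
  define x where "x = c + ip N c *\<^sub>R N"
  have x: "trace x = 0" "ip N x = 0" using N c by (simp_all add: x_def trace_mat2_linear linear_ip)
  have "c = x - ip N c *\<^sub>R N" by (simp add: x_def)
  then have "c + N ** (c ** N) = (x - ip N c *\<^sub>R N) + N ** ((x - ip N c *\<^sub>R N) ** N)" by simp
  also have "\<dots> = 2 *\<^sub>R x"
    by (simp add: mul_linear orth_rules[OF N(1) x] unit_rules[OF N] scaleR_2)
  finally show ?thesis by (simp add: x_def)
qed

text \<open>Here \<open>a\<close>, \<open>b\<close> are the first entries of the surface derivative in two directions, \<open>p\<close>, \<open>q\<close> their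
  mixed derivatives and \<open>n\<close>, \<open>m\<close> the derivatives of the axis. The hypotheses are the two Maurer-Cartan
  equations, for the first entries and for their images under \<open>rho N\<close>.\<close>

lemma connection_form_eq:
  assumes N: "trace N = 0" "ip N N = -1"
    and a: "trace a = 0" "ip N a = 0" and b: "trace b = 0" "ip N b = 0"
    and pq: "p - q = - br a b"
    and pq': "((1/2) *\<^sub>R p + (sqrt 3/2) *\<^sub>R (N ** p + n ** b)) - ((1/2) *\<^sub>R q + (sqrt 3/2) *\<^sub>R (N ** q + m ** a))
       = - br (rho N ** a) (rho N ** b)"
  shows "(n + (1/sqrt 3) *\<^sub>R a - N ** a) ** b = (m + (1/sqrt 3) *\<^sub>R b - N ** b) ** a"
proof -
  note r = mul_linear right_assoc unit_rules[OF N] orth_rules[OF N(1) a] orth_rules[OF N(1) b]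
  have p: "p = q - br a b" using pq by (simp add: algebra_simps)
  have "(sqrt 3/2) *\<^sub>R (n ** b - m ** a) = (sqrt 3/2) *\<^sub>R (N ** br a b) - (1/2) *\<^sub>R br a b"
  proof -
    have "(((1/2) *\<^sub>R p + (sqrt 3/2) *\<^sub>R (N ** p + n ** b)) - ((1/2) *\<^sub>R q + (sqrt 3/2) *\<^sub>R (N ** q + m ** a))) $ i $ j
       = (- br (rho N ** a) (rho N ** b)) $ i $ j" for i j
      by (simp only: pq')
    then have "((sqrt 3/2) *\<^sub>R (n ** b - m ** a)) $ i $ j = ((sqrt 3/2) *\<^sub>R (N ** br a b) - (1/2) *\<^sub>R br a b) $ i $ j" for i j
      unfolding p by (simp add: rho_def br_def r algebra_simps) (smt (verit, ccfv_threshold) field_sum_of_halves)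
    then show ?thesis by (simp add: vec_eq_iff)
  qed
  from arg_cong[OF this, of "\<lambda>w. (2/sqrt 3) *\<^sub>R w"]
  have "n ** b - m ** a = N ** br a b - (1/sqrt 3) *\<^sub>R br a b"
    by (simp add: scaleR_diff_right)
  then have "n ** b = m ** a + N ** br a b - (1/sqrt 3) *\<^sub>R br a b" by (simp add: algebra_simps)
  then show ?thesis by (simp add: mul_linear right_assoc br_def algebra_simps)
qed

text \<open>The hypotheses say that the covariant derivative of the normal vector with entries \<open>k1 N\<close>,
  \<open>k2 N\<close> is tangent up to multiples of \<open>N\<close>. In terms of the complex structure \<open>N\<close>, the conclusion
  equates a term in the antilinear part \<open>M\<close> of the derivative of \<open>N\<close> with a term linear in \<open>a\<close>.\<close>

lemma normal_connection_eq:
  assumes N: "trace N = 0" "ip N N = -1"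
    and a: "trace a = 0" "ip N a = 0" and M: "trace M = 0" "ip N M = 0"
    and a': "trace a' = 0" "ip N a' = 0"
    and n: "n = M - (1/sqrt 3) *\<^sub>R a + N ** a"
    and W1: "l1 *\<^sub>R N + k1 *\<^sub>R n + ((1/2) *\<^sub>R br a (k1 *\<^sub>R N) - (1/6) *\<^sub>R (br a (k2 *\<^sub>R N) - br (rho N ** a) (k1 *\<^sub>R N)))
       = a' + r *\<^sub>R N"
    and W2: "l2 *\<^sub>R N + k2 *\<^sub>R n + ((1/2) *\<^sub>R br (rho N ** a) (k2 *\<^sub>R N) + (1/6) *\<^sub>R (br a (k2 *\<^sub>R N) - br (rho N ** a) (k1 *\<^sub>R N)))
       = rho N ** a' + s *\<^sub>R N"
  shows "(k2 - k1/2) *\<^sub>R M - (sqrt 3/2 * k1) *\<^sub>R (N ** M) =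
    - (1/sqrt 3) *\<^sub>R ((k2 - k1/2) *\<^sub>R a + (sqrt 3/2 * k1) *\<^sub>R (N ** a))"
proof -
  note r = mul_linear right_assoc unit_rules[OF N] orth_rules[OF N(1) a] orth_rules[OF N(1) M] orth_rules[OF N(1) a']
  \<comment> \<open>\<open>?P\<close> projects to the complement of \<open>N\<close>, see \<open>component_projection\<close>\<close>
  let ?P = "\<lambda>c. (1/2) *\<^sub>R (c + N ** (c ** N))"
  have "(k1 *\<^sub>R n - k1 *\<^sub>R (N ** a) + (1/3) *\<^sub>R (k2 *\<^sub>R (N ** a) - k1 *\<^sub>R ((1/2) *\<^sub>R (N ** a) - (sqrt 3/2) *\<^sub>R a))) $ i $ j = a' $ i $ j" for i j
    using arg_cong[OF W1, of "\<lambda>c. ?P c $ i $ j"] unfolding n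
    by (simp add: rho_def br_def r) (simp add: field_simps sqrt3_mult times_two r)
  then have 1: "k1 *\<^sub>R n - k1 *\<^sub>R (N ** a) + (1/3) *\<^sub>R (k2 *\<^sub>R (N ** a) - k1 *\<^sub>R ((1/2) *\<^sub>R (N ** a) - (sqrt 3/2) *\<^sub>R a)) = a'"
    by (simp only: vec_eq_iff) simp
  have "(k2 *\<^sub>R n - k2 *\<^sub>R ((1/2) *\<^sub>R (N ** a) - (sqrt 3/2) *\<^sub>R a)
      - (1/3) *\<^sub>R (k2 *\<^sub>R (N ** a) - k1 *\<^sub>R ((1/2) *\<^sub>R (N ** a) - (sqrt 3/2) *\<^sub>R a))) $ i $ j
      = ((1/2) *\<^sub>R a' + (sqrt 3/2) *\<^sub>R (N ** a')) $ i $ j" for i j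
    using arg_cong[OF W2, of "\<lambda>c. ?P c $ i $ j"] unfolding n
    by (simp add: rho_def br_def r) (simp add: field_simps sqrt3_mult times_two r)
  note 2 = this[unfolded 1[symmetric] n]
  have "((k2 - k1/2) *\<^sub>R M - (sqrt 3/2 * k1) *\<^sub>R (N ** M)) $ i $ j =
    (- (1/sqrt 3) *\<^sub>R ((k2 - k1/2) *\<^sub>R a + (sqrt 3/2 * k1) *\<^sub>R (N ** a))) $ i $ j" for i j
    using 2[of i j] by (simp add: r) (simp add: field_simps sqrt3_mult)
  then show ?thesis by (simp only: vec_eq_iff) simp
qed

lemma complex_coefficients_zero:
  assumes N: "trace N = 0" "ip N N = -1" and a: "trace a = 0" "ip N a = 0" "ip a a \<noteq> 0"
    and 0: "p *\<^sub>R a + q *\<^sub>R (N ** a) = 0"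
  shows "p = 0 \<and> q = 0"
proof -
  have "ip a (p *\<^sub>R a + q *\<^sub>R (N ** a)) = 0" "ip (N ** a) (p *\<^sub>R a + q *\<^sub>R (N ** a)) = 0"
    unfolding 0 by (simp_all add: ip_linear)
  then show ?thesis using a(3) rotate_ip[OF N a(1,2)] by (simp add: linear_ip)
qed

text \<open>The second equation is the first one for the direction rotated by a right angle: the
  antilinear term \<open>M\<close> is multiplied by \<open>N\<close> and the linear term \<open>a\<close> by \<open>- N\<close>. So the two sides have to
  vanish separately.\<close>

lemma antilinear_and_linear_zero:
  assumes N: "trace N = 0" "ip N N = -1" and a: "trace a = 0" "ip N a = 0" "ip a a \<noteq> 0"
    and 1: "p *\<^sub>R M - q *\<^sub>R (N ** M) = c *\<^sub>R (p *\<^sub>R a + q *\<^sub>R (N ** a))"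
    and 2: "p *\<^sub>R (N ** M) - q *\<^sub>R (N ** (N ** M)) = c *\<^sub>R (p *\<^sub>R (- (N ** a)) + q *\<^sub>R (N ** (- (N ** a))))"
    and c: "c \<noteq> 0"
  shows "p = 0 \<and> q = 0"
proof (rule complex_coefficients_zero[OF N a])
  have "c *\<^sub>R (p *\<^sub>R a + q *\<^sub>R (N ** a)) = - (c *\<^sub>R (p *\<^sub>R a + q *\<^sub>R (N ** a)))"
    using arg_cong[OF 2, of "\<lambda>w. - (N ** w)"] 1
    by (simp add: mul_linear unit_rules[OF N] algebra_simps)
  then have "2 *\<^sub>R (c *\<^sub>R (p *\<^sub>R a + q *\<^sub>R (N ** a))) = 0" unfolding scaleR_2 by (metis add.right_inverse)
  then show "p *\<^sub>R a + q *\<^sub>R (N ** a) = 0" using c by simp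
qed

section \<open>Surfaces with null tangent planes\<close>

lemma RL_self: "RL a a c = 0"
  by (simp add: RL_def br2_def lam_def br_linear prod_eq_iff)

lemma RL_add_middle: "RL a (b + b') c = RL a b c + RL a b' c"
  and RL_scaleR_middle: "RL a (k *\<^sub>R b) c = k *\<^sub>R RL a b c"
  by (simp_all add: RL_def lam.add_left lam.add_right lam.scaleR_left lam.scaleR_right
      br2.add_right br2.scaleR_right algebra_simps)

locale null_patch = surface_patch +
  assumes parallel: "u \<in> D \<Longrightarrow> nabla_second_ff f (\<lambda>_. x) (\<lambda>_. y) (\<lambda>_. z) u = 0"
    and null: "u \<in> D \<Longrightarrow> v \<noteq> 0 \<Longrightarrow> ip (fst (mc u v)) (fst (mc u v)) = 2 * ip (fst (mc u v)) (snd (mc u v))"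
      "u \<in> D \<Longrightarrow> v \<noteq> 0 \<Longrightarrow> ip (snd (mc u v)) (snd (mc u v)) = 2 * ip (fst (mc u v)) (snd (mc u v))"
begin

definition N :: "real^2 \<Rightarrow> mat2" where "N u = nu (mc u (axis 1 1))"
definition al :: "real^2 \<Rightarrow> real^2 \<Rightarrow> mat2" where "al u v = fst (mc u v)"
definition dN :: "real^2 \<Rightarrow> real^2 \<Rightarrow> mat2" where "dN u x = frechet_derivative N (at u) x"
text \<open>The antilinear part of the derivative of the axis, for the complex structure \<open>N\<close>. Like the
  trace-free part of a shape operator it measures the failure of being umbilic.\<close>

definition umb :: "real^2 \<Rightarrow> real^2 \<Rightarrow> mat2" where
  "umb u x = dN u x + (1/sqrt 3) *\<^sub>R al u x - N u ** al u x"

lemma al_regular: assumes "u \<in> D" "v \<noteq> 0" shows "ip (al u v) (al u v) \<noteq> 0"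
  using mc_regular[OF assms] null[OF assms] by (auto simp: gL_def al_def ip_commute[of "snd (mc u v)" "fst (mc u v)"])

lemma e1: "axis 1 1 \<noteq> (0::real^2)" by (simp add: axis_eq_0_iff)

lemma N_unit: assumes "u \<in> D" shows "trace (N u) = 0" "ip (N u) (N u) = -1"
  using nu_props(1,2)[OF sl_mc[OF assms] null[OF assms e1] al_regular[OF assms e1, unfolded al_def]]
  by (simp_all add: N_def)

lemma mc_TN: assumes u: "u \<in> D" shows "mc u v \<in> TN (N u)"
proof -
  obtain r s where rs: "mc u v = r *\<^sub>R mc u (axis 1 1) + s *\<^sub>R JL (mc u (axis 1 1))"
    using mc_complex_line[OF u e1] .
  show ?thesis
    using nu_props(3,4)[OF sl_mc[OF u] null[OF u e1] al_regular[OF u e1, unfolded al_def]]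
    unfolding rs N_def by (intro TN_add TN_scaleR)
qed

lemma al_orth: assumes "u \<in> D" shows "trace (al u v) = 0" "ip (N u) (al u v) = 0"
  using mc_TN[OF assms, of v] by (simp_all add: TN_iff al_def)

lemma snd_mc: "u \<in> D \<Longrightarrow> snd (mc u v) = rho (N u) ** al u v"
  using mc_TN[of u v] by (simp add: TN_iff al_def)

lemma mc_al: "u \<in> D \<Longrightarrow> mc u v = (al u v, rho (N u) ** al u v)"
  using snd_mc[of u v] by (simp add: prod_eq_iff al_def)

text \<open>The denominator in the formula for the axis is nonzero by regularity.\<close>

lemma N_deriv: assumes u: "u \<in> D" shows "(N has_derivative dN u) (at u)"
proof -
  have m: "((\<lambda>s. mc s (axis 1 1)) has_derivative (\<lambda>x. dmc u x (axis 1 1))) (at u)" by (rule mc_deriv[OF u])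
  note f = has_derivative_fst[OF m] and s = has_derivative_snd[OF m]
  have "N differentiable at u"
    unfolding N_def[abs_def] nu_def
    by (intro differentiable_scaleR differentiable_divide differentiable_mult differentiable_const differentiable_minus)
      (use br.FDERIV[OF f s] ip.FDERIV[OF f f] al_regular[OF u e1] in \<open>auto simp: differentiable_def al_def\<close>)
  then show ?thesis unfolding dN_def by (simp add: frechet_derivative_works)
qed

lemma al_deriv: "u \<in> D \<Longrightarrow> ((\<lambda>s. al s y) has_derivative (\<lambda>x. fst (dmc u x y))) (at u)"
  unfolding al_def by (rule has_derivative_fst[OF mc_deriv])

lemma dN_orth: assumes u: "u \<in> D" shows "trace (dN u x) = 0" "ip (N u) (dN u x) = 0"
proof -
  have "((\<lambda>s. 0) has_derivative (\<lambda>x. trace (dN u x))) (at u)"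
    by (rule has_derivative_on_D_cong[OF trace_mat2_has_derivative[OF N_deriv[OF u]] u]) (simp add: N_unit)
  from has_derivative_unique[OF this has_derivative_const] show "trace (dN u x) = 0" by (simp add: fun_eq_iff)
  have "((\<lambda>s. - 1) has_derivative (\<lambda>x. ip (N u) (dN u x) + ip (dN u x) (N u))) (at u)"
    by (rule has_derivative_on_D_cong[OF ip.FDERIV[OF N_deriv[OF u] N_deriv[OF u]] u]) (simp add: N_unit)
  from has_derivative_unique[OF this has_derivative_const] show "ip (N u) (dN u x) = 0"
    by (simp add: fun_eq_iff ip_commute[of "dN u _" "N u"])
qed

lemma ip_N_dal: assumes u: "u \<in> D" shows "ip (N u) (fst (dmc u x y)) = - ip (dN u x) (al u y)"
proof -
  have "((\<lambda>s. 0) has_derivative (\<lambda>x. ip (N u) (fst (dmc u x y)) + ip (dN u x) (al u y))) (at u)"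
    by (rule has_derivative_on_D_cong[OF ip.FDERIV[OF N_deriv[OF u] al_deriv[OF u]] u]) (simp add: al_orth)
  from has_derivative_unique[OF this has_derivative_const] show ?thesis by (simp add: fun_eq_iff eq_neg_iff_add_eq_0)
qed

lemma snd_dmc: assumes u: "u \<in> D"
  shows "snd (dmc u x y) = (1/2) *\<^sub>R fst (dmc u x y) + (sqrt 3/2) *\<^sub>R (N u ** fst (dmc u x y) + dN u x ** al u y)"
proof -
  have "((\<lambda>s. (1/2) *\<^sub>R al s y + (sqrt 3/2) *\<^sub>R (N s ** al s y)) has_derivative
     (\<lambda>x. (1/2) *\<^sub>R fst (dmc u x y) + (sqrt 3/2) *\<^sub>R (N u ** fst (dmc u x y) + dN u x ** al u y))) (at u)"
    by (intro has_derivative_add has_derivative_scaleR_right al_deriv[OF u] mat2_mult.FDERIV[OF N_deriv[OF u] al_deriv[OF u]])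
  from has_derivative_on_D_cong[OF this u, of "\<lambda>s. snd (mc s y)"]
  have "((\<lambda>s. snd (mc s y)) has_derivative
     (\<lambda>x. (1/2) *\<^sub>R fst (dmc u x y) + (sqrt 3/2) *\<^sub>R (N u ** fst (dmc u x y) + dN u x ** al u y))) (at u)"
    by (simp add: snd_mc rho_def mul_linear)
  from has_derivative_unique[OF has_derivative_snd[OF mc_deriv[OF u]] this] show ?thesis by (simp add: fun_eq_iff)
qed

lemma umb_orth: assumes u: "u \<in> D" shows "trace (umb u x) = 0" "ip (N u) (umb u x) = 0"
  using dN_orth[OF u] al_orth[OF u] rotate_orth[OF N_unit[OF u] al_orth[OF u]]
  by (simp_all add: umb_def trace_mat2_linear linear_ip)

text \<open>This symmetry is what makes \<open>umb\<close> antilinear, as the next lemma shows.\<close>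

lemma umb_sym: assumes u: "u \<in> D" shows "umb u x ** al u y = umb u y ** al u x"
  unfolding umb_def
proof (rule connection_form_eq[OF N_unit[OF u] al_orth[OF u] al_orth[OF u]])
  note MC = maurer_cartan[OF u, of x y]
  show "fst (dmc u x y) - fst (dmc u y x) = - br (al u x) (al u y)"
    using arg_cong[OF MC, of fst] by (simp add: br2_def al_def)
  show "((1/2) *\<^sub>R fst (dmc u x y) + (sqrt 3/2) *\<^sub>R (N u ** fst (dmc u x y) + dN u x ** al u y))
     - ((1/2) *\<^sub>R fst (dmc u y x) + (sqrt 3/2) *\<^sub>R (N u ** fst (dmc u y x) + dN u y ** al u x))
     = - br (rho (N u) ** al u x) (rho (N u) ** al u y)"
    using arg_cong[OF MC, of snd] by (simp only: snd_diff snd_dmc[OF u] br2_def snd_uminus snd_conv snd_mc[OF u])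
qed

lemma rotated_direction:
  assumes u: "u \<in> D" and x: "x \<noteq> 0"
  obtains x' where "al u x' = - (N u ** al u x)" "umb u x' = N u ** umb u x" "mc u x' = JL (mc u x)"
proof -
  obtain x' where x': "mc u x' = JL (mc u x)" using JL_mc[OF u] .
  note ax = al_orth[OF u, of x]
  have a: "al u x' = - (N u ** al u x)"
    using arg_cong[OF x', of fst] by (simp add: al_def[symmetric] JL_def snd_mc[OF u] rho_def mul_linear vec_eq_iff field_simps)
  have aa: "al u x ** al u x = ip (al u x) (al u x) *\<^sub>R mat 1" by (rule square_traceless[OF ax(1)])
  have "umb u x' ** al u x = umb u x ** (- (N u ** al u x))" using umb_sym[OF u, of x' x] by (simp add: a)
  also have "\<dots> = (N u ** umb u x) ** al u x"
    by (simp add: mul_linear right_assoc orth_rules[OF N_unit(1)[OF u] umb_orth[OF u]])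
  finally have "umb u x' ** (al u x ** al u x) = (N u ** umb u x) ** (al u x ** al u x)" by (simp add: matrix_mul_assoc)
  then have "umb u x' = N u ** umb u x"
    using al_regular[OF u x] by (simp add: aa mul_linear)
  then show thesis using a x' by (intro that)
qed

lemma TN_subset_mc: assumes u: "u \<in> D" and z: "z \<in> TN (N u)" obtains c where "z = mc u c"
proof -
  let ?a = "al u (axis 1 1)"
  obtain x' where x': "al u x' = - (N u ** ?a)" using rotated_direction[OF u e1] .
  obtain r s where "fst z = r *\<^sub>R ?a + s *\<^sub>R (N u ** ?a)"
    using orth_span[OF N_unit[OF u] al_orth[OF u] al_regular[OF u e1], of "fst z"] z by (auto simp: TN_iff)
  then have "fst z = al u (r *\<^sub>R axis 1 1 - s *\<^sub>R x')"
    using x' by (simp add: al_def mc_diff[OF u] mc_scaleR[OF u])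
  moreover from this have "snd z = rho (N u) ** al u (r *\<^sub>R axis 1 1 - s *\<^sub>R x')" using z by (simp add: TN_iff)
  ultimately show thesis by (intro that[of "r *\<^sub>R axis 1 1 - s *\<^sub>R x'"]) (simp add: mc_al[OF u] prod_eq_iff)
qed

lemma nrm_axial: assumes u: "u \<in> D" shows "nrm u (k *\<^sub>R N u, l *\<^sub>R N u) = (k *\<^sub>R N u, l *\<^sub>R N u)"
proof -
  have "ip (N u) (rho (N u) ** al u y) = 0" for y
    using rotate_orth[OF N_unit[OF u] al_orth[OF u, of y]] al_orth[OF u, of y] by (simp add: rho_def mul_linear linear_ip)
  then have "gL (k *\<^sub>R N u, l *\<^sub>R N u) (mc u y) = 0" for y
    by (simp add: mc_al[OF u] gL_def linear_ip al_orth[OF u])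
  then have "tang u (k *\<^sub>R N u, l *\<^sub>R N u) = 0"
    by (intro tang_unique[OF u]) (simp add: mc_zero[OF u] gL.zero_left)
  then show ?thesis by (simp add: nrm_def mc_zero[OF u])
qed

text \<open>The projection that kills everything commuting with \<open>N\<close> maps the covariant derivative into the
  tangent plane. What remains are the components along \<open>N\<close>, and these are normal.\<close>

lemma sff_axial:
  assumes u: "u \<in> D"
  shows "sff u x y = ((- ip (N u) (fst (cov u x y))) *\<^sub>R N u, (- ip (N u) (snd (cov u x y))) *\<^sub>R N u)"
proof -
  note r = mul_linear right_assoc unit_rules[OF N_unit[OF u]] orth_rules[OF N_unit(1)[OF u] al_orth[OF u]]
    orth_rules[OF N_unit(1)[OF u] dN_orth[OF u]]
  define c1 c2 where c: "c1 = fst (cov u x y)" "c2 = snd (cov u x y)"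
  have t: "trace c1 = 0" "trace c2 = 0" using sl_cov[OF u] by (auto simp: sl_def c)
  have c1: "c1 = fst (dmc u x y) + ((1/2) *\<^sub>R br (al u x) (al u y) -
      (1/6) *\<^sub>R (br (al u x) (rho (N u) ** al u y) - br (rho (N u) ** al u x) (al u y)))"
    and c2: "c2 = snd (dmc u x y) + ((1/2) *\<^sub>R br (rho (N u) ** al u x) (rho (N u) ** al u y) +
      (1/6) *\<^sub>R (br (al u x) (rho (N u) ** al u y) - br (rho (N u) ** al u x) (al u y)))"
    by (simp_all add: c cov_def lam_def mc_al[OF u])
  have "c2 + N u ** (c2 ** N u) = rho (N u) ** (c1 + N u ** (c1 ** N u))"
    unfolding c1 c2 snd_dmc[OF u]
    by (simp add: rho_def br_def r) (simp add: vec_eq_iff field_simps times_two r sqrt3_mult)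
  then have "2 *\<^sub>R (c2 + ip (N u) c2 *\<^sub>R N u) = 2 *\<^sub>R (rho (N u) ** (c1 + ip (N u) c1 *\<^sub>R N u))"
    unfolding component_projection[OF N_unit[OF u] t(1)] component_projection[OF N_unit[OF u] t(2)]
    by (simp only: mul_linear)
  then have "(c1 + ip (N u) c1 *\<^sub>R N u, c2 + ip (N u) c2 *\<^sub>R N u) \<in> TN (N u)"
    using t N_unit[OF u] by (simp add: TN_iff trace_mat2_linear linear_ip)
  then obtain c where "(c1 + ip (N u) c1 *\<^sub>R N u, c2 + ip (N u) c2 *\<^sub>R N u) = mc u c"
    using TN_subset_mc[OF u] by blast
  then have "cov u x y = mc u c + ((- ip (N u) c1) *\<^sub>R N u, (- ip (N u) c2) *\<^sub>R N u)"
    by (simp add: prod_eq_iff c algebra_simps)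
  from arg_cong[OF this, of "nrm u"] show ?thesis
    unfolding nrm_add[OF u] nrm_mc[OF u] nrm_axial[OF u] sff_def[symmetric] c by simp
qed

text \<open>The complex linear part of the derivative of \<open>N\<close> cancels against the connection form, and only
  the antilinear part remains.\<close>

lemma ip_N_cov: assumes u: "u \<in> D" shows "ip (N u) (fst (cov u x y)) = - ip (umb u x) (al u y)"
proof -
  note r = mul_linear right_assoc unit_rules[OF N_unit[OF u]] orth_rules[OF N_unit(1)[OF u] al_orth[OF u]]
  define a b where ab: "a = al u x" "b = al u y"
  have o: "trace a = 0" "ip (N u) a = 0" "trace b = 0" "ip (N u) b = 0" using al_orth[OF u] by (simp_all add: ab)
  note r = mul_linear right_assoc unit_rules[OF N_unit[OF u]] orth_rules[OF N_unit(1)[OF u] o(1,2)] orth_rules[OF N_unit(1)[OF u] o(3,4)]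
  have ba: "b ** a = (2 * ip a b) *\<^sub>R mat 1 - a ** b"
    using mult_traceless[OF o(1,3)] mult_traceless[OF o(3,1)] br_anti[of b a] by (simp add: ip_commute[of b a] vec_eq_iff algebra_simps)
  \<comment> \<open>\<open>a b + b a\<close> is a multiple of the identity\<close>
  have mixed: "br a (rho (N u) ** b) - br (rho (N u) ** a) b = (- 2 * sqrt 3 * ip a b) *\<^sub>R N u"
  proof -
    have "br a (rho (N u) ** b) - br (rho (N u) ** a) b = - sqrt 3 *\<^sub>R (N u ** (a ** b + b ** a))"
      by (simp add: rho_def br_def r) (simp add: vec_eq_iff field_simps times_two r)
    then show ?thesis by (simp add: ba mul_linear)
  qed
  have "ip (N u) (br a b) = 2 * ip (N u ** a) b"
    unfolding ip_br_cyclic br_orthogonal[OF N_unit(1)[OF u] o(1,2)] by (simp add: linear_ip)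
  then have "ip (N u) ((1/2) *\<^sub>R br a b - (1/6) *\<^sub>R (br a (rho (N u) ** b) - br (rho (N u) ** a) b))
     = ip (N u ** a) b - (1/sqrt 3) * ip a b"
    unfolding mixed by (simp add: linear_ip N_unit[OF u] field_simps)
  then show ?thesis
    by (simp add: cov_def lam_def linear_ip ip_N_dal[OF u] umb_def mc_al[OF u] ab[symmetric])
qed

text \<open>Parallelity compares a complex linear with an antilinear expression in the direction \<open>x\<close>.
  Applying it also to the rotated direction shows that the linear one vanishes, and its
  coefficients are the two components of the second fundamental form. Then the antilinear part of
  the derivative of \<open>N\<close> is orthogonal to the whole complement of \<open>N\<close>.\<close>

lemma sff_and_umb_zero:
  assumes u: "u \<in> D"
  shows "sff u y z = 0" "umb u x = 0"
proof -
  have S0: "sff u y z = 0" for y z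
  proof -
    define k1 where "k1 s = - ip (N s) (fst (cov s y z))" for s
    define k2 where "k2 s = - ip (N s) (snd (cov s y z))" for s
    note c = cov_deriv[OF u, of y z]
    obtain k1' where k1: "(k1 has_derivative k1') (at u)"
      unfolding k1_def[abs_def] using has_derivative_minus[OF ip.FDERIV[OF N_deriv[OF u] has_derivative_fst[OF c]]] by blast
    obtain k2' where k2: "(k2 has_derivative k2') (at u)"
      unfolding k2_def[abs_def] using has_derivative_minus[OF ip.FDERIV[OF N_deriv[OF u] has_derivative_snd[OF c]]] by blast
    have "((\<lambda>s. (k1 s *\<^sub>R N s, k2 s *\<^sub>R N s)) has_derivative
        (\<lambda>x. (k1 u *\<^sub>R dN u x + k1' x *\<^sub>R N u, k2 u *\<^sub>R dN u x + k2' x *\<^sub>R N u))) (at u)"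
      by (intro has_derivative_Pair has_derivative_scaleR k1 k2 N_deriv[OF u])
    then have S: "((\<lambda>s. sff s y z) has_derivative
        (\<lambda>x. (k1 u *\<^sub>R dN u x + k1' x *\<^sub>R N u, k2 u *\<^sub>R dN u x + k2' x *\<^sub>R N u))) (at u)"
      by (rule has_derivative_on_D_cong[OF _ u]) (simp add: sff_axial k1_def k2_def)
    \<comment> \<open>the complex number \<open>k2 - k1 rho N\<close> is \<open>p - q N\<close>; it is zero only if \<open>k1\<close> and \<open>k2\<close> are\<close>
    define p q where pq: "p = k2 u - k1 u / 2" "q = sqrt 3 / 2 * k1 u"
    have key: "p *\<^sub>R umb u x - q *\<^sub>R (N u ** umb u x) = - (1/sqrt 3) *\<^sub>R (p *\<^sub>R al u x + q *\<^sub>R (N u ** al u x))" for x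
    proof -
      let ?W = "(k1 u *\<^sub>R dN u x + k1' x *\<^sub>R N u, k2 u *\<^sub>R dN u x + k2' x *\<^sub>R N u) + lam (mc u x) (sff u y z)"
      obtain a b where "nrm u ?W = (a *\<^sub>R N u, b *\<^sub>R N u)"
        using parallel_equation[OF u parallel[OF u] S, of x]
        unfolding sff_axial[OF u, of "gam u x y"] sff_axial[OF u, of y "gam u x z"]
          add_Pair scaleR_add_left[symmetric] by blast
      then have "?W = mc u (tang u ?W) + (a *\<^sub>R N u, b *\<^sub>R N u)"
        by (simp add: nrm_def algebra_simps)
      then obtain t where W: "?W = mc u t + (a *\<^sub>R N u, b *\<^sub>R N u)" by blast
      have S': "sff u y z = (k1 u *\<^sub>R N u, k2 u *\<^sub>R N u)" by (simp add: sff_axial[OF u] k1_def k2_def)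
      show ?thesis
        unfolding pq
      proof (rule normal_connection_eq[OF N_unit[OF u] al_orth[OF u] umb_orth[OF u] al_orth[OF u], of "dN u x" x x "k1' x" "k1 u" "k2 u" t a "k2' x" b])
        show "dN u x = umb u x - (1 / sqrt 3) *\<^sub>R al u x + N u ** al u x" by (simp add: umb_def)
        show "k1' x *\<^sub>R N u + k1 u *\<^sub>R dN u x + ((1/2) *\<^sub>R br (al u x) (k1 u *\<^sub>R N u) - (1/6) *\<^sub>R (br (al u x) (k2 u *\<^sub>R N u) - br (rho (N u) ** al u x) (k1 u *\<^sub>R N u))) = al u t + a *\<^sub>R N u"
          using arg_cong[OF W, of fst] unfolding S' by (simp add: lam_def mc_al[OF u] add_ac)
        show "k2' x *\<^sub>R N u + k2 u *\<^sub>R dN u x + ((1/2) *\<^sub>R br (rho (N u) ** al u x) (k2 u *\<^sub>R N u) + (1/6) *\<^sub>R (br (al u x) (k2 u *\<^sub>R N u) - br (rho (N u) ** al u x) (k1 u *\<^sub>R N u))) = rho (N u) ** al u t + b *\<^sub>R N u"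
          using arg_cong[OF W, of snd] unfolding S' by (simp add: lam_def mc_al[OF u] add_ac)
      qed
    qed
    obtain x' where x': "al u x' = - (N u ** al u (axis 1 1))" "umb u x' = N u ** umb u (axis 1 1)"
      using rotated_direction[OF u e1] .
    have "p = 0 \<and> q = 0"
      by (rule antilinear_and_linear_zero[OF N_unit[OF u] al_orth[OF u] al_regular[OF u e1] key[of "axis 1 1"] key[of x', unfolded x']]) simp
    then have "k1 u = 0" "k2 u = 0" by (auto simp: pq)
    then show ?thesis by (simp add: sff_axial[OF u] k1_def k2_def zero_prod_def)
  qed
  show "sff u y z = 0" by (rule S0)
  have "N u \<noteq> 0" using N_unit[OF u] by (auto simp: ip_linear)
  then have 0: "ip (umb u x) (al u y) = 0" for y
    using S0[of x y] by (simp add: sff_axial[OF u] ip_N_cov[OF u] prod_eq_iff)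
  obtain x' where x': "al u x' = - (N u ** al u (axis 1 1))"
    using rotated_direction[OF u e1] .
  show "umb u x = 0"
    using 0[of "axis 1 1"] 0[of x']
    by (intro orth_definite[OF N_unit[OF u] al_orth[OF u] al_regular[OF u e1] umb_orth[OF u]]) (simp_all add: x' linear_ip)
qed

lemma dN_formula: "u \<in> D \<Longrightarrow> dN u x = N u ** al u x - (1/sqrt 3) *\<^sub>R al u x"
  using sff_and_umb_zero(2)[of u x] by (simp add: umb_def algebra_simps)

text \<open>The derivative of the axis is now known, and it cancels against the derivative of the
  surface.\<close>

lemma frame_constant:
  assumes u: "u \<in> D"
  shows "((\<lambda>s. unl (f s) (rho (N s), rhoc (N s))) has_derivative (\<lambda>x. 0)) (at u)"
proof -
  note N = N_deriv[OF u]
  have W: "((\<lambda>s. (rho (N s), rhoc (N s))) has_derivative (\<lambda>x. ((sqrt 3/2) *\<^sub>R dN u x, - ((sqrt 3/2) *\<^sub>R dN u x)))) (at u)"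
    unfolding rho_def rhoc_def
    by (rule derivative_eq_intros N refl)+ auto
  have z: "unl (mc u x) (rho (N u), rhoc (N u)) + ((sqrt 3/2) *\<^sub>R dN u x, - ((sqrt 3/2) *\<^sub>R dN u x)) = 0" for x
  proof -
    note r = mul_linear right_assoc unit_rules[OF N_unit[OF u]] orth_rules[OF N_unit(1)[OF u] al_orth[OF u]]
    show ?thesis
      unfolding dN_formula[OF u] mc_al[OF u]
      by (simp add: unl_def prod_eq_iff rho_def rhoc_def r) (simp add: vec_eq_iff field_simps)
  qed
  from unl_field_deriv[OF u _ W, of "\<lambda>s. unl (f s) (rho (N s), rhoc (N s))"] show ?thesis
    by (simp add: z unl.zero_right)
qed

lemma gauss_curvature_null:
  assumes u: "u \<in> D" shows "gauss_curvature (induced_metric f) u = - 4 / 3"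
proof -
  define z b where zb: "z = mc u (axis 1 1)" "b = mc u (axis 2 1)"
  define a where "a = al u (axis 1 1)"
  note ao = al_orth[OF u, of "axis 1 1", folded a_def]
  note r = mul_linear right_assoc unit_rules[OF N_unit[OF u]] orth_rules[OF N_unit(1)[OF u] al_orth[OF u]]
  obtain r s where rs: "b = r *\<^sub>R z + s *\<^sub>R JL z" unfolding zb using mc_complex_line[OF u e1] .
  have za: "z = (a, rho (N u) ** a)" by (simp add: zb mc_al[OF u] a_def)
  have gz: "gL z z = ip a a" using gL_TN[OF N_unit[OF u] mc_TN[OF u]] by (simp add: zb a_def al_def)
  have "br a (rho (N u) ** a) = - (sqrt 3 * ip a a) *\<^sub>R N u"
    unfolding br_def rho_def by (simp add: r a_def square_traceless[OF al_orth(1)[OF u]]) (simp add: vec_eq_iff field_simps)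
  then have g: "br (fst z) (snd z) = - (sqrt 3 * ip a a) *\<^sub>R N u" by (simp add: za)
  have brN: "br (al u c) (N u) = - 2 *\<^sub>R (N u ** al u c)" "br (rho (N u) ** al u c) (N u) = - 2 *\<^sub>R (N u ** (rho (N u) ** al u c))" for c
  proof -
    have o: "trace (rho (N u) ** al u c) = 0" "ip (N u) (rho (N u) ** al u c) = 0"
      using rotate_orth[OF N_unit[OF u] al_orth[OF u, of c]] al_orth[OF u, of c]
      by (simp_all add: rho_def mul_linear linear_ip trace_mat2_linear)
    show "br (al u c) (N u) = - 2 *\<^sub>R (N u ** al u c)" "br (rho (N u) ** al u c) (N u) = - 2 *\<^sub>R (N u ** (rho (N u) ** al u c))"
      using br_orthogonal[OF N_unit(1)[OF u] al_orth[OF u]] br_orthogonal[OF N_unit(1)[OF u] o]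
        br_anti[of "al u c" "N u"] br_anti[of "rho (N u) ** al u c" "N u"] by simp_all
  qed
  have Jmc: "JL (mc u c) = - (N u ** al u c, N u ** (rho (N u) ** al u c))" for c
  proof -
    have "al u c - 2 *\<^sub>R (rho (N u) ** al u c) = - (sqrt 3 *\<^sub>R (N u ** al u c))"
      "2 *\<^sub>R al u c - rho (N u) ** al u c = - (sqrt 3 *\<^sub>R (N u ** (rho (N u) ** al u c)))"
      unfolding rho_def by (simp_all add: r vec_eq_iff field_simps)
    then show ?thesis by (simp add: JL_def mc_al[OF u])
  qed
  have "RL z (JL z) b = (4 * ip a a / 3) *\<^sub>R JL b"
  proof -
    have b: "fst b = al u (axis 2 1)" "snd b = rho (N u) ** al u (axis 2 1)" by (simp_all add: zb mc_al[OF u])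
    have "RL z (JL z) b = (- 2 / (3 * sqrt 3)) *\<^sub>R (br (fst b) (br (fst z) (snd z)), br (snd b) (br (fst z) (snd z)))"
      by (rule RL_complex_line[OF rs])
    then show ?thesis unfolding g b br.scaleR_right brN unfolding zb(2) Jmc by simp
  qed
  then have "RL z (r *\<^sub>R z + s *\<^sub>R JL z) b = (s * (4 * ip a a / 3)) *\<^sub>R JL b"
    by (simp add: RL_add_middle RL_scaleR_middle RL_self)
  then have R: "RL z b b = (s * (4 * ip a a / 3)) *\<^sub>R JL b" unfolding rs[symmetric] .
  have J0: "gL (JL z) z = 0" using gL_JL_self[of z] gL_commute[of z "JL z"] by simp
  have "JL b = r *\<^sub>R JL z - s *\<^sub>R z" by (simp add: rs JL_add JL_scaleR JL_JL)
  then have num: "gL (RL z b b) z = - (4/3) * (s * ip a a)\<^sup>2"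
    by (simp add: R gL.scaleR_left gL.diff_left gz J0 power2_eq_square)
  have den: "gL z z * gL b b - (gL z b)\<^sup>2 = (s * ip a a)\<^sup>2"
    unfolding rs
    by (simp add: gL.add_left gL.add_right gL.scaleR_left gL.scaleR_right gz J0 gL_JL gL_JL_self
        power2_eq_square algebra_simps)
  have "(s * ip a a)\<^sup>2 \<noteq> 0" using gram_det_nonzero[OF u] unfolding zb[symmetric] den .
  moreover have "gauss_curvature (induced_metric f) u = gL (RL z b b) z / (gL z z * gL b b - (gL z b)\<^sup>2)"
    unfolding zb by (rule gauss_curvature_totally_geodesic[OF u]) (rule sff_and_umb_zero(1))
  ultimately show ?thesis unfolding num den by simp
qed

end

section \<open>Surfaces with commuting tangent directions\<close>

definition AX :: "mat2 \<Rightarrow> mat2_pair set" where "AX X = {(a *\<^sub>R X, b *\<^sub>R X) | a b. True}"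

lemma AX_scaleR: assumes "c \<noteq> 0" shows "AX (c *\<^sub>R X) = AX X"
proof
  show "AX (c *\<^sub>R X) \<subseteq> AX X" by (auto simp: AX_def)
  have "(a *\<^sub>R X, b *\<^sub>R X) \<in> AX (c *\<^sub>R X)" for a b
    unfolding AX_def using assms by (intro CollectI exI[of _ "a / c"] exI[of _ "b / c"]) simp
  then show "AX X \<subseteq> AX (c *\<^sub>R X)" by (auto simp: AX_def)
qed

lemma AX_br:
  assumes "z \<in> AX X" "w \<in> AX X"
  shows "br (fst z) (fst w) = 0" "br (fst z) (snd w) = 0" "br (snd z) (fst w) = 0" "br (snd z) (snd w) = 0"
  using assms by (auto simp: AX_def br_linear)

lemma AX_lam: "z \<in> AX X \<Longrightarrow> w \<in> AX X \<Longrightarrow> lam z w = 0"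
  by (simp add: lam_def AX_br zero_prod_def)

lemma AX_RL: "a \<in> AX X \<Longrightarrow> b \<in> AX X \<Longrightarrow> c \<in> AX X \<Longrightarrow> RL a b c = 0"
  by (simp add: RL_def AX_lam br2_def AX_br lam.zero_right) (simp add: lam_def ip_linear br_linear zero_prod_def)

locale commuting_patch = surface_patch +
  assumes commuting: "u \<in> D \<Longrightarrow> v \<noteq> 0 \<Longrightarrow> br (fst (mc u v)) (snd (mc u v)) = 0"
begin

lemma axis_plane:
  assumes u: "u \<in> D"
  obtains X where "trace X = 0" "ip X X \<noteq> 0" "range (mc u) = AX X"
proof -
  define z where "z = mc u (axis 1 1)"
  have e1: "axis 1 1 \<noteq> (0::real^2)" by (simp add: axis_eq_0_iff)
  have z0: "z \<noteq> 0" using mc_eq_0[OF u, of "axis 1 1"] e1 by (auto simp: z_def)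
  have t: "trace (fst z) = 0" "trace (snd z) = 0" using sl_mc[OF u] by (auto simp: z_def sl_def)
  have c: "br (fst z) (snd z) = 0" using commuting[OF u e1] by (simp add: z_def)
  obtain X m n where X: "trace X = 0" "z = (m *\<^sub>R X, n *\<^sub>R X)"
  proof (cases "fst z = 0")
    case True then show ?thesis using t that[of "snd z" 0 1] by (simp add: prod_eq_iff)
  next
    case False
    then obtain k where "snd z = k *\<^sub>R fst z" using commuting_parallel[OF t c] by blast
    then show ?thesis using t that[of "fst z" 1 k] by (simp add: prod_eq_iff)
  qed
  have zX: "gL z z = (1/3 * (2 * (m\<^sup>2 - m * n + n\<^sup>2))) * ip X X"
    by (simp add: X(2) gL_def linear_ip power2_eq_square field_simps)
  have g: "gL z z \<noteq> 0" unfolding z_def by (rule mc_regular[OF u e1])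
  then have q: "ip X X \<noteq> 0" "2 * (m\<^sup>2 - m * n + n\<^sup>2) \<noteq> 0" unfolding zX by auto
  have J: "JL z = ((1/sqrt 3 * (m - 2 * n)) *\<^sub>R X, (1/sqrt 3 * (2 * m - n)) *\<^sub>R X)"
    by (simp add: X(2) JL_def flip: scaleR_diff_left)
  have "range (mc u) \<subseteq> AX X"
  proof (rule image_subsetI)
    fix w
    obtain r s where "mc u w = r *\<^sub>R z + s *\<^sub>R JL z" unfolding z_def using mc_complex_line[OF u e1] .
    then have "mc u w = ((r * m + s * (1/sqrt 3 * (m - 2 * n))) *\<^sub>R X, (r * n + s * (1/sqrt 3 * (2 * m - n))) *\<^sub>R X)"
      unfolding J by (simp add: X(2) scaleR_add_left)
    then show "mc u w \<in> AX X" by (auto simp: AX_def)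
  qed
  moreover have "AX X \<subseteq> range (mc u)"
  proof
    fix w assume "w \<in> AX X"
    then obtain a b where w: "w = (a *\<^sub>R X, b *\<^sub>R X)" by (auto simp: AX_def)
    \<comment> \<open>the determinant of \<open>z\<close> and \<open>sqrt 3 *\<^sub>R JL z\<close> in the coordinates of the plane\<close>
    define d where "d = 2 * (m\<^sup>2 - m * n + n\<^sup>2)"
    obtain v' where v': "mc u v' = JL z" unfolding z_def using JL_mc[OF u] .
    define r s where "r = (a * (2 * m - n) - b * (m - 2 * n)) / d" "s = (m * b - n * a) / d"
    have d: "d \<noteq> 0" using q by (simp add: d_def)
    have "r * m + s * (m - 2 * n) = a" "r * n + s * (2 * m - n) = b"
      using d by (simp_all add: r_s_def divide_simps) (simp_all add: d_def power2_eq_square algebra_simps)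
    then have "w = r *\<^sub>R z + (sqrt 3 * s) *\<^sub>R JL z"
      unfolding J w by (simp add: X(2) flip: scaleR_add_left)
    also have "\<dots> = mc u (r *\<^sub>R axis 1 1 + (sqrt 3 * s) *\<^sub>R v')"
      by (simp add: mc_add[OF u] mc_scaleR[OF u] v' z_def)
    finally show "w \<in> range (mc u)" by blast
  qed
  ultimately show thesis using X q that by blast
qed

lemma mc_br:
  assumes u: "u \<in> D"
  shows "br (fst (mc u x)) (fst (mc u y)) = 0" "br (fst (mc u x)) (snd (mc u y)) = 0"
    "br (snd (mc u x)) (fst (mc u y)) = 0" "br (snd (mc u x)) (snd (mc u y)) = 0"
proof -
  obtain X where X: "range (mc u) = AX X" using axis_plane[OF u] .
  have "mc u x \<in> AX X" "mc u y \<in> AX X" using X by blast+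
  from AX_br[OF this] show "br (fst (mc u x)) (fst (mc u y)) = 0" "br (fst (mc u x)) (snd (mc u y)) = 0"
    "br (snd (mc u x)) (fst (mc u y)) = 0" "br (snd (mc u x)) (snd (mc u y)) = 0" .
qed

text \<open>All brackets between entries of \<open>mc\<close> vanish identically, and so do their derivatives. With
  directions \<open>a\<close>, \<open>b\<close> adapted to the two factors, these equations and the symmetry of \<open>dmc\<close> show that
  the derivative commutes with \<open>X\<close>.\<close>

lemma commuting_derivative:
  assumes u: "u \<in> D" and X: "range (mc u) = AX X"
  shows "br X (fst (dmc u x y)) = 0 \<and> br X (snd (dmc u x y)) = 0"
proof -
  note m = mc_deriv[OF u]
  note f = has_derivative_fst[OF m] and s = has_derivative_snd[OF m]
  have Z: "L x = 0" if "(h has_derivative L) (at u)" "\<And>s. s \<in> D \<Longrightarrow> h s = 0" for h :: "real^2 \<Rightarrow> mat2" and L x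
  proof -
    have "((\<lambda>_. 0) has_derivative L) (at u)" by (rule has_derivative_on_D_cong[OF that(1) u]) (simp add: that(2))
    from has_derivative_unique[OF this has_derivative_const] show ?thesis by simp
  qed
  have ff: "br (fst (mc u y)) (fst (dmc u x z)) + br (fst (dmc u x y)) (fst (mc u z)) = 0" for x y z
    by (rule Z[OF br.FDERIV[OF f f]]) (simp add: mc_br)
  have fs: "br (fst (mc u y)) (snd (dmc u x z)) + br (fst (dmc u x y)) (snd (mc u z)) = 0" for x y z
    by (rule Z[OF br.FDERIV[OF f s]]) (simp add: mc_br)
  have ss: "br (snd (mc u y)) (snd (dmc u x z)) + br (snd (dmc u x y)) (snd (mc u z)) = 0" for x y z
    by (rule Z[OF br.FDERIV[OF s s]]) (simp add: mc_br)
  have sy: "dmc u x y = dmc u y x" for x y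
    using maurer_cartan[OF u, of x y] by (simp add: br2_def mc_br[OF u] flip: zero_prod_def)
  have "(1 *\<^sub>R X, 0 *\<^sub>R X) \<in> AX X" "(0 *\<^sub>R X, 1 *\<^sub>R X) \<in> AX X" unfolding AX_def by blast+
  then obtain a b where "mc u a = (1 *\<^sub>R X, 0 *\<^sub>R X)" "mc u b = (0 *\<^sub>R X, 1 *\<^sub>R X)"
    unfolding X[symmetric] by (auto simp: eq_commute)
  then have ab: "mc u a = (X, 0)" "mc u b = (0, X)" by simp_all
  have anti: "br Y X = - br X Y" for Y by (rule br_anti)
  \<comment> \<open>in \<open>ff\<close>, \<open>fs\<close> and \<open>ss\<close> one of the two terms drops out for suitable choices of \<open>a\<close> and \<open>b\<close>\<close>
  have Fb: "br X (fst (dmc u x b)) = 0" for x using ff[of b x a] by (simp add: ab br_linear anti)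
  have Sa: "br X (snd (dmc u x a)) = 0" for x using ss[of b x a] by (simp add: ab br_linear)
  have FS: "br X (fst (dmc u x a)) = br X (snd (dmc u x b))" for x using fs[of a x b] by (simp add: ab anti)
  have base: "br X (fst (dmc u a a)) = 0" "br X (fst (dmc u b a)) = 0" "br X (snd (dmc u a b)) = 0" "br X (snd (dmc u b b)) = 0"
    using FS[of a] FS[of b] Sa[of b] Fb[of a] sy[of a b] by simp_all
  have span: "\<exists>k l. y = k *\<^sub>R a + l *\<^sub>R b" for y
  proof -
    have "mc u y \<in> AX X" using X by blast
    then obtain k l where "mc u y = (k *\<^sub>R X, l *\<^sub>R X)" by (auto simp: AX_def)
    then have "mc u (y - (k *\<^sub>R a + l *\<^sub>R b)) = 0"
      by (simp add: mc_diff[OF u] mc_add[OF u] mc_scaleR[OF u] ab zero_prod_def)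
    then show ?thesis using mc_eq_0[OF u] by (metis eq_iff_diff_eq_0)
  qed
  obtain k l where y: "y = k *\<^sub>R a + l *\<^sub>R b" using span by blast
  obtain k' l' where x: "x = k' *\<^sub>R a + l' *\<^sub>R b" using span by blast
  show ?thesis
    unfolding x y by (simp add: dmc_add[OF u] dmc_scaleR[OF u] br_linear base Fb Sa)
qed

lemma sff_commuting: assumes u: "u \<in> D" shows "sff u x y = 0"
proof -
  obtain X where X: "trace X = 0" "ip X X \<noteq> 0" "range (mc u) = AX X" using axis_plane[OF u] .
  have X0: "X \<noteq> 0" using X(2) by (auto simp: ip_linear)
  note cd = commuting_derivative[OF u X(3), of x y]
  have tr: "trace (fst (dmc u x y)) = 0" "trace (snd (dmc u x y)) = 0" using sl_dmc[OF u] by (auto simp: sl_def)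
  obtain k where k: "fst (dmc u x y) = k *\<^sub>R X" using commuting_parallel[OF X(1) tr(1)] cd X0 by blast
  obtain l where l: "snd (dmc u x y) = l *\<^sub>R X" using commuting_parallel[OF X(1) tr(2)] cd X0 by blast
  have "dmc u x y \<in> AX X" unfolding AX_def using k l by (auto simp: prod_eq_iff)
  moreover have "lam (mc u x) (mc u y) = 0" by (rule AX_lam[of _ X]) (use X(3) in blast)+
  ultimately obtain c where "cov u x y = mc u c" unfolding cov_def using X(3) by auto
  then show ?thesis by (simp add: sff_def nrm_mc[OF u])
qed

lemma gauss_curvature_commuting: assumes u: "u \<in> D" shows "gauss_curvature (induced_metric f) u = 0"
proof -
  obtain X where X: "range (mc u) = AX X" using axis_plane[OF u] .
  have "RL (mc u (axis 1 1)) (mc u (axis 2 1)) (mc u (axis 2 1)) = 0" by (rule AX_RL[of _ X]) (use X in blast)+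
  moreover have "gauss_curvature (induced_metric f) u =
      gL (RL (mc u (axis 1 1)) (mc u (axis 2 1)) (mc u (axis 2 1))) (mc u (axis 1 1)) /
       (gL (mc u (axis 1 1)) (mc u (axis 1 1)) * gL (mc u (axis 2 1)) (mc u (axis 2 1)) - (gL (mc u (axis 1 1)) (mc u (axis 2 1)))\<^sup>2)"
    by (rule gauss_curvature_totally_geodesic[OF u]) (rule sff_commuting)
  ultimately show ?thesis by (simp add: gL.zero_left)
qed

text \<open>The derivative of the axis is proportional to the axis, so that the normalized axis has
  derivative zero.\<close>

lemma axis_locally_constant:
  assumes u0: "u0 \<in> D"
  obtains V X where "open V" "u0 \<in> V" "V \<subseteq> D" "trace X = 0" "ip X X \<noteq> 0" "\<And>u. u \<in> V \<Longrightarrow> range (mc u) = AX X"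
proof -
  obtain X0 where X0: "trace X0 = 0" "ip X0 X0 \<noteq> 0" "range (mc u0) = AX X0" using axis_plane[OF u0] .
  have "(1 *\<^sub>R X0, 0 *\<^sub>R X0) \<in> range (mc u0)" unfolding X0(3) AX_def by blast
  then obtain v where v: "mc u0 v = (X0, 0)" by auto
  define X where "X u = fst (mc u v)" for u
  \<comment> \<open>the sign makes \<open>q\<close> positive near \<open>u0\<close> for spacelike and for timelike axes\<close>
  define \<sigma> where "\<sigma> = sgn (ip X0 X0)"
  define q where "q u = \<sigma> * ip (X u) (X u)" for u
  have X': "(X has_derivative (\<lambda>x. fst (dmc u x v))) (at u)" if "u \<in> D" for u
    unfolding X_def[abs_def] by (rule has_derivative_fst[OF mc_deriv[OF that]])
  have q': "(q has_derivative (\<lambda>x. 2 * \<sigma> * ip (X u) (fst (dmc u x v)))) (at u)" if "u \<in> D" for u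
    unfolding q_def[abs_def]
    using has_derivative_mult_right[OF ip.FDERIV[OF X'[OF that] X'[OF that]], of \<sigma>]
    by (simp add: ip_commute[of "fst (dmc u _ v)" "X u"] algebra_simps)
  have q0: "q u0 > 0" using X0(2) by (simp add: q_def X_def v \<sigma>_def sgn_if)
  have "isCont q u0" using has_derivative_continuous[OF q'[OF u0]] by simp
  then have "\<forall>\<^sub>F u in nhds u0. 0 < q u"
    using q0 by (simp add: isCont_def tendsto_at_iff_tendsto_nhds order_tendstoD(1))
  moreover have "\<forall>\<^sub>F u in nhds u0. u \<in> D" using open_D u0 by (simp add: eventually_nhds_in_open)
  ultimately have "\<forall>\<^sub>F u in nhds u0. 0 < q u \<and> u \<in> D" by eventually_elim simp
  then obtain e where e: "e > 0" "\<And>u. dist u u0 < e \<Longrightarrow> 0 < q u \<and> u \<in> D"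
    unfolding eventually_nhds_metric by blast
  define V where "V = ball u0 e"
  have V: "q u > 0" "u \<in> D" if "u \<in> V" for u using e(2)[of u] that by (auto simp: V_def dist_commute)
  have plane: "range (mc u) = AX (X u)" if u: "u \<in> V" for u
  proof -
    obtain Y where Y: "range (mc u) = AX Y" using axis_plane[OF V(2)[OF u]] .
    then have "mc u v \<in> AX Y" by blast
    then obtain a b where "mc u v = (a *\<^sub>R Y, b *\<^sub>R Y)" by (auto simp: AX_def)
    then have "X u = a *\<^sub>R Y" by (simp add: X_def)
    moreover have "a \<noteq> 0" using V(1)[OF u] calculation by (auto simp: q_def ip_linear)
    ultimately show ?thesis using Y AX_scaleR by simp
  qed
  define Xh where "Xh u = (1 / sqrt (q u)) *\<^sub>R X u" for u
  have "(Xh has_derivative (\<lambda>_. 0)) (at u within V)" if u: "u \<in> V" for u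
  proof -
    note uD = V(2)[OF u]
    have "((\<lambda>t. 1 / sqrt t) has_real_derivative - (1 / (2 * q u * sqrt (q u)))) (at (q u))"
      using V(1)[OF u] by (auto intro!: derivative_eq_intros simp: field_simps)
    from has_derivative_compose[OF q'[OF uD] this[unfolded has_field_derivative_def]]
    have "((\<lambda>s. 1 / sqrt (q s)) has_derivative
       (\<lambda>x. - (1 / (2 * q u * sqrt (q u))) * (2 * \<sigma> * ip (X u) (fst (dmc u x v))))) (at u)" .
    from has_derivative_scaleR[OF this X'[OF uD]]
    have "(Xh has_derivative (\<lambda>x. (1 / sqrt (q u)) *\<^sub>R fst (dmc u x v)
        - (2 * \<sigma> * ip (X u) (fst (dmc u x v)) / (2 * q u * sqrt (q u))) *\<^sub>R X u)) (at u)"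
      unfolding Xh_def[abs_def] by simp
    moreover have "(1 / sqrt (q u)) *\<^sub>R fst (dmc u x v)
        - (2 * \<sigma> * ip (X u) (fst (dmc u x v)) / (2 * q u * sqrt (q u))) *\<^sub>R X u = 0" for x
    proof -
      have tr: "trace (X u) = 0" "trace (fst (dmc u x v)) = 0"
        using sl_mc[OF uD] sl_dmc[OF uD] by (auto simp: X_def sl_def)
      have "X u \<noteq> 0" using V(1)[OF u] by (auto simp: q_def ip_linear)
      then obtain c where c: "fst (dmc u x v) = c *\<^sub>R X u"
        using commuting_parallel[OF tr] commuting_derivative[OF uD plane[OF u]] by blast
      have "2 * \<sigma> * ip (X u) (fst (dmc u x v)) = 2 * c * q u" by (simp add: c q_def linear_ip)
      then show ?thesis using V(1)[OF u] by (simp add: c)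
    qed
    ultimately show ?thesis by (simp add: has_derivative_at_withinI)
  qed
  then obtain X1 where X1: "\<And>u. u \<in> V \<Longrightarrow> Xh u = X1"
    using has_derivative_zero_constant[of V Xh] by (auto simp: V_def)
  have u0V: "u0 \<in> V" using e by (simp add: V_def)
  have X1e: "X1 = (1 / sqrt (q u0)) *\<^sub>R X0" using X1[OF u0V] by (simp add: Xh_def X_def v)
  show thesis
  proof (rule that[of V X1])
    show "open V" "u0 \<in> V" "V \<subseteq> D" using V u0V by (auto simp: V_def)
    show "trace X1 = 0" "ip X1 X1 \<noteq> 0" using X0 q0 by (auto simp: X1e trace_mat2_linear linear_ip)
    show "range (mc u) = AX X1" if "u \<in> V" for u
      using plane[OF that] X1[OF that] AX_scaleR[of "1 / sqrt (q u)" "X u"] V(1)[OF that] by (simp add: Xh_def)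
  qed
qed

end

section \<open>Isometries, open pieces and the model surfaces\<close>

lemma bounded_linear_unl_mult:
  fixes P Q R :: mat2
  shows   "bounded_linear (\<lambda>p::mat2_pair. (P ** fst p ** R, Q ** snd p ** R))"
  unfolding linear_conv_bounded_linear[symmetric] linear_iff
  by (auto simp: mul_linear)

text \<open>Any two extensions agree along the submanifold, and tangent vectors are velocities of curves
  in it.\<close>

lemma local_extension_derivative:
  assumes E: "local_extension \<Phi> p U \<Psi>" and L: "bounded_linear \<Phi>"
    and p: "p \<in> SL2xSL2" and v: "v \<in> tangent_SL2xSL2 p"
  shows "frechet_derivative \<Psi> (at p) v = \<Phi> v"
proof -
  have U: "open U" "p \<in> U" "smooth_on U \<Psi>" "\<And>q. q \<in> U \<inter> SL2xSL2 \<Longrightarrow> \<Psi> q = \<Phi> q"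
    using E by (auto simp: local_extension_def)
  have d: "((\<lambda>q. \<Psi> q - \<Phi> q) has_derivative (\<lambda>v. frechet_derivative \<Psi> (at p) v - \<Phi> v)) (at p)"
    by (intro has_derivative_diff smooth_on_has_derivative[OF U(3,2)] bounded_linear_imp_has_derivative L)
  have "(frechet_derivative \<Psi> (at p) v - \<Phi> v) \<bullet> b = 0" for b
    by (rule derivative_zero_along[OF p v U(1,2), of "\<lambda>q. (\<Psi> q - \<Phi> q) \<bullet> b"])
      (use U(4) in \<open>auto intro!: has_derivative_inner_left d\<close>)
  from this[of "frechet_derivative \<Psi> (at p) v - \<Phi> v"] show ?thesis by simp
qed

lemma matrix_inv_mult3:
  fixes P A R :: mat2
  assumes "det P \<noteq> 0" "det A \<noteq> 0" "det R \<noteq> 0"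
  shows "matrix_inv (P ** A ** R) ** (P ** V ** R) = matrix_inv R ** (matrix_inv A ** V) ** R"
proof -
  have "matrix_inv (P ** A ** R) = matrix_inv R ** matrix_inv A ** matrix_inv P"
  proof (rule matrix_inv_unique_mat2)
    have "P ** A ** R ** (matrix_inv R ** matrix_inv A ** matrix_inv P) =
      P ** (A ** ((R ** matrix_inv R) ** (matrix_inv A ** matrix_inv P)))" by (simp only: right_assoc)
    also have "\<dots> = P ** ((A ** matrix_inv A) ** matrix_inv P)"
      by (simp only: matrix_inv_mat2(2)[OF assms(3)] matrix_mul_lid right_assoc)
    finally show "P ** A ** R ** (matrix_inv R ** matrix_inv A ** matrix_inv P) = mat 1"
      by (simp only: matrix_inv_mat2(2)[OF assms(2)] matrix_inv_mat2(2)[OF assms(1)] matrix_mul_lid)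
    have "matrix_inv R ** matrix_inv A ** matrix_inv P ** (P ** A ** R) =
      matrix_inv R ** (matrix_inv A ** ((matrix_inv P ** P) ** (A ** R)))" by (simp only: right_assoc)
    also have "\<dots> = matrix_inv R ** ((matrix_inv A ** A) ** R)"
      by (simp only: matrix_inv_mat2(3)[OF assms(1)] matrix_mul_lid right_assoc)
    finally show "matrix_inv R ** matrix_inv A ** matrix_inv P ** (P ** A ** R) = mat 1"
      by (simp only: matrix_inv_mat2(3)[OF assms(2)] matrix_inv_mat2(3)[OF assms(3)] matrix_mul_lid)
  qed
  then have "matrix_inv (P ** A ** R) ** (P ** V ** R) =
    matrix_inv R ** (matrix_inv A ** ((matrix_inv P ** P) ** (V ** R)))" by (simp only: right_assoc)
  then show ?thesis by (simp only: matrix_inv_mat2(3)[OF assms(1)] matrix_mul_lid right_assoc)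
qed

lemma ip_conj:
  fixes R X Y :: mat2 assumes "det R \<noteq> 0"
  shows "ip (matrix_inv R ** X ** R) (matrix_inv R ** Y ** R) = ip X Y"
proof -
  have "matrix_inv R ** X ** R ** (matrix_inv R ** Y ** R) = matrix_inv R ** (X ** ((R ** matrix_inv R) ** (Y ** R)))"
    by (simp only: right_assoc)
  also have "\<dots> = matrix_inv R ** (X ** Y ** R)" by (simp only: matrix_inv_mat2(2)[OF assms] matrix_mul_lid right_assoc)
  finally have "trace (matrix_inv R ** X ** R ** (matrix_inv R ** Y ** R)) = trace (X ** Y ** R ** matrix_inv R)"
    using trace_mul_sym[of "matrix_inv R" "X ** Y ** R"] by simp
  also have "X ** Y ** R ** matrix_inv R = X ** Y"
    by (simp only: right_assoc matrix_inv_mat2(2)[OF assms] matrix_mul_rid)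
  finally show ?thesis by (simp add: ip_def)
qed

text \<open>The determinant conditions make room for conjugation by matrices of arbitrary nonzero
  determinant.\<close>

lemma isometry_translation:
  fixes P Q R :: mat2
  assumes det: "det P * det R = 1" "det Q * det R = 1"
  shows "isometry (\<lambda>p. (P ** fst p ** R, Q ** snd p ** R))" (is "isometry ?\<Phi>")
proof -
  have d: "det P \<noteq> 0" "det Q \<noteq> 0" "det R \<noteq> 0" using det by auto
  define \<Psi> where "\<Psi> p = (matrix_inv P ** fst p ** matrix_inv R, matrix_inv Q ** snd p ** matrix_inv R)" for p :: mat2_pair
  have di: "det (matrix_inv P) * det (matrix_inv R) = 1" "det (matrix_inv Q) * det (matrix_inv R) = 1"
  proof -
    have "det X * det (matrix_inv X) = 1" if "det X \<noteq> 0" for X :: mat2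
      using matrix_inv_mat2(2)[OF that] by (metis det_I det_mul)
    from this[OF d(1)] this[OF d(2)] this[OF d(3)]
    have e: "det (matrix_inv P) = 1 / det P" "det (matrix_inv Q) = 1 / det Q" "det (matrix_inv R) = 1 / det R"
      using d by (auto simp: field_simps)
    then show "det (matrix_inv P) * det (matrix_inv R) = 1" "det (matrix_inv Q) * det (matrix_inv R) = 1"
      using det by simp_all
  qed
  have cancel: "matrix_inv X ** (X ** Y ** R) ** matrix_inv R = Y" "X ** (matrix_inv X ** Y ** matrix_inv R) ** R = Y"
    if "det X \<noteq> 0" for X Y :: mat2
  proof -
    have "matrix_inv X ** (X ** Y ** R) ** matrix_inv R = (matrix_inv X ** X) ** (Y ** (R ** matrix_inv R))"
      "X ** (matrix_inv X ** Y ** matrix_inv R) ** R = (X ** matrix_inv X) ** (Y ** (matrix_inv R ** R))"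
      by (simp_all only: right_assoc)
    then show "matrix_inv X ** (X ** Y ** R) ** matrix_inv R = Y" "X ** (matrix_inv X ** Y ** matrix_inv R) ** R = Y"
      by (simp_all add: matrix_inv_mat2(2,3)[OF d(3)] matrix_inv_mat2(2,3)[OF that])
  qed
  have inv: "\<Psi> (?\<Phi> p) = p" "?\<Phi> (\<Psi> p) = p" for p
    by (simp_all add: \<Psi>_def cancel d)
  have maps: "?\<Phi> p \<in> SL2xSL2" "\<Psi> p \<in> SL2xSL2" if "p \<in> SL2xSL2" for p
  proof -
    have "det (fst p) = 1" "det (snd p) = 1" using that by (auto simp: SL2xSL2_def)
    then show "?\<Phi> p \<in> SL2xSL2" "\<Psi> p \<in> SL2xSL2"
      using det di by (simp_all add: \<Psi>_def SL2xSL2_def det_mul)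
  qed
  have bl: "bounded_linear ?\<Phi>" "bounded_linear \<Psi>"
    unfolding \<Psi>_def[abs_def] by (rule bounded_linear_unl_mult)+
  have bij: "bij_betw ?\<Phi> SL2xSL2 SL2xSL2"
    by (rule bij_betw_byWitness[of _ \<Psi>]) (use inv maps in auto)
  have "inv_into SL2xSL2 ?\<Phi> q = \<Psi> q" if "q \<in> SL2xSL2" for q
    using inv_into_f_eq[OF bij_betw_imp_inj_on[OF bij] maps(2)[OF that] inv(2)] .
  then have "local_extension (inv_into SL2xSL2 ?\<Phi>) p UNIV \<Psi>" for p
    using smooth_on_linear[OF bounded_linear.linear[OF bl(2)]] by (simp add: local_extension_def)
  then have s2: "smooth_map (inv_into SL2xSL2 ?\<Phi>)" unfolding smooth_map_def by blast
  have "local_extension ?\<Phi> p UNIV ?\<Phi>" for p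
    using smooth_on_linear[OF bounded_linear.linear[OF bl(1)]] by (simp add: local_extension_def)
  then have s1: "smooth_map ?\<Phi>" unfolding smooth_map_def by blast
  have "gNK (?\<Phi> p) (frechet_derivative \<Theta> (at p) v) (frechet_derivative \<Theta> (at p) w) = gNK p v w"
    if "p \<in> SL2xSL2" "local_extension ?\<Phi> p U \<Theta>" "v \<in> tangent_SL2xSL2 p" "w \<in> tangent_SL2xSL2 p" for p U \<Theta> v w
  proof -
    note p = SL2xSL2_det[OF that(1)]
    have l: "ltr (?\<Phi> p) (?\<Phi> v) = (matrix_inv R ** fst (ltr p v) ** R, matrix_inv R ** snd (ltr p v) ** R)" for v
      using matrix_inv_mult3[OF d(1) _ d(3)] matrix_inv_mult3[OF d(2) _ d(3)] p by (simp add: ltr_def)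
    show ?thesis
      unfolding local_extension_derivative[OF that(2) bl(1) that(1) that(3)]
        local_extension_derivative[OF that(2) bl(1) that(1) that(4)] gNK_ltr l gL_def
      by (simp add: ip_conj[OF d(3)])
  qed
  then show ?thesis using bij s1 s2 unfolding isometry_def by blast
qed

text \<open>The map \<open>\<pi> \<circ> g\<close> has invertible derivative at \<open>u\<close> and hence covers a neighbourhood of its value.
  Injectivity of \<open>\<pi>\<close> on the model lifts this back to the model.\<close>

lemma open_immersed_image:
  fixes g :: "real^2 \<Rightarrow> mat2_pair" and \<pi> :: "mat2_pair \<Rightarrow> real^2"
  assumes D: "open D" "u \<in> D" and g: "continuous_on D g" "(g has_derivative g') (at u)"
    and \<pi>: "bounded_linear \<pi>" and inj: "\<And>v. \<pi> (g' v) = 0 \<Longrightarrow> v = 0"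
    and \<Sigma>: "g ` D \<subseteq> \<Sigma>" and W0: "open W0" "g u \<in> W0" "inj_on \<pi> (\<Sigma> \<inter> W0)"
  obtains W where "open W" "g u \<in> W" "\<Sigma> \<inter> W \<subseteq> g ` D"
proof -
  define D' where "D' = D \<inter> g -` W0"
  have D': "open D'" "u \<in> D'" "D' \<subseteq> D"
    using continuous_open_preimage[OF g(1) D(1) W0(1)] D W0 by (auto simp: D'_def Int_commute)
  have lin: "linear (\<pi> \<circ> g')"
    using linear_compose[OF has_derivative_linear[OF g(2)] bounded_linear.linear[OF \<pi>]] .
  have "inj (\<pi> \<circ> g')" unfolding linear_injective_0[OF lin] using inj by simp
  then have "surj (\<pi> \<circ> g')" by (rule linear_injective_imp_surjective[OF lin]) simp
  then obtain h where h: "linear h" "(\<pi> \<circ> g') \<circ> h = id" using linear_surjective_right_inverse[OF lin] by blast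
  have d: "((\<pi> \<circ> g) has_derivative (\<pi> \<circ> g')) (at u)"
    using bounded_linear.has_derivative[OF \<pi> g(2)] by (simp add: o_def)
  have "continuous_on D' (\<pi> \<circ> g)"
    by (intro continuous_on_compose continuous_on_subset[OF g(1) D'(3)] linear_continuous_on \<pi>)
  then have "(\<pi> \<circ> g) u \<in> interior ((\<pi> \<circ> g) ` D')"
    using h D' by (intro sussmann_open_mapping[OF D'(1) _ D'(2) d _ h(2)])
      (auto simp: linear_conv_bounded_linear interior_open)
  then have i: "\<pi> (g u) \<in> interior ((\<pi> \<circ> g) ` D')" by simp
  show thesis
  proof (rule that)
    have "open (\<pi> -` interior ((\<pi> \<circ> g) ` D'))"
      by (rule open_vimage[OF open_interior linear_continuous_on[OF \<pi>]])
    then show "open (W0 \<inter> \<pi> -` interior ((\<pi> \<circ> g) ` D'))" using W0 by blast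
    show "g u \<in> W0 \<inter> \<pi> -` interior ((\<pi> \<circ> g) ` D')" using W0 i by simp
    show "\<Sigma> \<inter> (W0 \<inter> \<pi> -` interior ((\<pi> \<circ> g) ` D')) \<subseteq> g ` D"
    proof
      fix \<sigma> assume s: "\<sigma> \<in> \<Sigma> \<inter> (W0 \<inter> \<pi> -` interior ((\<pi> \<circ> g) ` D'))"
      then have "\<pi> \<sigma> \<in> (\<pi> \<circ> g) ` D'" using interior_subset by blast
      then obtain t where t: "t \<in> D'" "\<pi> \<sigma> = \<pi> (g t)" by auto
      then have "g t \<in> \<Sigma> \<inter> W0" using \<Sigma> by (auto simp: D'_def)
      then have "\<sigma> = g t" using s t inj_onD[OF W0(3)] by blast
      then show "\<sigma> \<in> g ` D" using t D' by blast
    qed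
  qed
qed

definition Hm :: mat2 where "Hm = vector [vector [1, 0], vector [0, -1]]"
definition Km :: mat2 where "Km = vector [vector [0, 1], vector [-1, 0]]"

lemma Hm_nth [simp]: "Hm$1$1 = 1" "Hm$1$2 = 0" "Hm$2$1 = 0" "Hm$2$2 = -1"
  and Km_nth [simp]: "Km$1$1 = 0" "Km$1$2 = 1" "Km$2$1 = -1" "Km$2$2 = 0"
  by (simp_all add: Hm_def Km_def)

text \<open>After scaling, \<open>Y\<^sup>2\<close> is plus or minus the identity. If \<open>Y\<^sup>2 = T\<^sup>2 = 1\<close> then \<open>Y + T\<close> intertwines \<open>Y\<close>
  and \<open>T\<close>, and if \<open>Y\<^sup>2 = T\<^sup>2 = -1\<close> then \<open>1 - Y T\<close> does. Should this matrix be singular, the same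
  construction for \<open>- Y\<close> is not.\<close>

lemma traceless_normal_form:
  assumes X: "trace X = 0" "ip X X \<noteq> 0"
  obtains C k T where "det C \<noteq> 0" "k \<noteq> 0" "T \<in> {Hm, Km}" "X ** C = k *\<^sub>R (C ** T)"
proof -
  define r where "r = sqrt \<bar>ip X X\<bar>"
  have r: "r > 0" using X by (simp add: r_def)
  define Y where "Y = (1/r) *\<^sub>R X"
  have XY: "X = r *\<^sub>R Y" using r by (simp add: Y_def)
  have Y: "trace Y = 0" using X by (simp add: Y_def trace_mat2_linear)
  note t = trace0_22[OF Y]
  have YY: "ip Y Y = sgn (ip X X)"
  proof -
    have "r * r = \<bar>ip X X\<bar>" by (simp add: r_def)
    then show ?thesis using X(2) by (simp add: Y_def linear_ip sgn_if)
  qed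
  have ipY: "ip Y Y = Y$1$1 * Y$1$1 + Y$1$2 * Y$2$1" by (simp add: mat2_coords t)
  note goal = that
  have fin: thesis if "det C \<noteq> 0" "e \<noteq> 0" "T \<in> {Hm, Km}" "Y ** C = e *\<^sub>R (C ** T)" for C e T
    by (rule goal[of C "r * e" T]) (use that r in \<open>auto simp: XY mul_linear\<close>)
  show thesis
  proof (cases "ip X X > 0")
    case True
    then have q: "Y$1$1 * Y$1$1 + Y$1$2 * Y$2$1 = 1" using YY ipY by simp
    show thesis
    proof (cases "Y$1$1 = -1")
      case False
      show thesis
      proof (rule fin[of "Y + Hm" 1 Hm])
        have "det (Y + Hm) = - 2 - 2 * Y$1$1" using q by (simp add: det_2 t algebra_simps)
        then show "det (Y + Hm) \<noteq> 0" using False by simp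
        show "Y ** (Y + Hm) = 1 *\<^sub>R ((Y + Hm) ** Hm)" using q by (simp add: mat2_coords t algebra_simps)
      qed simp_all
    next
      case True
      show thesis
      proof (rule fin[of "Hm - Y" "-1" Hm])
        have "det (Hm - Y) = - 2 + 2 * Y$1$1" using q by (simp add: det_2 t algebra_simps)
        then show "det (Hm - Y) \<noteq> 0" using True by simp
        show "Y ** (Hm - Y) = - 1 *\<^sub>R ((Hm - Y) ** Hm)" using q by (simp add: mat2_coords t algebra_simps)
      qed simp_all
    qed
  next
    case False
    then have q: "Y$1$1 * Y$1$1 + Y$1$2 * Y$2$1 = -1" using YY ipY X(2) by simp
    show thesis
    proof (cases "Y$1$2 > 0")
      case True
      show thesis
      proof (rule fin[of "mat 1 - Y ** Km" 1 Km])
        have "det (mat 1 - Y ** Km) = 2 + Y$1$2 - Y$2$1" using q by (simp add: mat2_coords det_2 t algebra_simps)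
        moreover have "Y$2$1 < 0"
        proof (rule ccontr)
          assume "\<not> Y$2$1 < 0"
          then have "Y$1$2 * Y$2$1 \<ge> 0" using True by simp
          then show False using q zero_le_square[of "Y$1$1"] by linarith
        qed
        ultimately show "det (mat 1 - Y ** Km) \<noteq> 0" using True by linarith
        show "Y ** (mat 1 - Y ** Km) = 1 *\<^sub>R ((mat 1 - Y ** Km) ** Km)" using q by (simp add: mat2_coords t algebra_simps)
      qed simp_all
    next
      case False
      show thesis
      proof (rule fin[of "mat 1 + Y ** Km" "-1" Km])
        have "det (mat 1 + Y ** Km) = 2 - Y$1$2 + Y$2$1" using q by (simp add: mat2_coords det_2 t algebra_simps)
        moreover have "Y$2$1 \<ge> 0"
        proof (rule ccontr)
          assume "\<not> Y$2$1 \<ge> 0"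
          then have "Y$1$2 * Y$2$1 \<ge> 0" using False by (simp add: mult_nonpos_nonpos)
          then show False using q zero_le_square[of "Y$1$1"] by linarith
        qed
        ultimately show "det (mat 1 + Y ** Km) \<noteq> 0" using False by linarith
        show "Y ** (mat 1 + Y ** Km) = - 1 *\<^sub>R ((mat 1 + Y ** Km) ** Km)" using q by (simp add: mat2_coords t algebra_simps)
      qed simp_all
    qed
  qed
qed

text \<open>The parameters of the models are an invertible linear change of independent coordinates in
  the two factors.\<close>

lemma plane_reparametrization:
  fixes g :: "real \<Rightarrow> mat2"
  shows "{(g (1 / sqrt 2 * (sqrt 3 * s - t)), g (1 / sqrt 2 * (sqrt 3 * s + t))) | s t. True} = {(g a, g b) | a b. True}"
    (is "?L = ?R")
proof
  show "?L \<subseteq> ?R" by blast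
  show "?R \<subseteq> ?L"
  proof
    fix z assume "z \<in> ?R"
    then obtain a b where z: "z = (g a, g b)" by blast
    define s t where "s = (a + b) / (sqrt 2 * sqrt 3)" "t = (b - a) / sqrt 2"
    have "1 / sqrt 2 * (sqrt 3 * s - t) = a" "1 / sqrt 2 * (sqrt 3 * s + t) = b"
      by (simp_all add: s_t_def field_simps)
    then have "z = (g (1 / sqrt 2 * (sqrt 3 * s - t)), g (1 / sqrt 2 * (sqrt 3 * s + t)))" by (simp only: z)
    then show "z \<in> ?L" by blast
  qed
qed

lemma Sigma1_eq: "Sigma1 = {(exp_diag a, exp_diag b) | a b. True}"
  unfolding Sigma1_def by (rule plane_reparametrization)

lemma Sigma2_eq: "Sigma2 = {(rot a, rot b) | a b. True}"
  unfolding Sigma2_def by (rule plane_reparametrization)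

lemma Sigma3_eq: "Sigma3 = {(rho Y, rhoc Y) | Y. trace Y = 0 \<and> ip Y Y = -1}"
proof -
  have "(\<exists>y1 y2 y3. Y = vector [vector [y1, y2 + y3], vector [y2 - y3, - y1]] \<and> y1\<^sup>2 + y2\<^sup>2 - y3\<^sup>2 = (-1::real))
    \<longleftrightarrow> trace Y = 0 \<and> ip Y Y = -1" for Y :: mat2
  proof
    assume Y: "trace Y = 0 \<and> ip Y Y = -1"
    then have t: "Y$2$2 = - Y$1$1" using trace0_22[of Y] by simp
    have q: "Y$1$1 * Y$1$1 + Y$1$2 * Y$2$1 = -1" using Y by (simp add: mat2_coords t)
    show "\<exists>y1 y2 y3. Y = vector [vector [y1, y2 + y3], vector [y2 - y3, - y1]] \<and> y1\<^sup>2 + y2\<^sup>2 - y3\<^sup>2 = (-1::real)"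
      by (rule exI[of _ "Y$1$1"], rule exI[of _ "(Y$1$2 + Y$2$1)/2"], rule exI[of _ "(Y$1$2 - Y$2$1)/2"])
        (use q in \<open>simp add: vec_eq_iff forall_2 t field_simps power2_eq_square\<close>)
  qed (auto simp: mat2_coords power2_eq_square algebra_simps)
  then show ?thesis unfolding Sigma3_def rho_def rhoc_def by (auto; blast)
qed

lemma commute_Hm:
  assumes "det D = 1" "D ** Hm = Hm ** D" "D$1$1 > 0"
  shows "D = exp_diag (ln (D$1$1))"
proof -
  have o: "D$1$2 = 0" "D$2$1 = 0" using assms(2) by (auto simp: mat2_coords)
  then have "D$1$1 * D$2$2 = 1" using assms(1) by (simp add: det_2)
  then show ?thesis using assms(3) o by (simp add: vec_eq_iff forall_2 exp_diag_def exp_minus field_simps)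
qed

lemma commute_Km:
  assumes "det D = 1" "D ** Km = Km ** D"
  obtains x where "D = rot x"
proof -
  have o: "D$2$1 = - D$1$2" "D$2$2 = D$1$1"
    using arg_cong[OF assms(2), of "\<lambda>M. M$1$1"] arg_cong[OF assms(2), of "\<lambda>M. M$1$2"]
    by (simp_all add: matrix_matrix_mult_def sum_2)
  then have "(D$1$1)\<^sup>2 + (D$1$2)\<^sup>2 = 1" using assms(1) by (simp add: det_2 power2_eq_square)
  then obtain x where "D$1$1 = cos x" "D$1$2 = sin x" using sincos_total_2pi[of "D$1$1" "D$1$2"] by blast
  then show thesis using o by (intro that[of x]) (simp add: vec_eq_iff forall_2 rot_def)
qed

section \<open>Linear coordinates on the model surfaces\<close>

lemma openin_top_of_set_locally:
  assumes "S \<subseteq> \<Sigma>" "\<And>x. x \<in> S \<Longrightarrow> \<exists>W. open W \<and> x \<in> W \<and> \<Sigma> \<inter> W \<subseteq> S"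
  shows "openin (top_of_set \<Sigma>) S"
proof (subst openin_subopen, intro ballI)
  fix x assume x: "x \<in> S"
  then obtain W where W: "open W" "x \<in> W" "\<Sigma> \<inter> W \<subseteq> S" using assms(2) by blast
  then show "\<exists>T. openin (top_of_set \<Sigma>) T \<and> x \<in> T \<and> T \<subseteq> S"
    using x assms(1) by (intro exI[of _ "\<Sigma> \<inter> W"]) (auto intro: openin_open_Int)
qed

definition coord_pair :: "(mat2_pair \<Rightarrow> real) \<Rightarrow> (mat2_pair \<Rightarrow> real) \<Rightarrow> mat2_pair \<Rightarrow> real^2" where
  "coord_pair l k p = l p *\<^sub>R axis 1 1 + k p *\<^sub>R axis 2 1"

lemma coord_pair_eq: "coord_pair l k p = coord_pair l k q \<longleftrightarrow> l p = l q \<and> k p = k q"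
  by (auto simp: coord_pair_def vec_eq_iff forall_2 axis_def)

lemma coord_pair_0: "coord_pair l k p = 0 \<longleftrightarrow> l p = 0 \<and> k p = 0"
  by (auto simp: coord_pair_def vec_eq_iff forall_2 axis_def)

lemma bounded_linear_coord_pair:
  assumes "linear l" "linear k" shows "bounded_linear (coord_pair l k)"
  unfolding linear_conv_bounded_linear[symmetric] linear_iff coord_pair_def
  by (simp add: linear_add[OF assms(1)] linear_add[OF assms(2)] linear_cmul[OF assms(1)] linear_cmul[OF assms(2)] algebra_simps)

lemma linear_continuous: "linear l \<Longrightarrow> continuous_on S l" for l :: "mat2_pair \<Rightarrow> real"
  by (simp add: linear_continuous_on linear_conv_bounded_linear)

text \<open>The last property says that the projection is injective on the tangent plane of the model.\<close>

lemma Sigma1_chart: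
  assumes s: "s \<in> Sigma1"
  obtains \<pi> W where "bounded_linear \<pi>" "open W" "s \<in> W" "inj_on \<pi> (Sigma1 \<inter> W)"
    "\<And>a b. \<pi> (fst s ** (a *\<^sub>R Hm), snd s ** (b *\<^sub>R Hm)) = (0::real^2) \<Longrightarrow> a = 0 \<and> b = 0"
proof (rule that)
  let ?\<pi> = "coord_pair (\<lambda>p. fst p $ 1 $ 1) (\<lambda>p. snd p $ 1 $ 1)"
  show "bounded_linear ?\<pi>" by (rule bounded_linear_coord_pair) (auto simp: linear_iff)
  show "open UNIV" "s \<in> UNIV" by auto
  show "inj_on ?\<pi> (Sigma1 \<inter> UNIV)"
    by (auto simp: inj_on_def Sigma1_eq coord_pair_eq exp_diag_def)
  obtain x y where "s = (exp_diag x, exp_diag y)" using s by (auto simp: Sigma1_eq)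
  then show "a = 0 \<and> b = 0" if "?\<pi> (fst s ** (a *\<^sub>R Hm), snd s ** (b *\<^sub>R Hm)) = 0" for a b
    using that by (simp add: coord_pair_0 exp_diag_def matrix_matrix_mult_def sum_2)
qed

lemma rot_nth [simp]: "rot x $ 1 $ 1 = cos x" "rot x $ 1 $ 2 = sin x" "rot x $ 2 $ 1 = - sin x" "rot x $ 2 $ 2 = cos x"
  by (simp_all add: rot_def)

text \<open>Sine and sign of the cosine of the angle relative to \<open>e\<close> determine the rotation.\<close>

lemma rot_eqI:
  assumes "cos e * sin x - sin e * cos x = cos e * sin y - sin e * cos y"
    and "cos e * cos x + sin e * sin x > 0" "cos e * cos y + sin e * sin y > 0"
  shows "rot x = rot y"
proof -
  have s: "sin (x - e) = sin (y - e)" and c: "cos (x - e) > 0" "cos (y - e) > 0"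
    using assms by (simp_all add: sin_diff cos_diff mult.commute)
  have "(cos (x - e))\<^sup>2 = (cos (y - e))\<^sup>2" by (simp add: cos_squared_eq s)
  then have c': "cos (x - e) = cos (y - e)" using c by (simp add: power2_eq_iff_nonneg)
  have "sin x = sin y" "cos x = cos y"
    using sin_add[of "x - e" e] sin_add[of "y - e" e] cos_add[of "x - e" e] cos_add[of "y - e" e] s c' by simp_all
  then show ?thesis by (simp add: rot_def)
qed

text \<open>In each factor the coordinate is the sine of the angle relative to the base point; the
  neighbourhood keeps the cosine positive.\<close>

lemma Sigma2_chart:
  assumes s: "s \<in> Sigma2"
  obtains \<pi> W where "bounded_linear \<pi>" "open W" "s \<in> W" "inj_on \<pi> (Sigma2 \<inter> W)"
    "\<And>a b. \<pi> (fst s ** (a *\<^sub>R Km), snd s ** (b *\<^sub>R Km)) = (0::real^2) \<Longrightarrow> a = 0 \<and> b = 0"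
proof -
  obtain x y where xy: "s = (rot x, rot y)" using s by (auto simp: Sigma2_eq)
  define l where "l p = cos x * fst p $ 1 $ 2 - sin x * fst p $ 1 $ 1" for p :: mat2_pair
  define k where "k p = cos y * snd p $ 1 $ 2 - sin y * snd p $ 1 $ 1" for p :: mat2_pair
  define l' where "l' p = cos x * fst p $ 1 $ 1 + sin x * fst p $ 1 $ 2" for p :: mat2_pair
  define k' where "k' p = cos y * snd p $ 1 $ 1 + sin y * snd p $ 1 $ 2" for p :: mat2_pair
  have lin: "linear l" "linear k" "linear l'" "linear k'"
    by (auto simp: linear_iff l_def k_def l'_def k'_def algebra_simps)
  have one: "cos t * cos t + sin t * sin t = 1" for t :: real
    using sin_cos_squared_add2[of t] by (simp add: power2_eq_square)
  show thesis
  proof (rule that)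
    show "bounded_linear (coord_pair l k)" by (rule bounded_linear_coord_pair[OF lin(1,2)])
    show "open ({p. 0 < l' p} \<inter> {p. 0 < k' p})"
      by (intro open_Int open_Collect_less continuous_on_const linear_continuous lin)
    show "s \<in> {p. 0 < l' p} \<inter> {p. 0 < k' p}" by (simp add: xy l'_def k'_def one)
    show "inj_on (coord_pair l k) (Sigma2 \<inter> ({p. 0 < l' p} \<inter> {p. 0 < k' p}))"
    proof (rule inj_onI)
      fix p q assume p: "p \<in> Sigma2 \<inter> ({p. 0 < l' p} \<inter> {p. 0 < k' p})" and q: "q \<in> Sigma2 \<inter> ({p. 0 < l' p} \<inter> {p. 0 < k' p})"
        and e: "coord_pair l k p = coord_pair l k q"
      obtain a b where ab: "p = (rot a, rot b)" using p by (auto simp: Sigma2_eq)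
      obtain a' b' where ab': "q = (rot a', rot b')" using q by (auto simp: Sigma2_eq)
      have "rot a = rot a'" by (rule rot_eqI[of x]) (use p q e in \<open>auto simp: ab ab' l_def l'_def coord_pair_eq\<close>)
      moreover have "rot b = rot b'" by (rule rot_eqI[of y]) (use p q e in \<open>auto simp: ab ab' k_def k'_def coord_pair_eq\<close>)
      ultimately show "p = q" by (simp add: ab ab')
    qed
    fix a b assume "coord_pair l k (fst s ** (a *\<^sub>R Km), snd s ** (b *\<^sub>R Km)) = 0"
    then have "a * (cos x * cos x) + a * (sin x * sin x) = 0" "b * (cos y * cos y) + b * (sin y * sin y) = 0"
      by (simp_all add: coord_pair_0 xy l_def k_def matrix_matrix_mult_def sum_2 algebra_simps)
    then have "a * (cos x * cos x + sin x * sin x) = 0" "b * (cos y * cos y + sin y * sin y) = 0"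
      by (simp_all only: distrib_left)
    then show "a = 0 \<and> b = 0" by (simp add: one)
  qed
qed

text \<open>In the first factor of the model \<open>Y\<close> ranges over the hyperboloid \<open>y\<^sub>1\<^sup>2 + y\<^sub>2\<^sup>2 - y\<^sub>3\<^sup>2 = -1\<close>,
  whose two sheets are graphs over \<open>(y\<^sub>1, y\<^sub>2)\<close>. The neighbourhood selects the sheet.\<close>

lemma Sigma3_chart:
  assumes Y: "trace Y = 0" "ip Y Y = -1"
  obtains \<pi> W where "bounded_linear \<pi>" "open W" "(rho Y, rhoc Y) \<in> W" "inj_on \<pi> (Sigma3 \<inter> W)"
    "\<And>X. trace X = 0 \<Longrightarrow> ip Y X = 0 \<Longrightarrow> \<pi> ((sqrt 3 / 2) *\<^sub>R X, - ((sqrt 3 / 2) *\<^sub>R X)) = (0::real^2) \<Longrightarrow> X = 0"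
proof -
  define l where "l p = fst p $ 1 $ 1" for p :: mat2_pair
  define k where "k p = fst p $ 1 $ 2 + fst p $ 2 $ 1" for p :: mat2_pair
  define d where "d p = (Y$1$2 - Y$2$1) * (fst p $ 1 $ 2 - fst p $ 2 $ 1)" for p :: mat2_pair
  have lin: "linear l" "linear k" "linear d"
    by (auto simp: linear_iff l_def k_def d_def algebra_simps)
  have q: "Z$1$1 * Z$1$1 + Z$1$2 * Z$2$1 = -1" if "trace Z = 0" "ip Z Z = -1" for Z :: mat2
    using that(2) by (simp add: mat2_coords trace0_22[OF that(1)])
  \<comment> \<open>the off-diagonal entries have opposite signs, and the sign of their difference tells the sheet\<close>
  have neg: "Z$1$2 * Z$2$1 < 0" if "trace Z = 0" "ip Z Z = -1" for Z :: mat2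
    using q[OF that] zero_le_square[of "Z$1$1"] by linarith
  have ne: "Y$1$2 \<noteq> Y$2$1" using neg[OF Y] zero_le_square[of "Y$1$2"] by (metis linorder_not_less)
  show thesis
  proof (rule that)
    show "bounded_linear (coord_pair l k)" by (rule bounded_linear_coord_pair[OF lin(1,2)])
    show "open {p. 0 < d p}" by (intro open_Collect_less continuous_on_const linear_continuous lin)
    have "d (rho Y, rhoc Y) = sqrt 3 / 2 * ((Y$1$2 - Y$2$1) * (Y$1$2 - Y$2$1))"
      by (simp add: d_def rho_def mat_def field_simps)
    also have "\<dots> > 0" using ne by (auto simp: zero_less_mult_iff)
    finally show "(rho Y, rhoc Y) \<in> {p. 0 < d p}" by simp
    show "inj_on (coord_pair l k) (Sigma3 \<inter> {p. 0 < d p})"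
    proof (rule inj_onI)
      fix p r assume p: "p \<in> Sigma3 \<inter> {p. 0 < d p}" and r: "r \<in> Sigma3 \<inter> {p. 0 < d p}" and e: "coord_pair l k p = coord_pair l k r"
      obtain Z where Z: "p = (rho Z, rhoc Z)" "trace Z = 0" "ip Z Z = -1" using p by (auto simp: Sigma3_eq)
      obtain Z' where Z': "r = (rho Z', rhoc Z')" "trace Z' = 0" "ip Z' Z' = -1" using r by (auto simp: Sigma3_eq)
      have 1: "Z$1$1 = Z'$1$1" and "sqrt 3 * (Z$1$2 + Z$2$1) = sqrt 3 * (Z'$1$2 + Z'$2$1)"
        using e by (simp_all add: coord_pair_eq l_def k_def Z Z' rho_def mat_def field_simps)
      then have 2: "Z$1$2 + Z$2$1 = Z'$1$2 + Z'$2$1" by simp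
      have d: "0 < sqrt 3 / 2 * ((Y$1$2 - Y$2$1) * (Z$1$2 - Z$2$1))" "0 < sqrt 3 / 2 * ((Y$1$2 - Y$2$1) * (Z'$1$2 - Z'$2$1))"
        using p r by (simp_all add: d_def Z Z' rho_def mat_def field_simps)
      have "Z$1$2 * Z$2$1 = Z'$1$2 * Z'$2$1" using q[OF Z(2,3)] q[OF Z'(2,3)] 1 by simp
      then have "(Z$1$2 - Z$2$1)\<^sup>2 = (Z'$1$2 - Z'$2$1)\<^sup>2"
        using arg_cong[OF 2, of "\<lambda>t. t * t"] by (simp add: power2_eq_square algebra_simps)
      then have "Z$1$2 - Z$2$1 = Z'$1$2 - Z'$2$1 \<or> Z$1$2 - Z$2$1 = - (Z'$1$2 - Z'$2$1)" by (simp only: power2_eq_iff)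
      then have 3: "Z$1$2 - Z$2$1 = Z'$1$2 - Z'$2$1"
      proof
        assume a: "Z$1$2 - Z$2$1 = - (Z'$1$2 - Z'$2$1)"
        show ?thesis using d unfolding a by (auto simp: zero_less_mult_iff)
      qed
      have "Z = Z'" using 1 2 3 trace0_22[OF Z(2)] trace0_22[OF Z'(2)] by (simp add: vec_eq_iff forall_2)
      then show "p = r" by (simp add: Z Z')
    qed
    fix X assume X: "trace X = 0" "ip Y X = 0" "coord_pair l k ((sqrt 3 / 2) *\<^sub>R X, - ((sqrt 3 / 2) *\<^sub>R X)) = 0"
    then have "sqrt 3 * (X$1$2 + X$2$1) = 0" by (simp add: coord_pair_0 k_def field_simps)
    then have x: "X$1$1 = 0" "X$2$1 = - X$1$2" "X$2$2 = 0"
      using X(3) trace0_22[OF X(1)] by (simp_all add: coord_pair_0 l_def eq_neg_iff_add_eq_0 add.commute)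
    then have "X$1$2 * (Y$2$1 - Y$1$2) = 0" using X(2) by (simp add: mat2_coords algebra_simps)
    then show "X = 0" using ne x by (simp add: vec_eq_iff forall_2)
  qed
qed

lemma rho_rhoc:
  assumes "trace N = 0" "ip N N = -1"
  shows "rho N ** rhoc N = mat 1" "rhoc N ** rho N = mat 1" "det (rho N) = 1" "det (rhoc N) = 1"
proof -
  note r = mul_linear right_assoc unit_rules[OF assms]
  show "rho N ** rhoc N = mat 1" "rhoc N ** rho N = mat 1"
    unfolding rho_def rhoc_def by (simp_all add: r vec_eq_iff field_simps)
  have "N$1$1 * N$1$1 + N$1$2 * N$2$1 = -1"
    using assms(2) by (simp add: mat2_coords trace0_22[OF assms(1)])
  then show "det (rho N) = 1" "det (rhoc N) = 1"
    by (simp_all add: rho_def rhoc_def det_2 mat_def trace0_22[OF assms(1)] sqrt3_mult algebra_simps)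
qed

section \<open>From charts to the surface\<close>

lemma locally_constant_zero_derivative:
  fixes h :: "'b::euclidean_space \<Rightarrow> 'c::real_normed_vector"
  assumes "open D" "u \<in> D" "\<And>s. s \<in> D \<Longrightarrow> (h has_derivative (\<lambda>_. 0)) (at s)"
  obtains V where "open V" "u \<in> V" "V \<subseteq> D" "\<And>s. s \<in> V \<Longrightarrow> h s = h u"
proof -
  obtain e where e: "e > 0" "ball u e \<subseteq> D" using openE[OF assms(1,2)] .
  have "\<exists>c. \<forall>s\<in>ball u e. h s = c"
  proof (rule has_derivative_zero_constant)
    show "(h has_derivative (\<lambda>_. 0)) (at s within ball u e)" if "s \<in> ball u e" for s
      using e(2) that by (blast intro: has_derivative_at_withinI[OF assms(3)])
  qed simp
  then obtain c where c: "\<forall>s\<in>ball u e. h s = c" by (elim exE) (rule that)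
  show thesis
  proof (rule that)
    show "open (ball u e)" "u \<in> ball u e" "ball u e \<subseteq> D" using e by simp_all
    show "h s = h u" if "s \<in> ball u e" for s using c that e(1) by simp
  qed
qed

abbreviation chart_image :: "'a chart \<Rightarrow> (real^2) set" where "chart_image c \<equiv> snd c ` fst c"

locale surface_in_SL2 =
  fixes M :: "'a topology" and \<A> :: "'a chart set" and F :: "'a \<Rightarrow> mat2_pair"
  assumes acs: "almost_complex_surface M \<A> F"
begin

abbreviation par :: "'a chart \<Rightarrow> real^2 \<Rightarrow> mat2_pair" where "par c \<equiv> F \<circ> inv_into (fst c) (snd c)"
abbreviation mcc :: "'a chart \<Rightarrow> real^2 \<Rightarrow> real^2 \<Rightarrow> mat2_pair" where "mcc c \<equiv> surface_patch.mc (par c)"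

lemma surf: "smooth_surface M \<A>" and conn: "connected_space M" and imm: "immersion M \<A> F"
  using acs by (auto simp: almost_complex_surface_def)

lemma chart_facts:
  assumes "c \<in> \<A>"
  shows "openin M (fst c)" "open (chart_image c)"
    "homeomorphic_map (subtopology M (fst c)) (top_of_set (chart_image c)) (snd c)"
  using surf assms by (auto simp: smooth_surface_def)

lemma chart_sub: "c \<in> \<A> \<Longrightarrow> fst c \<subseteq> topspace M"
  by (rule openin_subset[OF chart_facts(1)])

lemma topspace_subtop: "c \<in> \<A> \<Longrightarrow> topspace (subtopology M (fst c)) = fst c"
  using chart_sub[of c] by (simp add: Int_absorb1)

lemma chart_inj: "c \<in> \<A> \<Longrightarrow> inj_on (snd c) (fst c)"
  using homeomorphic_imp_injective_map[OF chart_facts(3)] topspace_subtop by metis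

lemma chart_inv: "c \<in> \<A> \<Longrightarrow> m \<in> fst c \<Longrightarrow> inv_into (fst c) (snd c) (snd c m) = m"
  by (rule inv_into_f_f[OF chart_inj])

lemma local_paramsI: "c \<in> \<A> \<Longrightarrow> (chart_image c, par c) \<in> local_params \<A> F"
  by (force simp: local_params_def)

lemma patch: assumes c: "c \<in> \<A>" shows "surface_patch (chart_image c) (par c)"
proof -
  note lp = local_paramsI[OF c]
  from imm have "\<forall>(D, f)\<in>local_params \<A> F. smooth_on D f \<and> (\<forall>u\<in>D. inj (frechet_derivative f (at u)))"
    unfolding immersion_def by (rule conjunct2)
  note i = bspec[OF this lp, unfolded prod.case]
  from acs have "\<forall>(D, f)\<in>local_params \<A> F. \<forall>u\<in>D. J_NK (f u) ` tangent_plane f u \<subseteq> tangent_plane f u \<and>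
       (\<forall>x. (\<forall>y. induced_metric f u x y = 0) \<longrightarrow> x = 0)"
    unfolding almost_complex_surface_def by (elim conjE)
  note j = bspec[OF this lp, unfolded prod.case]
  have s: "par c u \<in> SL2xSL2" if "u \<in> chart_image c" for u
  proof -
    obtain m where "m \<in> fst c" "u = snd c m" using \<open>u \<in> chart_image c\<close> by blast
    then show ?thesis using chart_inv[OF c] chart_sub[OF c] imm by (auto simp: immersion_def)
  qed
  show ?thesis
  proof
    show "open (chart_image c)" by (rule chart_facts(2)[OF c])
    show "smooth_on (chart_image c) (par c)" using i by (rule conjunct1)
    fix u assume u: "u \<in> chart_image c"
    show "par c u \<in> SL2xSL2" by (rule s[OF u])
    show "inj (frechet_derivative (par c) (at u))" using i u by blast
    show "J_NK (par c u) ` tangent_plane (par c) u \<subseteq> tangent_plane (par c) u" using bspec[OF j u] by (rule conjunct1)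
    show "x = 0" if "\<And>y. induced_metric (par c) u x y = 0" for x
      using bspec[OF j u] that by blast
  qed
qed

lemma F_par: "c \<in> \<A> \<Longrightarrow> m \<in> fst c \<Longrightarrow> par c (snd c m) = F m"
  by (simp add: chart_inv)

lemma F_SL: "m \<in> topspace M \<Longrightarrow> F m \<in> SL2xSL2"
  using imm by (auto simp: immersion_def)

lemma chart_exists: assumes "m \<in> topspace M" obtains c where "c \<in> \<A>" "m \<in> fst c"
proof -
  have "(\<Union>(U, \<phi>)\<in>\<A>. U) = topspace M" using surf by (simp add: smooth_surface_def)
  then have "m \<in> (\<Union>(U, \<phi>)\<in>\<A>. U)" using assms by simp
  then obtain c where "c \<in> \<A>" "m \<in> fst c" by (auto simp: case_prod_unfold)
  then show thesis by (rule that)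
qed

lemma chart_nbhd:
  assumes c: "c \<in> \<A>" and V: "open V"
  shows "openin M {m \<in> fst c. snd c m \<in> V}"
proof -
  have "continuous_map (subtopology M (fst c)) (top_of_set (chart_image c)) (snd c)"
    by (rule homeomorphic_imp_continuous_map[OF chart_facts(3)[OF c]])
  then have "continuous_map (subtopology M (fst c)) euclidean (snd c)"
    by (rule continuous_map_into_fulltopology)
  then have "openin (subtopology M (fst c)) {m \<in> topspace (subtopology M (fst c)). snd c m \<in> V}"
    by (rule openin_continuous_map_preimage) (use V in simp)
  then have "openin (subtopology M (fst c)) {m \<in> fst c. snd c m \<in> V}" unfolding topspace_subtop[OF c] .
  then show ?thesis by (rule openin_trans_full[OF _ chart_facts(1)[OF c]])
qed

lemma constant_if_locally_constant:
  assumes loc: "\<And>c m. c \<in> \<A> \<Longrightarrow> m \<in> fst c \<Longrightarrow>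
      \<exists>V. open V \<and> snd c m \<in> V \<and> (\<forall>m'\<in>fst c. snd c m' \<in> V \<longrightarrow> K m' = K m)"
    and m: "m \<in> topspace M" "m' \<in> topspace M"
  shows "K m = K m'"
proof -
  have nb: "\<exists>T. openin M T \<and> x \<in> T \<and> (\<forall>y\<in>T. K y = K x)" if x: "x \<in> topspace M" for x
  proof -
    obtain c where c: "c \<in> \<A>" "x \<in> fst c" using chart_exists[OF x] .
    obtain V where V: "open V" "snd c x \<in> V" "\<forall>m'\<in>fst c. snd c m' \<in> V \<longrightarrow> K m' = K x"
      using loc[OF c] by (elim exE conjE) (rule that)
    show ?thesis
    proof (intro exI conjI)
      show "openin M {m \<in> fst c. snd c m \<in> V}" by (rule chart_nbhd[OF c(1) V(1)])
      show "x \<in> {m \<in> fst c. snd c m \<in> V}" using c(2) V(2) by simp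
      show "\<forall>y\<in>{m \<in> fst c. snd c m \<in> V}. K y = K x" using V(3) by simp
    qed
  qed
  have op: "openin M {x \<in> topspace M. K x \<in> B}" for B
  proof (subst openin_subopen, intro ballI)
    fix x assume x: "x \<in> {x \<in> topspace M. K x \<in> B}"
    then have "x \<in> topspace M" by simp
    from nb[OF this] obtain T where T: "openin M T" "x \<in> T" "\<forall>y\<in>T. K y = K x" by (elim exE conjE) (rule that)
    have "T \<subseteq> {x \<in> topspace M. K x \<in> B}"
    proof
      fix y assume y: "y \<in> T"
      then have "K y = K x" using T(3) by blast
      then show "y \<in> {x \<in> topspace M. K x \<in> B}" using x y openin_subset[OF T(1)] by auto
    qed
    then show "\<exists>T. openin M T \<and> x \<in> T \<and> T \<subseteq> {x \<in> topspace M. K x \<in> B}" using T(1,2) by blast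
  qed
  define S where "S = {x \<in> topspace M. K x \<in> {K m}}"
  have "topspace M - S = {x \<in> topspace M. K x \<in> - {K m}}" by (auto simp: S_def)
  then have "closedin M S" unfolding closedin_def using op[of "- {K m}"] by (simp add: S_def)
  moreover have "openin M S" unfolding S_def by (rule op)
  ultimately have "S = {} \<or> S = topspace M" using conn unfolding connected_space_clopen_in by blast
  then have "S = topspace M" using m by (auto simp: S_def)
  then have "m' \<in> S" using m by simp
  then show ?thesis by (simp add: S_def)
qed

text \<open>The functions \<open>h c\<close> are local representatives of \<open>K\<close> up to a common map \<open>g\<close>.\<close>

lemma constant_if_zero_derivative:
  fixes h :: "'a chart \<Rightarrow> real^2 \<Rightarrow> 'c::real_normed_vector"
  assumes d: "\<And>c u. c \<in> \<A> \<Longrightarrow> u \<in> chart_image c \<Longrightarrow> (h c has_derivative (\<lambda>_. 0)) (at u)"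
    and K: "\<And>c m. c \<in> \<A> \<Longrightarrow> m \<in> fst c \<Longrightarrow> K m = g (h c (snd c m))"
    and m: "m \<in> topspace M" "m' \<in> topspace M"
  shows "K m = K m'"
proof (rule constant_if_locally_constant[OF _ m])
  fix c m assume c: "c \<in> \<A>" "m \<in> fst c"
  have u: "snd c m \<in> chart_image c" using c by blast
  obtain V where V: "open V" "snd c m \<in> V" "V \<subseteq> chart_image c"
    and const: "\<And>s. s \<in> V \<Longrightarrow> h c s = h c (snd c m)"
    by (rule locally_constant_zero_derivative[OF chart_facts(2)[OF c(1)] u]) (erule d[OF c(1)], rule that)
  show "\<exists>V. open V \<and> snd c m \<in> V \<and> (\<forall>m'\<in>fst c. snd c m' \<in> V \<longrightarrow> K m' = K m)"
  proof (intro exI conjI ballI impI)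
    fix m' assume m': "m' \<in> fst c" "snd c m' \<in> V"
    show "K m' = K m" unfolding K[OF c(1) m'(1)] K[OF c] const[OF m'(2)] ..
  qed (rule V)+
qed

text \<open>The transition map is smooth, so the chain rule applies.\<close>

lemma plane_subset:
  assumes c: "c \<in> \<A>" "m \<in> fst c" and d: "d \<in> \<A>" "m \<in> fst d"
  shows "range (mcc c (snd c m)) \<subseteq> range (mcc d (snd d m))"
proof -
  interpret P: surface_patch "chart_image c" "par c" by (rule patch[OF c(1)])
  interpret Q: surface_patch "chart_image d" "par d" by (rule patch[OF d(1)])
  define \<tau> where "\<tau> = snd d \<circ> inv_into (fst c) (snd c)"
  define E where "E = snd c ` (fst c \<inter> fst d)"
  have "\<forall>c\<in>\<A>. \<forall>d\<in>\<A>. smooth_on (snd c ` (fst c \<inter> fst d)) (snd d \<circ> inv_into (fst c) (snd c))"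
    using surf by (simp add: smooth_surface_def case_prod_unfold)
  then have sm: "smooth_on E \<tau>" using c(1) d(1) unfolding E_def \<tau>_def by blast
  have uE: "snd c m \<in> E" using c d by (auto simp: E_def)
  have "openin (subtopology M (fst c)) (fst c \<inter> fst d)"
    using chart_facts(1)[OF d(1)] by (metis Int_commute openin_subtopology)
  then have "openin (top_of_set (chart_image c)) E"
    unfolding E_def using homeomorphic_map_openness_eq[OF chart_facts(3)[OF c(1)]] by blast
  then have oE: "open E" using chart_facts(2)[OF c(1)] openin_open_eq by blast
  have eq: "par d (\<tau> s) = par c s" if s: "s \<in> E" for s
  proof -
    obtain x where x: "x \<in> fst c" "x \<in> fst d" "s = snd c x" using s by (auto simp: E_def)
    then show ?thesis using chart_inv[OF c(1) x(1)] chart_inv[OF d(1) x(2)] by (simp add: \<tau>_def)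
  qed
  have \<tau>u: "\<tau> (snd c m) = snd d m" using chart_inv[OF c] by (simp add: \<tau>_def)
  have du: "snd d m \<in> chart_image d" using d by blast
  have "((\<lambda>s. par d (\<tau> s)) has_derivative (\<lambda>v. frechet_derivative (par d) (at (snd d m)) (frechet_derivative \<tau> (at (snd c m)) v))) (at (snd c m))"
    by (rule has_derivative_compose[OF smooth_on_has_derivative[OF sm uE]]) (simp only: \<tau>u Q.f_deriv[OF du])
  then have "(par c has_derivative (\<lambda>v. frechet_derivative (par d) (at (snd d m)) (frechet_derivative \<tau> (at (snd c m)) v))) (at (snd c m))"
    by (rule has_derivative_transform_within_open[OF _ oE uE eq])
  from frechet_derivative_at[OF this]
  have "mcc c (snd c m) v = mcc d (snd d m) (frechet_derivative \<tau> (at (snd c m)) v)" for v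
    unfolding P.mc_def Q.mc_def F_par[OF c] F_par[OF d] by (simp add: fun_eq_iff)
  then show ?thesis by blast
qed

text \<open>All charts at a point give the same plane (\<open>plane_eq\<close>).\<close>

definition plane :: "'a \<Rightarrow> mat2_pair set" where
  "plane m = (let c = SOME c. c \<in> \<A> \<and> m \<in> fst c in range (mcc c (snd c m)))"

lemma plane_eq: assumes c: "c \<in> \<A>" "m \<in> fst c" shows "plane m = range (mcc c (snd c m))"
proof -
  define d where "d = (SOME c. c \<in> \<A> \<and> m \<in> fst c)"
  have d: "d \<in> \<A>" "m \<in> fst d" unfolding d_def using someI[of "\<lambda>c. c \<in> \<A> \<and> m \<in> fst c"] c by blast+
  have "range (mcc d (snd d m)) = range (mcc c (snd c m))"
    using plane_subset[OF c d] plane_subset[OF d c] by blast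
  then show ?thesis unfolding plane_def d_def[symmetric] Let_def .
qed

end

text \<open>The bracket of the entries is multiplied by a scalar when the vector is replaced by another
  one of the same complex line.\<close>

lemma (in surface_patch) commuting_direction_independent:
  assumes u: "u \<in> D" and v: "v \<noteq> 0" and c: "br (fst (mc u v)) (snd (mc u v)) = 0"
  shows "br (fst (mc u w)) (snd (mc u w)) = 0"
proof -
  obtain r s where w: "mc u w = r *\<^sub>R mc u v + s *\<^sub>R JL (mc u v)" using mc_complex_line[OF u v] .
  have c': "br (snd (mc u v)) (fst (mc u v)) = 0" using c br_anti[of "snd (mc u v)"] by simp
  show ?thesis unfolding w JL_def by (simp add: br_linear c c')
qed

text \<open>If both conditions hold, \<open>\<alpha>\<close> and \<open>\<beta>\<close> are proportional with \<open>\<langle>\<alpha>, \<alpha>\<rangle>\<langle>\<beta>, \<beta>\<rangle> = \<langle>\<alpha>, \<beta>\<rangle>\<^sup>2\<close>, so that all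
  products vanish and the plane is degenerate.\<close>

lemma (in surface_patch) not_commuting_and_null:
  assumes u: "u \<in> D" and v: "v \<noteq> 0" and c: "br (fst (mc u v)) (snd (mc u v)) = 0"
    and n: "ip (fst (mc u v)) (fst (mc u v)) = 2 * ip (fst (mc u v)) (snd (mc u v))"
      "ip (snd (mc u v)) (snd (mc u v)) = 2 * ip (fst (mc u v)) (snd (mc u v))"
  shows False
proof -
  define x y where xy: "x = fst (mc u v)" "y = snd (mc u v)"
  have t: "trace x = 0" "trace y = 0" using sl_mc[OF u] by (auto simp: sl_def xy)
  have "br x (br x y) = 0" using c by (simp add: xy br_linear)
  then have "(4 * ip x x) *\<^sub>R y = (4 * ip x y) *\<^sub>R x" using triple_br[OF t(1) t(1) t(2)] by simp
  from arg_cong[OF this, of "ip y"] have "ip x x * ip y y = ip x y * ip x y"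
    by (simp add: linear_ip ip_commute[of y x])
  then have "ip x y = 0" using n by (simp add: xy)
  then have "gL (mc u v) (mc u v) = 0" using n by (simp add: gL_def xy ip_commute[of "snd (mc u v)" "fst (mc u v)"])
  then show False using mc_regular[OF u v] by simp
qed

locale parallel_surface = surface_in_SL2 +
  assumes parallel: "parallel_second_ff \<A> F"
begin

lemma parallel_const:
  assumes "c \<in> \<A>" "u \<in> chart_image c"
  shows "nabla_second_ff (par c) (\<lambda>_. x) (\<lambda>_. y) (\<lambda>_. z) u = 0"
  using parallel local_paramsI[OF assms(1)] assms(2) smooth_on_const unfolding parallel_second_ff_def by blast

definition commuting_at :: "'a \<Rightarrow> bool" where
  "commuting_at m \<longleftrightarrow> (\<forall>z\<in>plane m. br (fst z) (snd z) = 0)"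

lemma commuting_at_chart:
  assumes c: "c \<in> \<A>" "m \<in> fst c" and v: "v \<noteq> 0"
  shows "commuting_at m \<longleftrightarrow> br (fst (mcc c (snd c m) v)) (snd (mcc c (snd c m) v)) = 0"
proof -
  interpret P: surface_patch "chart_image c" "par c" by (rule patch[OF c(1)])
  have u: "snd c m \<in> chart_image c" using c by blast
  show ?thesis unfolding commuting_at_def plane_eq[OF c] using P.commuting_direction_independent[OF u v] by blast
qed

text \<open>Each of the two alternatives is given by equations and is therefore closed. As they exclude
  each other, each is also open.\<close>

lemma commuting_constant:
  assumes m: "m \<in> topspace M" "m' \<in> topspace M"
  shows "commuting_at m = commuting_at m'"
proof (rule constant_if_locally_constant[OF _ m])
  fix c m assume c: "c \<in> \<A>" "m \<in> fst c"
  interpret P: surface_patch "chart_image c" "par c" by (rule patch[OF c(1)])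
  have e1: "axis 1 1 \<noteq> (0::real^2)" by (simp add: axis_eq_0_iff)
  have u: "snd c m \<in> chart_image c" using c by blast
  define x y where "x s = fst (P.mc s (axis 1 1))" "y s = snd (P.mc s (axis 1 1))" for s
  have ct: "isCont x (snd c m)" "isCont y (snd c m)"
    unfolding x_y_def[abs_def]
    using has_derivative_continuous[OF has_derivative_fst[OF P.mc_deriv[OF u]]]
      has_derivative_continuous[OF has_derivative_snd[OF P.mc_deriv[OF u]]] by simp_all
  have com: "commuting_at m' \<longleftrightarrow> br (x (snd c m')) (y (snd c m')) = 0" if "m' \<in> fst c" for m'
    using commuting_at_chart[OF c(1) that e1] by (simp add: x_y_def)
  define n where "n s = (ip (x s) (x s) - 2 * ip (x s) (y s), ip (y s) (y s) - 2 * ip (x s) (y s))" for s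
  have dich: "br (x (snd c m')) (y (snd c m')) = 0 \<longleftrightarrow> n (snd c m') \<noteq> 0" if m': "m' \<in> fst c" for m'
  proof -
    have u': "snd c m' \<in> chart_image c" using m' by blast
    show ?thesis
      using P.pointwise_dichotomy[OF u' parallel_const[OF c(1) u'] e1] P.not_commuting_and_null[OF u' e1]
      by (auto simp: n_def x_y_def zero_prod_def)
  qed
  have br: "isCont (\<lambda>s. br (x s) (y s)) (snd c m)" by (intro br.isCont ct)
  have nc: "isCont n (snd c m)"
    unfolding n_def[abs_def] by (intro isCont_Pair continuous_intros ip.isCont ct)
  have open_nbhd: "\<exists>V. open V \<and> s0 \<in> V \<and> (\<forall>s\<in>V. h s \<noteq> 0)" if "isCont h s0" "h s0 \<noteq> 0" for h :: "real^2 \<Rightarrow> 'b::real_normed_vector" and s0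
  proof -
    have "\<forall>\<^sub>F s in nhds s0. h s \<in> - {0}"
      using that by (intro topological_tendstoD[where f = h]) (auto simp: isCont_def tendsto_at_iff_tendsto_nhds)
    then show ?thesis unfolding eventually_nhds by blast
  qed
  show "\<exists>V. open V \<and> snd c m \<in> V \<and> (\<forall>m'\<in>fst c. snd c m' \<in> V \<longrightarrow> commuting_at m' = commuting_at m)"
  proof (cases "commuting_at m")
    case True
    then show ?thesis using open_nbhd[OF nc] com dich c(2) by (metis (full_types))
  next
    case False
    then show ?thesis using open_nbhd[OF br] com dich c(2) by (metis (full_types))
  qed
qed

end

section \<open>Congruence with the model surfaces\<close>

lemma adj2_mult: "adj2 (A ** B) = adj2 B ** adj2 A" for A B :: mat2
  by (simp add: adj2_def vec_eq_iff forall_2 matrix_matrix_mult_def sum_2 algebra_simps)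

lemma adj2_traceless: "trace X = 0 \<Longrightarrow> adj2 X = - X"
  by (simp add: adj2_def vec_eq_iff forall_2 trace0_22)

lemma commute_Hm_nonzero:
  fixes D :: mat2
  assumes "det D = 1" "D ** Hm = Hm ** D" shows "D$1$1 \<noteq> 0"
proof
  assume "D$1$1 = 0"
  moreover have "D$1$2 = 0" using arg_cong[OF assms(2), of "\<lambda>M. M$1$2"] by (simp add: matrix_matrix_mult_def sum_2)
  ultimately show False using assms(1) by (simp add: det_2)
qed

text \<open>Conjugation by \<open>C\<close> carries the centralizer of \<open>X\<close> to the centralizer of \<open>T\<close>.\<close>

lemma commute_conj:
  fixes X C T D :: mat2
  assumes X: "X ** C = k *\<^sub>R (C ** T)" and C: "det C \<noteq> 0" and k: "k \<noteq> 0" and D: "D ** X = X ** D"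
  shows "(matrix_inv C ** D ** C) ** T = T ** (matrix_inv C ** D ** C)"
proof -
  have XC: "matrix_inv C ** X = k *\<^sub>R (T ** matrix_inv C)"
  proof -
    have "matrix_inv C ** X = matrix_inv C ** ((X ** C) ** matrix_inv C)"
      by (simp only: right_assoc matrix_inv_mat2(2)[OF C] matrix_mul_rid)
    also have "\<dots> = k *\<^sub>R ((matrix_inv C ** C) ** (T ** matrix_inv C))"
      unfolding X by (simp only: mul_linear right_assoc)
    finally show ?thesis by (simp only: matrix_inv_mat2(3)[OF C] matrix_mul_lid)
  qed
  have "k *\<^sub>R ((matrix_inv C ** D ** C) ** T) = matrix_inv C ** (D ** (X ** C))"
    unfolding X by (simp only: mul_linear right_assoc)
  also have "\<dots> = matrix_inv C ** ((D ** X) ** C)" by (simp only: right_assoc)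
  also have "\<dots> = (matrix_inv C ** X) ** (D ** C)" unfolding D by (simp only: right_assoc)
  also have "\<dots> = k *\<^sub>R (T ** (matrix_inv C ** D ** C))" unfolding XC by (simp only: mul_linear right_assoc)
  finally show ?thesis using k by simp
qed

context surface_in_SL2 begin

lemma local_paramsE:
  assumes "(D, f) \<in> local_params \<A> F"
  obtains c where "c \<in> \<A>" "D = chart_image c" "f = par c"
  using assms by (auto simp: local_params_def case_prod_unfold)

lemma totally_geodesicI:
  assumes "\<And>c u x y. c \<in> \<A> \<Longrightarrow> u \<in> chart_image c \<Longrightarrow> surface_patch.sff (par c) u x y = 0"
  shows "totally_geodesic \<A> F"
  unfolding totally_geodesic_def
proof (clarify)
  fix D f and X Y :: "real^2 \<Rightarrow> real^2" and u
  assume lp: "(D, f) \<in> local_params \<A> F" and Y: "smooth_on D Y" and u: "u \<in> D"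
  obtain c where c: "c \<in> \<A>" "D = chart_image c" "f = par c" using local_paramsE[OF lp] .
  interpret P: surface_patch "chart_image c" "par c" by (rule patch[OF c(1)])
  have u': "u \<in> chart_image c" using u c by simp
  show "second_ff f X Y u = 0"
    using P.second_ff_eq[OF u' smooth_on_differentiable[OF Y u], of X] assms[OF c(1) u'] c(3)
    by (simp add: unl.zero_right)
qed

lemma constant_gauss_curvatureI:
  assumes "\<And>c u. c \<in> \<A> \<Longrightarrow> u \<in> chart_image c \<Longrightarrow> gauss_curvature (induced_metric (par c)) u = k"
  shows "constant_gauss_curvature \<A> F k"
  unfolding constant_gauss_curvature_def
proof clarify
  fix D f u assume lp: "(D, f) \<in> local_params \<A> F" and u: "u \<in> D"
  obtain c where "c \<in> \<A>" "D = chart_image c" "f = par c" using local_paramsE[OF lp] .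
  then show "gauss_curvature (induced_metric f) u = k" using assms u by simp
qed

text \<open>Reduces the openness in the model to a linear coordinate near each point.\<close>

lemma congruent_criterion:
  assumes iso: "isometry \<Phi>" and bl: "bounded_linear \<Phi>" and mem: "\<And>m. m \<in> topspace M \<Longrightarrow> \<Phi> (F m) \<in> \<Sigma>"
    and ch: "\<And>c m. c \<in> \<A> \<Longrightarrow> m \<in> fst c \<Longrightarrow> \<exists>\<pi> W. bounded_linear \<pi> \<and> open W \<and> \<Phi> (F m) \<in> W \<and> inj_on \<pi> (\<Sigma> \<inter> W) \<and>
        (\<forall>v. \<pi> (\<Phi> (unl (F m) (mcc c (snd c m) v))) = (0::real^2) \<longrightarrow> v = 0)"
  shows "congruent_to M F \<Sigma>"
proof -
  have "openin (top_of_set \<Sigma>) (\<Phi> ` F ` topspace M)"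
  proof (rule openin_top_of_set_locally)
    show "\<Phi> ` F ` topspace M \<subseteq> \<Sigma>" using mem by blast
    fix x assume "x \<in> \<Phi> ` F ` topspace M"
    then obtain m where m: "m \<in> topspace M" "x = \<Phi> (F m)" by blast
    obtain c where c: "c \<in> \<A>" "m \<in> fst c" using chart_exists[OF m(1)] .
    interpret P: surface_patch "chart_image c" "par c" by (rule patch[OF c(1)])
    define u where "u = snd c m"
    have u: "u \<in> chart_image c" using c by (simp add: u_def)
    have fu: "par c u = F m" unfolding u_def by (rule F_par[OF c])
    obtain \<pi> W where pw: "bounded_linear \<pi>" "open W" "\<Phi> (F m) \<in> W" "inj_on \<pi> (\<Sigma> \<inter> W)"
      "\<forall>v. \<pi> (\<Phi> (unl (F m) (mcc c (snd c m) v))) = (0::real^2) \<longrightarrow> v = 0"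
      using ch[OF c] by (elim exE conjE) (rule that)
    define g where "g s = \<Phi> (par c s)" for s
    have gd: "(g has_derivative (\<lambda>v. \<Phi> (frechet_derivative (par c) (at s) v))) (at s)" if "s \<in> chart_image c" for s
      unfolding g_def[abs_def] by (rule bounded_linear.has_derivative[OF bl P.f_deriv[OF that]])
    have sub: "chart_image c \<subseteq> snd c ` topspace M" using chart_sub[OF c(1)] by blast
    have im: "g ` chart_image c \<subseteq> \<Phi> ` F ` topspace M"
    proof
      fix y assume "y \<in> g ` chart_image c"
      then obtain n where n: "n \<in> fst c" "y = g (snd c n)" by blast
      then have "y = \<Phi> (F n)" unfolding g_def using F_par[OF c(1) n(1)] by simp
      then show "y \<in> \<Phi> ` F ` topspace M" using chart_sub[OF c(1)] n(1) by blast
    qed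
    have cont: "continuous_on (chart_image c) g"
      by (rule has_derivative_continuous_on) (rule has_derivative_at_withinI[OF gd])
    have inj: "v = 0" if "\<pi> (\<Phi> (frechet_derivative (par c) (at u) v)) = 0" for v
    proof -
      have "\<pi> (\<Phi> (unl (F m) (mcc c u v))) = 0" using that by (simp only: P.df_mc[OF u] fu)
      then show ?thesis unfolding u_def by (rule pw(5)[rule_format])
    qed
    have g\<Sigma>: "g ` chart_image c \<subseteq> \<Sigma>" by (rule order_trans[OF im]) (use mem in blast)
    have gW: "g u \<in> W" unfolding g_def fu by (rule pw(3))
    obtain W' where W': "open W'" "g u \<in> W'" "\<Sigma> \<inter> W' \<subseteq> g ` chart_image c"
      using open_immersed_image[OF P.open_D u cont gd[OF u] pw(1) inj g\<Sigma> pw(2) gW pw(4)] .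
    have xg: "x = g u" unfolding m(2) g_def fu ..
    show "\<exists>W. open W \<and> x \<in> W \<and> \<Sigma> \<inter> W \<subseteq> \<Phi> ` F ` topspace M"
      unfolding xg by (intro exI[of _ W'] conjI W'(1,2) order_trans[OF W'(3) im])
  qed
  then show ?thesis unfolding congruent_to_def using iso by blast
qed

end

lemma ip_skew_rotate:
  fixes b :: mat2
  assumes N: "trace N = 0" and a: "trace a = 0" "ip N a = 0"
  shows "ip a (N ** b) = - ip (N ** a) b"
  by (simp add: ip_def orth_rules[OF N a] trace_mat2_linear right_assoc)

text \<open>Swapping the entries is \<open>P\<close>, so this says that \<open>P\<close> maps the plane into its normal space.\<close>

lemma gL_swap_TN:
  assumes N: "trace N = 0" "ip N N = -1" and z: "z \<in> TN N" and w: "w \<in> TN N"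
  shows "gL (prod.swap z) w = 0"
proof -
  define a b where ab: "a = fst z" "b = fst w"
  have za: "z = (a, rho N ** a)" "trace a = 0" "ip N a = 0" and wb: "w = (b, rho N ** b)" "trace b = 0" "ip N b = 0"
    using z w by (simp_all add: TN_iff ab prod_eq_iff)
  have 1: "ip a (N ** b) = - ip (N ** a) b" by (rule ip_skew_rotate[OF N(1) za(2,3)])
  have 2: "ip (N ** a) (N ** b) = ip a b"
    by (simp add: ip_def right_assoc orth_rules[OF N(1) za(2,3)] unit_rules[OF N] mul_linear)
  show ?thesis
    unfolding gL_def za(1) wb(1)
    by (simp add: rho_def mul_linear linear_ip 1 2 sqrt3_mult field_simps)
qed

locale commuting_surface = surface_in_SL2 +
  assumes commuting: "c \<in> \<A> \<Longrightarrow> commuting_patch (chart_image c) (par c)"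
begin

lemma totally_geodesic_commuting: "totally_geodesic \<A> F"
  by (rule totally_geodesicI) (rule commuting_patch.sff_commuting[OF commuting])

lemma flat_commuting: "constant_gauss_curvature \<A> F 0"
  by (rule constant_gauss_curvatureI) (rule commuting_patch.gauss_curvature_commuting[OF commuting])

lemma P_preserves_tangent_commuting: "P_preserves_tangent \<A> F"
  unfolding P_preserves_tangent_def
proof clarify
  fix D f u assume lp: "(D, f) \<in> local_params \<A> F" and u: "u \<in> D"
  obtain c where c: "c \<in> \<A>" "D = chart_image c" "f = par c" using local_paramsE[OF lp] .
  interpret P: commuting_patch "chart_image c" "par c" by (rule commuting[OF c(1)])
  have u': "u \<in> chart_image c" using u c by simp
  obtain X where X: "range (mcc c u) = AX X" using P.axis_plane[OF u'] .
  have tp: "tangent_plane (par c) u = unl (par c u) ` AX X"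
    unfolding P.tangent_plane_mc[OF u'] X[symmetric] by (simp add: image_image)
  have "P_NK (par c u) ` tangent_plane (par c) u = unl (par c u) ` prod.swap ` AX X"
    unfolding tp image_image by (simp only: P_NK_ltr ltr_unl[OF P.f_SL[OF u']])
  moreover have "prod.swap ` AX X = AX X" by (force simp: AX_def)
  ultimately show "P_NK (f u) ` tangent_plane f u = tangent_plane f u" unfolding c(3) tp by (simp only:)
qed

lemma common_axis:
  assumes m0: "m0 \<in> topspace M"
  obtains X where "trace X = 0" "ip X X \<noteq> 0" "\<And>m. m \<in> topspace M \<Longrightarrow> plane m = AX X"
proof -
  obtain c0 where c0: "c0 \<in> \<A>" "m0 \<in> fst c0" using chart_exists[OF m0] .
  have u0: "snd c0 m0 \<in> chart_image c0" using c0 by blast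
  obtain X where X: "trace X = 0" "ip X X \<noteq> 0" "range (mcc c0 (snd c0 m0)) = AX X"
    using commuting_patch.axis_plane[OF commuting[OF c0(1)] u0] .
  have plane0: "plane m0 = AX X" unfolding plane_eq[OF c0] by (rule X(3))
  have "plane m = plane m0" if m: "m \<in> topspace M" for m
  proof (rule constant_if_locally_constant[OF _ m m0])
    fix c m assume c: "c \<in> \<A>" "m \<in> fst c"
    have u: "snd c m \<in> chart_image c" using c by blast
    obtain V Y where V: "open V" "snd c m \<in> V" "V \<subseteq> chart_image c" "trace Y = 0" "ip Y Y \<noteq> 0"
      and VY: "\<And>u. u \<in> V \<Longrightarrow> range (mcc c u) = AX Y"
      by (rule commuting_patch.axis_locally_constant[OF commuting[OF c(1)] u]) (rule that)
    show "\<exists>V. open V \<and> snd c m \<in> V \<and> (\<forall>m'\<in>fst c. snd c m' \<in> V \<longrightarrow> plane m' = plane m)"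
    proof (intro exI conjI ballI impI)
      fix m' assume m': "m' \<in> fst c" "snd c m' \<in> V"
      show "plane m' = plane m" unfolding plane_eq[OF c(1) m'(1)] plane_eq[OF c] VY[OF m'(2)] VY[OF V(2)] ..
    qed (rule V)+
  qed
  then show thesis using that X(1,2) plane0 by simp
qed

definition conj_axis :: "mat2 \<Rightarrow> mat2_pair \<Rightarrow> mat2_pair" where
  "conj_axis X p = (fst p ** X ** adj2 (fst p), snd p ** X ** adj2 (snd p))"

text \<open>The velocity of \<open>A\<close> is \<open>A\<close> times a multiple of \<open>X\<close>, and \<open>X\<close> commutes with itself.\<close>

lemma conj_axis_constant:
  assumes X: "trace X = 0" and planeX: "\<And>m. m \<in> topspace M \<Longrightarrow> plane m = AX X"
    and m: "m \<in> topspace M" "m' \<in> topspace M"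
  shows "conj_axis X (F m) = conj_axis X (F m')"
proof (rule constant_if_zero_derivative[OF _ _ m, where h = "\<lambda>c s. conj_axis X (par c s)" and g = "\<lambda>x. x"])
  fix c u assume c: "c \<in> \<A>" and u: "u \<in> chart_image c"
  interpret P: surface_patch "chart_image c" "par c" by (rule patch[OF c])
  show "((\<lambda>s. conj_axis X (par c s)) has_derivative (\<lambda>_. 0)) (at u)"
  proof -
    obtain n where n: "n \<in> fst c" "u = snd c n" using u by blast
    have pl: "range (mcc c u) = AX X"
      using plane_eq[OF c n(1)] planeX[of n] chart_sub[OF c] n by auto
    define A B where AB: "A = fst (par c u)" "B = snd (par c u)"
    have df: "(par c has_derivative (\<lambda>x. unl (par c u) (mcc c u x))) (at u)"
    proof -
      have "frechet_derivative (par c) (at u) = (\<lambda>x. unl (par c u) (mcc c u x))" by (rule ext) (rule P.df_mc[OF u])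
      then show ?thesis using P.f_deriv[OF u] by (simp only:)
    qed
    have bl: "bounded_linear adj2" by (simp add: linear_conv_bounded_linear[symmetric] linear_adj2)
    note f1 = has_derivative_fst[OF df] and f2 = has_derivative_snd[OF df]
    have conj: "((\<lambda>s. h s ** X ** adj2 (h s)) has_derivative
        (\<lambda>x. h u ** X ** adj2 (h' x) + (h' x ** X) ** adj2 (h u))) (at u)"
      if "(h has_derivative h') (at u)" for h :: "real^2 \<Rightarrow> mat2" and h'
    proof -
      have "((\<lambda>s. h s ** X) has_derivative (\<lambda>x. h' x ** X)) (at u)"
        by (rule bounded_linear.has_derivative[OF mat2_mult.bounded_linear_left that])
      from mat2_mult.FDERIV[OF this bounded_linear.has_derivative[OF bl that]] show ?thesis .
    qed
    have z: "h ** X ** adj2 (h ** Y) + ((h ** Y) ** X) ** adj2 h = 0" if "Y = a *\<^sub>R X" for h Y a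
      using adj2_traceless[OF X] unfolding that
      by (simp add: adj2_mult mul_linear right_assoc linear_cmul[OF linear_adj2])
    have "((\<lambda>s. conj_axis X (par c s)) has_derivative (\<lambda>x.
        (A ** X ** adj2 (A ** fst (mcc c u x)) + ((A ** fst (mcc c u x)) ** X) ** adj2 A,
         B ** X ** adj2 (B ** snd (mcc c u x)) + ((B ** snd (mcc c u x)) ** X) ** adj2 B))) (at u)"
      unfolding conj_axis_def AB using has_derivative_Pair[OF conj[OF f1] conj[OF f2]] by (simp only: unl_def fst_conv snd_conv)
    moreover have "(A ** X ** adj2 (A ** fst (mcc c u x)) + ((A ** fst (mcc c u x)) ** X) ** adj2 A,
         B ** X ** adj2 (B ** snd (mcc c u x)) + ((B ** snd (mcc c u x)) ** X) ** adj2 B) = 0" for x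
    proof -
      have "mcc c u x \<in> AX X" using pl by blast
      then obtain a b where "mcc c u x = (a *\<^sub>R X, b *\<^sub>R X)" by (auto simp: AX_def)
      then show ?thesis by (simp only: fst_conv snd_conv z[OF refl] zero_prod_def)
    qed
    ultimately show ?thesis by (simp only:)
  qed
qed (simp only: F_par)

text \<open>The translation moves the base point to the identity and conjugates the common axis to its
  normal form.\<close>

lemma normalized_position:
  assumes m0: "m0 \<in> topspace M"
  obtains \<Phi> T where "isometry \<Phi>" "bounded_linear \<Phi>" "T \<in> {Hm, Km}" "\<Phi> (F m0) = (mat 1, mat 1)"
    "\<And>m. m \<in> topspace M \<Longrightarrow> det (fst (\<Phi> (F m))) = 1 \<and> det (snd (\<Phi> (F m))) = 1 \<and>
      fst (\<Phi> (F m)) ** T = T ** fst (\<Phi> (F m)) \<and> snd (\<Phi> (F m)) ** T = T ** snd (\<Phi> (F m))"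
    "\<And>c m v. c \<in> \<A> \<Longrightarrow> m \<in> fst c \<Longrightarrow> \<exists>a b.
      \<Phi> (unl (F m) (mcc c (snd c m) v)) = (fst (\<Phi> (F m)) ** (a *\<^sub>R T), snd (\<Phi> (F m)) ** (b *\<^sub>R T)) \<and>
      (a = 0 \<and> b = 0 \<longrightarrow> v = 0)"
proof -
  obtain X where X: "trace X = 0" "ip X X \<noteq> 0" and planeX: "\<And>m. m \<in> topspace M \<Longrightarrow> plane m = AX X"
    by (rule common_axis[OF m0]) (rule that)
  define A0 B0 where AB0: "A0 = fst (F m0)" "B0 = snd (F m0)"
  have det0: "det A0 = 1" "det B0 = 1" using F_SL[OF m0] by (auto simp: AB0 SL2xSL2_def)
  obtain C k T where C: "det C \<noteq> 0" "k \<noteq> 0" "T \<in> {Hm, Km}" "X ** C = k *\<^sub>R (C ** T)"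
    using traceless_normal_form[OF X(1,2)] .
  define \<Phi> where "\<Phi> p = (matrix_inv C ** matrix_inv A0 ** fst p ** C, matrix_inv C ** matrix_inv B0 ** snd p ** C)" for p :: mat2_pair
  have det_inv: "det (matrix_inv Y) * det Y = 1" if "det Y \<noteq> 0" for Y :: mat2
    using matrix_inv_mat2(3)[OF that] by (metis det_I det_mul)
  have dets: "det (matrix_inv C ** matrix_inv A0) * det C = 1" "det (matrix_inv C ** matrix_inv B0) * det C = 1"
    using det_inv[of A0] det_inv[of B0] det_inv[OF C(1)] det0 by (simp_all add: det_mul)
  have iso: "isometry \<Phi>" unfolding \<Phi>_def[abs_def] by (rule isometry_translation[OF dets])
  have bl: "bounded_linear \<Phi>" unfolding \<Phi>_def[abs_def] by (rule bounded_linear_unl_mult)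
  have comm: "matrix_inv Y0 ** Y ** X = X ** (matrix_inv Y0 ** Y)"
    if "det Y0 = 1" "det Y = 1" "Y ** X ** adj2 Y = Y0 ** X ** adj2 Y0" for Y Y0 :: mat2
  proof -
    have i: "adj2 Y ** Y = mat 1" "matrix_inv Y0 ** Y0 = mat 1" "adj2 Y0 = matrix_inv Y0"
      using matrix_inv_mat2(3)[of Y] matrix_inv_mat2(3)[of Y0] matrix_inv_SL2 that by auto
    have "matrix_inv Y0 ** Y ** X = matrix_inv Y0 ** ((Y ** X ** adj2 Y) ** Y)"
      by (simp only: right_assoc i matrix_mul_rid)
    also have "\<dots> = (matrix_inv Y0 ** Y0) ** (X ** (adj2 Y0 ** Y))" unfolding that(3) by (simp only: right_assoc)
    finally show ?thesis by (simp only: i matrix_mul_lid)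
  qed
  have E: "det (fst (\<Phi> (F m))) = 1" "det (snd (\<Phi> (F m))) = 1" "fst (\<Phi> (F m)) ** T = T ** fst (\<Phi> (F m))"
    "snd (\<Phi> (F m)) ** T = T ** snd (\<Phi> (F m))" if m: "m \<in> topspace M" for m
  proof -
    have dm: "det (fst (F m)) = 1" "det (snd (F m)) = 1" using F_SL[OF m] by (auto simp: SL2xSL2_def)
    show "det (fst (\<Phi> (F m))) = 1" "det (snd (\<Phi> (F m))) = 1"
      using dets dm by (simp_all add: \<Phi>_def det_mul)
    have "fst (F m) ** X ** adj2 (fst (F m)) = A0 ** X ** adj2 A0" "snd (F m) ** X ** adj2 (snd (F m)) = B0 ** X ** adj2 B0"
      using conj_axis_constant[OF X(1) planeX m m0] by (simp_all add: conj_axis_def AB0)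
    then have "matrix_inv A0 ** fst (F m) ** X = X ** (matrix_inv A0 ** fst (F m))"
      "matrix_inv B0 ** snd (F m) ** X = X ** (matrix_inv B0 ** snd (F m))"
      by (auto intro!: comm det0 dm)
    from this[THEN commute_conj[OF C(4,1,2)]]
    show "fst (\<Phi> (F m)) ** T = T ** fst (\<Phi> (F m))" "snd (\<Phi> (F m)) ** T = T ** snd (\<Phi> (F m))"
      by (simp_all add: \<Phi>_def matrix_mul_assoc)
  qed
  have dirs: "\<exists>a b. \<Phi> (unl (F m) (mcc c (snd c m) v)) = (fst (\<Phi> (F m)) ** (a *\<^sub>R T), snd (\<Phi> (F m)) ** (b *\<^sub>R T)) \<and>
      (a = 0 \<and> b = 0 \<longrightarrow> v = 0)" if c: "c \<in> \<A>" "m \<in> fst c" for c m v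
  proof -
    interpret P: surface_patch "chart_image c" "par c" by (rule patch[OF c(1)])
    have u: "snd c m \<in> chart_image c" using c by blast
    have "mcc c (snd c m) v \<in> AX X" using plane_eq[OF c] planeX[of m] chart_sub[OF c(1)] c(2) by blast
    then obtain a b where ab: "mcc c (snd c m) v = (a *\<^sub>R X, b *\<^sub>R X)" by (auto simp: AX_def)
    have "\<Phi> (unl (F m) (mcc c (snd c m) v)) = (fst (\<Phi> (F m)) ** ((a * k) *\<^sub>R T), snd (\<Phi> (F m)) ** ((b * k) *\<^sub>R T))"
      unfolding ab \<Phi>_def unl_def by (simp add: mul_linear right_assoc C(4))
    moreover have "v = 0" if "a * k = 0 \<and> b * k = 0"
      using that C(2) P.mc_eq_0[OF u, of v] by (simp add: ab zero_prod_def)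
    ultimately show ?thesis by blast
  qed
  have base: "\<Phi> (F m0) = (mat 1, mat 1)"
  proof -
    have "matrix_inv C ** matrix_inv Y ** Y ** C = mat 1" if "det Y = 1" for Y :: mat2
    proof -
      have "matrix_inv C ** matrix_inv Y ** Y ** C = matrix_inv C ** ((matrix_inv Y ** Y) ** C)" by (simp only: right_assoc)
      then show ?thesis using that by (simp add: matrix_inv_mat2(3) C(1))
    qed
    then show ?thesis using det0 by (simp add: \<Phi>_def AB0)
  qed
  show thesis by (rule that[OF iso bl C(3) base _ dirs]) (simp add: E)
qed

text \<open>The centralizer of the rotation generator in \<open>SL(2,\<real>)\<close> is the rotation group. The centralizer
  of the diagonal generator has two components, and connectedness keeps the surface in the one of
  the identity.\<close>

lemma congruent_Sigma1_or_Sigma2: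
  assumes ne: "topspace M \<noteq> {}"
  shows "congruent_to M F Sigma1 \<or> congruent_to M F Sigma2"
proof -
  obtain m0 where m0: "m0 \<in> topspace M" using ne by blast
  obtain \<Phi> T where iso: "isometry \<Phi>" and bl: "bounded_linear \<Phi>" and T': "T \<in> {Hm, Km}"
    and base: "\<Phi> (F m0) = (mat 1, mat 1)"
    and E': "\<And>m. m \<in> topspace M \<Longrightarrow> det (fst (\<Phi> (F m))) = 1 \<and> det (snd (\<Phi> (F m))) = 1 \<and>
      fst (\<Phi> (F m)) ** T = T ** fst (\<Phi> (F m)) \<and> snd (\<Phi> (F m)) ** T = T ** snd (\<Phi> (F m))"
    and dirs: "\<And>c m v. c \<in> \<A> \<Longrightarrow> m \<in> fst c \<Longrightarrow> \<exists>a b.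
      \<Phi> (unl (F m) (mcc c (snd c m) v)) = (fst (\<Phi> (F m)) ** (a *\<^sub>R T), snd (\<Phi> (F m)) ** (b *\<^sub>R T)) \<and>
      (a = 0 \<and> b = 0 \<longrightarrow> v = 0)"
    by (rule normalized_position[OF m0]) (rule that)
  have E: "det (fst (\<Phi> (F m))) = 1" "det (snd (\<Phi> (F m))) = 1" "fst (\<Phi> (F m)) ** T = T ** fst (\<Phi> (F m))"
    "snd (\<Phi> (F m)) ** T = T ** snd (\<Phi> (F m))" if "m \<in> topspace M" for m using E'[OF that] by blast+
  have congr: "congruent_to M F \<Sigma>" if mem: "\<And>m. m \<in> topspace M \<Longrightarrow> \<Phi> (F m) \<in> \<Sigma>"
    and ch: "\<And>s. s \<in> \<Sigma> \<Longrightarrow> \<exists>\<pi> W. bounded_linear \<pi> \<and> open W \<and> s \<in> W \<and> inj_on \<pi> (\<Sigma> \<inter> W) \<and>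
      (\<forall>a b. \<pi> (fst s ** (a *\<^sub>R T), snd s ** (b *\<^sub>R T)) = (0::real^2) \<longrightarrow> a = 0 \<and> b = 0)" for \<Sigma>
  proof (rule congruent_criterion[OF iso bl mem])
    fix c m assume c: "c \<in> \<A>" "m \<in> fst c"
    then have "\<Phi> (F m) \<in> \<Sigma>" using mem chart_sub by blast
    from ch[OF this] obtain \<pi> W where w: "bounded_linear \<pi>" "open W" "\<Phi> (F m) \<in> W" "inj_on \<pi> (\<Sigma> \<inter> W)"
      "\<forall>a b. \<pi> (fst (\<Phi> (F m)) ** (a *\<^sub>R T), snd (\<Phi> (F m)) ** (b *\<^sub>R T)) = (0::real^2) \<longrightarrow> a = 0 \<and> b = 0"
      by (elim exE conjE) (rule that)
    have "v = 0" if v: "\<pi> (\<Phi> (unl (F m) (mcc c (snd c m) v))) = 0" for v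
    proof -
      obtain a b where ab: "\<Phi> (unl (F m) (mcc c (snd c m) v)) = (fst (\<Phi> (F m)) ** (a *\<^sub>R T), snd (\<Phi> (F m)) ** (b *\<^sub>R T))"
        "a = 0 \<and> b = 0 \<longrightarrow> v = 0" using dirs[OF c, of v] by (elim exE conjE) (rule that)
      show ?thesis using ab(2) w(5) v unfolding ab(1) by blast
    qed
    then show "\<exists>\<pi> W. bounded_linear \<pi> \<and> open W \<and> \<Phi> (F m) \<in> W \<and> inj_on \<pi> (\<Sigma> \<inter> W) \<and>
        (\<forall>v. \<pi> (\<Phi> (unl (F m) (mcc c (snd c m) v))) = (0::real^2) \<longrightarrow> v = 0)" using w(1-4) by blast
  qed
  show ?thesis
  proof (cases "T = Km")
    case True
    have mem: "\<Phi> (F m) \<in> Sigma2" if m: "m \<in> topspace M" for m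
    proof -
      obtain x where x: "fst (\<Phi> (F m)) = rot x" using commute_Km[OF E(1)[OF m]] E(3)[OF m] True by blast
      obtain y where y: "snd (\<Phi> (F m)) = rot y" using commute_Km[OF E(2)[OF m]] E(4)[OF m] True by blast
      show ?thesis unfolding Sigma2_eq using x y by (auto simp: prod_eq_iff)
    qed
    have "congruent_to M F Sigma2"
      by (rule congr, erule mem, erule Sigma2_chart, unfold True, blast)
    then show ?thesis ..
  next
    case False
    then have T: "T = Hm" using T' by blast
    have nz: "fst (\<Phi> (F m)) $ 1 $ 1 \<noteq> 0" "snd (\<Phi> (F m)) $ 1 $ 1 \<noteq> 0" if m: "m \<in> topspace M" for m
      using commute_Hm_nonzero[OF E(1)[OF m]] commute_Hm_nonzero[OF E(2)[OF m]] E(3,4)[OF m] T by auto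
    \<comment> \<open>the sign of a diagonal entry is locally constant because the entry does not vanish\<close>
    have pos_const: "(l (\<Phi> (F m)) > 0) = (l (\<Phi> (F m0)) > 0)"
      if m: "m \<in> topspace M" and l: "bounded_linear l" "\<And>m. m \<in> topspace M \<Longrightarrow> l (\<Phi> (F m)) \<noteq> 0"
      for m and l :: "mat2_pair \<Rightarrow> real"
    proof (rule constant_if_locally_constant[OF _ m m0, of "\<lambda>m. l (\<Phi> (F m)) > 0"])
      fix c m assume c: "c \<in> \<A>" "m \<in> fst c"
      interpret P: surface_patch "chart_image c" "par c" by (rule patch[OF c(1)])
      have u: "snd c m \<in> chart_image c" using c by blast
      define h where "h s = l (\<Phi> (par c s))" for s
      have "isCont h (snd c m)"
        unfolding h_def[abs_def]
        by (rule has_derivative_continuous[OF bounded_linear.has_derivative[OF l(1) bounded_linear.has_derivative[OF bl P.f_deriv[OF u]]]])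
      then have lim: "(h \<longlongrightarrow> h (snd c m)) (nhds (snd c m))" by (simp add: isCont_def tendsto_at_iff_tendsto_nhds)
      have hm: "h (snd c m') = l (\<Phi> (F m'))" if "m' \<in> fst c" for m' unfolding h_def F_par[OF c(1) that] ..
      have "h (snd c m) \<noteq> 0" using l(2) hm[OF c(2)] chart_sub[OF c(1)] c(2) by auto
      then consider "h (snd c m) > 0" | "h (snd c m) < 0" by linarith
      then have "\<forall>\<^sub>F s in nhds (snd c m). (0 < h s) = (0 < h (snd c m))"
      proof cases
        case 1 then show ?thesis using order_tendstoD(1)[OF lim 1] by (auto elim: eventually_mono)
      next
        case 2 then show ?thesis using order_tendstoD(2)[OF lim 2] by (auto elim: eventually_mono)
      qed
      then obtain V where V: "open V" "snd c m \<in> V" "\<And>s. s \<in> V \<Longrightarrow> (0 < h s) = (0 < h (snd c m))"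
        unfolding eventually_nhds by blast
      show "\<exists>V. open V \<and> snd c m \<in> V \<and> (\<forall>m'\<in>fst c. snd c m' \<in> V \<longrightarrow> (0 < l (\<Phi> (F m'))) = (0 < l (\<Phi> (F m))))"
      proof (intro exI conjI ballI impI)
        fix m' assume m': "m' \<in> fst c" "snd c m' \<in> V"
        show "(0 < l (\<Phi> (F m'))) = (0 < l (\<Phi> (F m)))" using V(3)[OF m'(2)] unfolding hm[OF m'(1)] hm[OF c(2)] .
      qed (rule V)+
    qed
    have mem: "\<Phi> (F m) \<in> Sigma1" if m: "m \<in> topspace M" for m
    proof -
      have l: "bounded_linear (\<lambda>p::mat2_pair. fst p $ 1 $ 1)" "bounded_linear (\<lambda>p::mat2_pair. snd p $ 1 $ 1)"
        unfolding linear_conv_bounded_linear[symmetric] by (auto simp: linear_iff)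
      have "fst (\<Phi> (F m)) $ 1 $ 1 > 0" "snd (\<Phi> (F m)) $ 1 $ 1 > 0"
        using pos_const[OF m l(1) nz(1)] pos_const[OF m l(2) nz(2)] by (simp_all add: base mat_def)
      then have "fst (\<Phi> (F m)) = exp_diag (ln (fst (\<Phi> (F m)) $ 1 $ 1))" "snd (\<Phi> (F m)) = exp_diag (ln (snd (\<Phi> (F m)) $ 1 $ 1))"
        using commute_Hm[OF E(1)[OF m]] commute_Hm[OF E(2)[OF m]] E(3,4)[OF m] T by auto
      then show ?thesis unfolding Sigma1_eq by (metis (mono_tags, lifting) mem_Collect_eq prod.collapse)
    qed
    have "congruent_to M F Sigma1"
      by (rule congr, erule mem, erule Sigma1_chart, unfold T, blast)
    then show ?thesis ..
  qed
qed

end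

locale null_surface = surface_in_SL2 +
  assumes null: "c \<in> \<A> \<Longrightarrow> null_patch (chart_image c) (par c)"
begin

abbreviation gm :: "'a chart \<Rightarrow> real^2 \<Rightarrow> mat2" where "gm c \<equiv> null_patch.N (par c)"

lemma totally_geodesic_null: "totally_geodesic \<A> F"
  by (rule totally_geodesicI) (rule null_patch.sff_and_umb_zero(1)[OF null])

lemma constant_curvature_null: "constant_gauss_curvature \<A> F (- 4 / 3)"
  by (rule constant_gauss_curvatureI) (rule null_patch.gauss_curvature_null[OF null])

lemma P_tangent_to_normal_null: "P_tangent_to_normal \<A> F"
  unfolding P_tangent_to_normal_def
proof (rule ballI, unfold case_prod_unfold, rule ballI)
  fix p u assume lp: "p \<in> local_params \<A> F" and u: "u \<in> fst p"
  obtain c where c: "c \<in> \<A>" "fst p = chart_image c" "snd p = par c"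
    using local_paramsE[of "fst p" "snd p"] lp by auto
  interpret P: null_patch "chart_image c" "par c" by (rule null[OF c(1)])
  have u': "u \<in> chart_image c" using u c by simp
  show "P_NK (snd p u) ` tangent_plane (snd p) u \<subseteq> normal_space (snd p) u"
  proof (rule image_subsetI)
    fix w assume w: "w \<in> tangent_plane (snd p) u"
    obtain x where x: "w = unl (par c u) (mcc c u x)" using w unfolding c(3) P.tangent_plane_mc[OF u'] by blast
    have "P_NK (par c u) w = unl (par c u) (prod.swap (mcc c u x))"
      unfolding x by (simp only: P_NK_ltr ltr_unl[OF P.f_SL[OF u']])
    moreover have "sl (prod.swap (mcc c u x))" using P.sl_mc[OF u', of x] by (simp add: sl_def)
    moreover have "gL (prod.swap (mcc c u x)) (mcc c u y) = 0" for y
      by (rule gL_swap_TN[OF P.N_unit[OF u'] P.mc_TN[OF u'] P.mc_TN[OF u']])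
    ultimately show "P_NK (snd p u) w \<in> normal_space (snd p) u"
      unfolding c(3) using P.normal_space_unl[OF u'] by (simp only:) blast
  qed
qed

text \<open>Defined from the tangent plane alone and hence the same in all charts; the next lemma shows
  that the set has a single element.\<close>

definition frames :: "'a \<Rightarrow> mat2_pair set" where
  "frames m = {unl (F m) (rho (nu z), rhoc (nu z)) | z. z \<in> plane m \<and> z \<noteq> 0}"

lemma frames_chart:
  assumes c: "c \<in> \<A>" "m \<in> fst c"
  shows "frames m = {unl (F m) (rho (gm c (snd c m)), rhoc (gm c (snd c m)))}"
proof -
  interpret P: null_patch "chart_image c" "par c" by (rule null[OF c(1)])
  have u: "snd c m \<in> chart_image c" using c by blast
  have nuz: "nu z = P.N (snd c m)" if z: "z \<in> plane m" "z \<noteq> 0" for z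
  proof -
    obtain v where v: "z = mcc c (snd c m) v" using z(1) unfolding plane_eq[OF c] by blast
    have v0: "v \<noteq> 0"
    proof
      assume "v = 0"
      then have "z = 0" by (simp only: v P.mc_zero[OF u])
      then show False using z(2) by blast
    qed
    have "ip (fst z) (fst z) \<noteq> 0" using P.al_regular[OF u v0] unfolding v P.al_def .
    then show ?thesis by (rule nu_TN[OF P.N_unit[OF u], rotated]) (unfold v, rule P.mc_TN[OF u])
  qed
  define e where "e = mcc c (snd c m) (axis 1 1)"
  have e: "e \<in> plane m" "e \<noteq> 0"
    unfolding plane_eq[OF c] e_def using P.mc_eq_0[OF u] P.e1 by blast+
  have "nu ` (plane m - {0}) = {P.N (snd c m)}"
  proof
    show "nu ` (plane m - {0}) \<subseteq> {P.N (snd c m)}" using nuz by (intro image_subsetI) simp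
    show "{P.N (snd c m)} \<subseteq> nu ` (plane m - {0})" using e nuz[OF e] by (intro subsetI image_eqI[of _ _ e]) simp_all
  qed
  moreover have "frames m = (\<lambda>n. unl (F m) (rho n, rhoc n)) ` nu ` (plane m - {0})"
    unfolding frames_def by blast
  ultimately show ?thesis by (simp only: image_insert image_empty)
qed

lemma frame_constant_global:
  assumes m0: "m0 \<in> topspace M"
  obtains A0 B0 where "det A0 = 1" "det B0 = 1"
    "\<And>c m. c \<in> \<A> \<Longrightarrow> m \<in> fst c \<Longrightarrow> fst (F m) ** rho (gm c (snd c m)) = A0"
    "\<And>c m. c \<in> \<A> \<Longrightarrow> m \<in> fst c \<Longrightarrow> snd (F m) ** rhoc (gm c (snd c m)) = B0"
proof -
  have const: "frames m = frames m0" if m: "m \<in> topspace M" for m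
  proof (rule constant_if_zero_derivative[OF _ _ m m0, where g = "\<lambda>x. {x}" and
        h = "\<lambda>c s. unl (par c s) (rho (gm c s), rhoc (gm c s))"])
    fix c u assume "c \<in> \<A>" "u \<in> chart_image c"
    then show "((\<lambda>s. unl (par c s) (rho (gm c s), rhoc (gm c s))) has_derivative (\<lambda>_. 0)) (at u)"
      by (rule null_patch.frame_constant[OF null])
  next
    fix c m assume c: "c \<in> \<A>" "m \<in> fst c"
    show "frames m = {unl (par c (snd c m)) (rho (gm c (snd c m)), rhoc (gm c (snd c m)))}"
      unfolding F_par[OF c] by (rule frames_chart[OF c])
  qed
  obtain c0 where c0: "c0 \<in> \<A>" "m0 \<in> fst c0" using chart_exists[OF m0] .
  obtain A0 B0 where AB: "frames m0 = {(A0, B0)}" using frames_chart[OF c0] by (metis surj_pair)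
  have frame: "fst (F m) ** rho (gm c (snd c m)) = A0" "snd (F m) ** rhoc (gm c (snd c m)) = B0"
    if c: "c \<in> \<A>" "m \<in> fst c" for c m
  proof -
    have "m \<in> topspace M" using chart_sub[OF c(1)] c(2) by blast
    then have "unl (F m) (rho (gm c (snd c m)), rhoc (gm c (snd c m))) = (A0, B0)"
      using const[of m] unfolding AB frames_chart[OF c] by simp
    then show "fst (F m) ** rho (gm c (snd c m)) = A0" "snd (F m) ** rhoc (gm c (snd c m)) = B0"
      by (simp_all add: unl_def)
  qed
  have det0: "det A0 = 1" "det B0 = 1"
  proof -
    interpret P: null_patch "chart_image c0" "par c0" by (rule null[OF c0(1)])
    have u: "snd c0 m0 \<in> chart_image c0" using c0 by blast
    have "det (fst (F m0)) = 1" "det (snd (F m0)) = 1" using F_SL[OF m0] by (auto simp: SL2xSL2_def)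
    then show "det A0 = 1" "det B0 = 1"
      unfolding frame[OF c0, symmetric] det_mul using rho_rhoc(3,4)[OF P.N_unit[OF u]] by simp_all
  qed
  then show thesis using frame by (rule that)
qed

text \<open>In the moved surface the matrix \<open>Y\<close> of the model is \<open>- N\<close>.\<close>

lemma congruent_Sigma3:
  assumes m0: "m0 \<in> topspace M"
  shows "congruent_to M F Sigma3"
proof -
  obtain A0 B0 where det0: "det A0 = 1" "det B0 = 1"
    and frame: "\<And>c m. c \<in> \<A> \<Longrightarrow> m \<in> fst c \<Longrightarrow> fst (F m) ** rho (gm c (snd c m)) = A0"
      "\<And>c m. c \<in> \<A> \<Longrightarrow> m \<in> fst c \<Longrightarrow> snd (F m) ** rhoc (gm c (snd c m)) = B0"
    by (rule frame_constant_global[OF m0]) (rule that)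
  define \<Phi> where "\<Phi> p = (matrix_inv A0 ** fst p ** mat 1, matrix_inv B0 ** snd p ** mat 1)" for p :: mat2_pair
  have det_inv: "det (matrix_inv Y) * det Y = 1" if "det Y \<noteq> 0" for Y :: mat2
    using matrix_inv_mat2(3)[OF that] by (metis det_I det_mul)
  have iso: "isometry \<Phi>" unfolding \<Phi>_def[abs_def]
    using det_inv[of A0] det_inv[of B0] det0 by (intro isometry_translation) simp_all
  have bl: "bounded_linear \<Phi>" unfolding \<Phi>_def[abs_def] by (rule bounded_linear_unl_mult)
  have model: "\<Phi> (F m) = (rhoc (gm c (snd c m)), rho (gm c (snd c m)))"
    if c: "c \<in> \<A>" "m \<in> fst c" for c m
  proof -
    interpret P: null_patch "chart_image c" "par c" by (rule null[OF c(1)])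
    have u: "snd c m \<in> chart_image c" using c by blast
    note rr = rho_rhoc(1,2)[OF P.N_unit[OF u]]
    have "fst (F m) = A0 ** rhoc (P.N (snd c m))" "snd (F m) = B0 ** rho (P.N (snd c m))"
      unfolding frame[OF c, symmetric] by (simp_all add: right_assoc rr)
    moreover have "matrix_inv A0 ** A0 = mat 1" "matrix_inv B0 ** B0 = mat 1"
      using det0 by (simp_all add: matrix_inv_mat2(3))
    ultimately show ?thesis by (simp add: \<Phi>_def matrix_mul_assoc)
  qed
  have rho_neg: "rho (- N) = rhoc N" "rhoc (- N) = rho N" for N by (simp_all add: rho_def rhoc_def)
  show ?thesis
  proof (rule congruent_criterion[OF iso bl])
    fix m assume m: "m \<in> topspace M"
    obtain c where c: "c \<in> \<A>" "m \<in> fst c" using chart_exists[OF m] .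
    interpret P: null_patch "chart_image c" "par c" by (rule null[OF c(1)])
    have u: "snd c m \<in> chart_image c" using c by blast
    show "\<Phi> (F m) \<in> Sigma3"
      unfolding Sigma3_eq model[OF c]
      by (rule CollectI, rule exI[of _ "- P.N (snd c m)"])
        (use P.N_unit[OF u] in \<open>simp add: rho_neg trace_mat2_linear linear_ip\<close>)
  next
    fix c m assume c: "c \<in> \<A>" "m \<in> fst c"
    interpret P: null_patch "chart_image c" "par c" by (rule null[OF c(1)])
    define u where "u = snd c m"
    have u: "u \<in> chart_image c" using c by (simp add: u_def)
    have Y: "trace (- P.N u) = 0" "ip (- P.N u) (- P.N u) = -1"
      using P.N_unit[OF u] by (simp_all add: trace_mat2_linear linear_ip)
    obtain \<pi> W where w: "bounded_linear \<pi>" "open W" "(rho (- P.N u), rhoc (- P.N u)) \<in> W" "inj_on \<pi> (Sigma3 \<inter> W)"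
      and wX: "\<And>X. trace X = 0 \<Longrightarrow> ip (- P.N u) X = 0 \<Longrightarrow> \<pi> ((sqrt 3 / 2) *\<^sub>R X, - ((sqrt 3 / 2) *\<^sub>R X)) = (0::real^2) \<Longrightarrow> X = 0"
      by (rule Sigma3_chart[OF Y]) (rule that)
    have fu: "par c u = F m" unfolding u_def by (rule F_par[OF c])
    have vel: "\<Phi> (unl (F m) (mcc c u v)) = ((sqrt 3 / 2) *\<^sub>R (- P.dN u v), - ((sqrt 3 / 2) *\<^sub>R (- P.dN u v)))" for v
    proof -
      have "((\<lambda>s. \<Phi> (par c s)) has_derivative (\<lambda>v. \<Phi> (unl (par c u) (mcc c u v)))) (at u)"
        using bounded_linear.has_derivative[OF bl P.f_deriv[OF u]] by (simp only: P.df_mc[OF u])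
      moreover have "((\<lambda>s. \<Phi> (par c s)) has_derivative (\<lambda>v. (- ((sqrt 3 / 2) *\<^sub>R P.dN u v), (sqrt 3 / 2) *\<^sub>R P.dN u v))) (at u)"
      proof (rule P.has_derivative_on_D_cong[OF _ u])
        show "((\<lambda>s. (rhoc (P.N s), rho (P.N s))) has_derivative (\<lambda>v. (- ((sqrt 3 / 2) *\<^sub>R P.dN u v), (sqrt 3 / 2) *\<^sub>R P.dN u v))) (at u)"
          unfolding rho_def rhoc_def by (rule derivative_eq_intros P.N_deriv[OF u] refl)+ auto
        fix s assume "s \<in> chart_image c"
        then obtain n where n: "n \<in> fst c" "s = snd c n" by blast
        show "(rhoc (P.N s), rho (P.N s)) = \<Phi> (par c s)"
          using model[OF c(1) n(1)] unfolding n(2) F_par[OF c(1) n(1)] by (rule sym)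
      qed
      ultimately have "(\<lambda>v. \<Phi> (unl (par c u) (mcc c u v))) = (\<lambda>v. (- ((sqrt 3 / 2) *\<^sub>R P.dN u v), (sqrt 3 / 2) *\<^sub>R P.dN u v))"
        by (rule has_derivative_unique)
      from fun_cong[OF this, of v] show ?thesis unfolding fu by simp
    qed
    have inj: "v = 0" if v: "\<pi> (\<Phi> (unl (F m) (mcc c u v))) = 0" for v
    proof -
      have "- P.dN u v = 0"
      proof (rule wX)
        show "trace (- P.dN u v) = 0" "ip (- P.N u) (- P.dN u v) = 0"
          using P.dN_orth[OF u, of v] by (simp_all add: trace_mat2_linear linear_ip)
        show "\<pi> ((sqrt 3 / 2) *\<^sub>R (- P.dN u v), - ((sqrt 3 / 2) *\<^sub>R (- P.dN u v))) = 0"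
          using v unfolding vel .
      qed
      then have e: "P.N u ** P.al u v = (1/sqrt 3) *\<^sub>R P.al u v" using P.dN_formula[OF u, of v] by simp
      have "- P.al u v = P.N u ** (P.N u ** P.al u v)" by (simp add: unit_rules[OF P.N_unit[OF u]])
      also have "\<dots> = (1/3) *\<^sub>R P.al u v" unfolding e mul_linear by (simp add: e)
      finally have "(4/3) *\<^sub>R P.al u v = 0" by (simp add: vec_eq_iff)
      then have "mcc c u v = 0" by (simp add: P.mc_al[OF u] mul_linear zero_prod_def)
      then show ?thesis by (rule P.mc_eq_0[OF u])
    qed
    have "\<Phi> (F m) \<in> W" using w(3) unfolding model[OF c] rho_neg u_def .
    then show "\<exists>\<pi> W. bounded_linear \<pi> \<and> open W \<and> \<Phi> (F m) \<in> W \<and> inj_on \<pi> (Sigma3 \<inter> W) \<and>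
        (\<forall>v. \<pi> (\<Phi> (unl (F m) (mcc c (snd c m) v))) = (0::real^2) \<longrightarrow> v = 0)"
      using w(1,2,4) inj unfolding u_def by blast
  qed
qed

end

context parallel_surface begin

lemma commuting_or_null:
  assumes "topspace M \<noteq> {}"
  obtains "commuting_surface M \<A> F" | "null_surface M \<A> F"
proof -
  obtain m0 where m0: "m0 \<in> topspace M" using assms by blast
  show thesis
  proof (cases "commuting_at m0")
    case True
    have "commuting_surface M \<A> F"
    proof (rule commuting_surface.intro[OF surface_in_SL2_axioms], rule commuting_surface_axioms.intro)
      fix c assume c: "c \<in> \<A>"
      show "commuting_patch (chart_image c) (par c)"
      proof (rule commuting_patch.intro[OF patch[OF c]], unfold_locales)
        fix u v assume u: "u \<in> chart_image c" and v: "v \<noteq> (0::real^2)"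
        obtain m where m: "m \<in> fst c" "u = snd c m" using u by blast
        have "m \<in> topspace M" using chart_sub[OF c] m by blast
        from commuting_constant[OF this m0] True have "commuting_at m" by simp
        then show "br (fst (mcc c u v)) (snd (mcc c u v)) = 0" using commuting_at_chart[OF c m(1) v] m(2) by simp
      qed
    qed
    then show thesis by (rule that(1))
  next
    case False
    have np: "null_patch (chart_image c) (par c)" if c: "c \<in> \<A>" for c
    proof (rule null_patch.intro[OF patch[OF c]], unfold_locales)
      fix u x y z assume "u \<in> chart_image c"
      then show "nabla_second_ff (par c) (\<lambda>_. x) (\<lambda>_. y) (\<lambda>_. z) u = 0" by (rule parallel_const[OF c])
    next
      fix u v assume u: "u \<in> chart_image c" and v: "v \<noteq> (0::real^2)"
      interpret P: surface_patch "chart_image c" "par c" by (rule patch[OF c])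
      obtain m where m: "m \<in> fst c" "u = snd c m" using u by blast
      have "m \<in> topspace M" using chart_sub[OF c] m by blast
      from commuting_constant[OF this m0] False have "\<not> commuting_at m" by simp
      then have "br (fst (mcc c u v)) (snd (mcc c u v)) \<noteq> 0" using commuting_at_chart[OF c m(1) v] m(2) by simp
      then have "ip (fst (mcc c u v)) (fst (mcc c u v)) = 2 * ip (fst (mcc c u v)) (snd (mcc c u v)) \<and>
        ip (snd (mcc c u v)) (snd (mcc c u v)) = 2 * ip (fst (mcc c u v)) (snd (mcc c u v))"
        using P.pointwise_dichotomy[OF u parallel_const[OF c u] v] by blast
      then show "ip (fst (mcc c u v)) (fst (mcc c u v)) = 2 * ip (fst (mcc c u v)) (snd (mcc c u v))"
        "ip (snd (mcc c u v)) (snd (mcc c u v)) = 2 * ip (fst (mcc c u v)) (snd (mcc c u v))" by blast+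
    qed
    have "null_surface M \<A> F"
      by (rule null_surface.intro[OF surface_in_SL2_axioms], rule null_surface_axioms.intro) (rule np)
    then show thesis by (rule that(2))
  qed
qed

text \<open>The definition of a surface allows the empty one, for which all conditions are vacuous.\<close>

lemma empty_case:
  assumes "topspace M = {}"
  shows "P_tangent_to_normal \<A> F" "constant_gauss_curvature \<A> F (- 4 / 3)" "totally_geodesic \<A> F"
    "congruent_to M F Sigma3"
proof -
  have empty: "D = {}" if "(D, f) \<in> local_params \<A> F" for D f
    using local_paramsE[OF that] chart_sub assms by (metis image_is_empty subset_empty)
  show "P_tangent_to_normal \<A> F" "constant_gauss_curvature \<A> F (- 4 / 3)" "totally_geodesic \<A> F"
    unfolding P_tangent_to_normal_def constant_gauss_curvature_def totally_geodesic_def using empty by blast+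
  have "isometry (\<lambda>p. (mat 1 ** fst p ** mat 1, mat 1 ** snd p ** mat 1))"
    by (rule isometry_translation) simp_all
  then show "congruent_to M F Sigma3" unfolding congruent_to_def using assms by auto
qed

end

theorem theorem4p6:
  fixes M :: "'a topology" and \<A> :: "'a chart set" and F :: "'a \<Rightarrow> mat2_pair"
  assumes "almost_complex_surface M \<A> F"
    and "parallel_second_ff \<A> F"
  shows "(P_tangent_to_normal \<A> F \<and>
          totally_geodesic \<A> F \<and>
          constant_gauss_curvature \<A> F (- 4 / 3) \<and>
          congruent_to M F Sigma3) \<or>
         (P_preserves_tangent \<A> F \<and>
          constant_gauss_curvature \<A> F 0 \<and>
          totally_geodesic \<A> F \<and>
          (congruent_to M F Sigma1 \<or> congruent_to M F Sigma2))"
proof -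
  interpret parallel_surface M \<A> F by unfold_locales (rule assms)+
  show ?thesis
  proof (cases "topspace M = {}")
    case True
    then show ?thesis using empty_case by blast
  next
    case False
    then show ?thesis
    proof (cases rule: commuting_or_null)
      case 1
      then interpret commuting_surface M \<A> F .
      show ?thesis
        using P_preserves_tangent_commuting flat_commuting totally_geodesic_commuting
          congruent_Sigma1_or_Sigma2[OF False] by blast
    next
      case 2
      then interpret null_surface M \<A> F .
      show ?thesis
        using P_tangent_to_normal_null totally_geodesic_null constant_curvature_null congruent_Sigma3 False by blast
    qed
  qed
qed

end
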